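(* Let $\mu$ be a weight satisfying the $A_\infty$ condition, and let $1\le r_0\le p_0<\infty$, $0<q_0<s_0$ and $\alpha\in(0,p_0]$. Assume that for certain measurable functions $f$ and $g$ and for all $w\in\widehat A_{\frac{p_0}{r_0},\frac{\delta_0}{r_0}}(\mu)$, where $\delta_0$ is defined via $\frac1{\delta_0}=\frac1{q_0}-\frac1{s_0}$, there holds $$\|g\|_{L^{q_0,\infty}\left(w^{\frac{q_0}{r_0}}\mu^{\frac{q_0}{\delta_0}}\right)}\le C\,\|f\|_{L^{p_0,\alpha}\left(w^{\frac{p_0}{r_0}}\mu^{1-\frac{p_0}{r_0}}\right)}.$$ Then for $0<q<s_0$ with $$\frac1q-\frac1{q_0}=\frac1{r_0}-\frac1{p_0}$$ and all $w\in\widehat A_{1,\frac{\delta_1}{r_0}}(\mu)$, where $\frac1{\delta_1}=\frac1q-\frac1{s_0}$, we have $$\|g\|_{L^{q,\infty}\left(w^{\frac q{r_0}}\mu^{\frac q{\delta_1}}\right)}\le C\,\|f\|_{L^{r_0,\frac{\alpha r_0}{p_0}}(w)}.$$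
   Context: Functions and weights are defined on $\mathbb R^n$. A weight is an a.e. positive measurable function, identified with the measure having that density with respect to Lebesgue measure. $C$ denotes a constant, not necessarily the same at each occurrence; the statement does not specify it any further. $r'$ is the conjugate exponent of $r$, with $1'=\infty$ and $1/\infty=0$. A weight satisfies the $A_\infty$ condition if it belongs to the Muckenhoupt class $A_p$ for some $p<\infty$; in particular it then defines a doubling measure. Lorentz quasi-norms: for $0<p<\infty$ and $0<\alpha<\infty$, $\|f\|_{L^{p,\alpha}(w)}=\big(p\int_0^\infty s^{\alpha-1}\,w(\{|f|>s\})^{\alpha/p}\,ds\big)^{1/\alpha}$ (other usual normalizations differ by a constant factor), and $\|f\|_{L^{p,\infty}(w)}=\sup_{t>0}t\,w(\{|f|>t\})^{1/p}$, where $w(E)=\int_E w$. For a doubling measure $\mu$: $M_\mu g(x)=\sup_{Q\ni x}\frac1{\mu(Q)}\int_Q|g|\,d\mu$ (supremum over cubes $Q$), and $u\in A_1(\mu)$ if $\sup_Q\frac{\frac1{\mu(Q)}\int_Q u\,d\mu}{\operatorname{ess\,inf}_Q u}<\infty$. For $1\le r<\infty$, $v\in\widehat A_r(\mu)$ if and only if there exist $u_1\in A_1(\mu)$ and a function $g$ with $M_\mu g(x)<\infty$ for a.e. $x$ such that $v=u_1(M_\mu g)^{1-r}$; in particular $\widehat A_1(\mu)=A_1(\mu)$. For $0<q<\infty$ and $1\le r<\infty$, $v\in\widehat A_{r,q}(\mu)$ if and only if $v^q\in\widehat A_{1+\frac q{r'}}(\mu)$. *)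

theory Defs
  imports "HOL-Analysis.Analysis"
begin

definition weight :: "('a::euclidean_space \<Rightarrow> real) \<Rightarrow> bool" where
  "weight w \<longleftrightarrow> w \<in> borel_measurable lebesgue \<and> (AE x in lebesgue. 0 < w x)"

definition weight_measure :: "('a::euclidean_space \<Rightarrow> real) \<Rightarrow> 'a measure" where
  "weight_measure w = density lebesgue (\<lambda>x. ennreal (w x))"

(* Only used with a > 0, so that 0 is mapped to 0 and infinity to infinity. *)
definition ennreal_powr :: "ennreal \<Rightarrow> real \<Rightarrow> ennreal" where
  "ennreal_powr x a = (if x = \<infinity> then \<infinity> else ennreal (enn2real x powr a))"

definition cubes :: "'a::euclidean_space set set" where
  "cubes = {cbox a (a + l *\<^sub>R One) | a l. 0 < l}"

definition average :: "'a::euclidean_space measure \<Rightarrow> 'a set \<Rightarrow> ('a \<Rightarrow> real) \<Rightarrow> ennreal" where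
  "average M Q g = (\<integral>\<^sup>+x\<in>Q. ennreal \<bar>g x\<bar> \<partial>M) / emeasure M Q"

definition maximal_function ::
    "'a::euclidean_space measure \<Rightarrow> ('a \<Rightarrow> real) \<Rightarrow> 'a \<Rightarrow> ennreal" where
  "maximal_function M g x = (SUP Q\<in>{Q \<in> cubes. x \<in> Q}. average M Q g)"

definition ess_inf_on :: "'a::euclidean_space measure \<Rightarrow> 'a set \<Rightarrow> ('a \<Rightarrow> real) \<Rightarrow> ennreal" where
  "ess_inf_on M Q u = Sup {c. AE x in M. x \<in> Q \<longrightarrow> c \<le> ennreal (u x)}"

(* In ennreal, a / 0 is infinite for a > 0, so the essential infima are forced to be positive. *)
definition A1_class :: "'a::euclidean_space measure \<Rightarrow> ('a \<Rightarrow> real) set" where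
  "A1_class M = {u. weight u \<and> (SUP Q\<in>cubes. average M Q u / ess_inf_on M Q u) < \<infinity>}"

(* For p > 1 the exponent - 1 / (p - 1) is 1 - p', with p' the conjugate exponent of p. *)
definition Ap_class :: "real \<Rightarrow> ('a::euclidean_space \<Rightarrow> real) set" where
  "Ap_class p = (if p = 1 then A1_class lebesgue else
     {w. weight w \<and>
         (SUP Q\<in>cubes. average lebesgue Q w *
            ennreal_powr (average lebesgue Q (\<lambda>x. w x powr (- 1 / (p - 1)))) (p - 1)) < \<infinity>})"

definition A_infinity :: "('a::euclidean_space \<Rightarrow> real) set" where
  "A_infinity = (\<Union>p\<in>{1..}. Ap_class p)"

(* An identity between weights holds almost everywhere.  For r > 1 the function g cannot vanish
   almost everywhere: 0 powr (1 - r) = 0, which would contradict the positivity of v. *)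
definition hat_A :: "real \<Rightarrow> 'a::euclidean_space measure \<Rightarrow> ('a \<Rightarrow> real) set" where
  "hat_A r M = {v. weight v \<and>
     (\<exists>u\<in>A1_class M. \<exists>g\<in>borel_measurable lebesgue.
        (AE x in M. maximal_function M g x < \<infinity>) \<and>
        (AE x in M. v x = u x * enn2real (maximal_function M g x) powr (1 - r)))}"

definition conjugate_exponent :: "real \<Rightarrow> ereal" where
  "conjugate_exponent r = (if r = 1 then \<infinity> else ereal (r / (r - 1)))"

definition hat_A_off :: "real \<Rightarrow> real \<Rightarrow> 'a::euclidean_space measure \<Rightarrow> ('a \<Rightarrow> real) set" where
  "hat_A_off r q M = {v. weight v \<and>
     (\<lambda>x. v x powr q) \<in> hat_A (1 + real_of_ereal (ereal q / conjugate_exponent r)) M}"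

definition lorentz_norm ::
    "real \<Rightarrow> real \<Rightarrow> ('a::euclidean_space \<Rightarrow> real) \<Rightarrow> ('a \<Rightarrow> 'b::real_normed_vector) \<Rightarrow> ennreal" where
  "lorentz_norm p \<alpha> w f =
     ennreal_powr
       (ennreal p *
        (\<integral>\<^sup>+s\<in>{0<..}. ennreal (s powr (\<alpha> - 1)) *
            ennreal_powr (emeasure (weight_measure w) {x. s < norm (f x)}) (\<alpha> / p) \<partial>lborel))
       (1 / \<alpha>)"

definition weak_lorentz_norm ::
    "real \<Rightarrow> ('a::euclidean_space \<Rightarrow> real) \<Rightarrow> ('a \<Rightarrow> 'b::real_normed_vector) \<Rightarrow> ennreal" where
  "weak_lorentz_norm p w f =
     (SUP t\<in>{0<..}. ennreal t *
        ennreal_powr (emeasure (weight_measure w) {x. t < norm (f x)}) (1 / p))"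

end

theory Submission
  imports Defs
begin

text \<open>
  The constant in the hypothesis may depend on the weight, so a single weight has to serve a whole
  sequence of bad pairs. If the conclusion fails, rescaling gives pairs \<open>(f\<^sub>k, g\<^sub>k)\<close> with \<open>f\<^sub>k\<close> in the
  unit ball of \<open>L\<^bsup>r\<^sub>0,\<alpha>r\<^sub>0/p\<^sub>0\<^esup>(w) \<subseteq> L\<^bsup>r\<^sub>0\<^esup>(w)\<close> and with the norm of \<open>g\<^sub>k\<close> exceeding a prescribed power of \<open>2\<^sup>k\<close>.
  Write \<open>w\<^bsup>\<delta>\<^sub>1/r\<^sub>0\<^esup> = v \<in> A\<^sub>1(\<mu>)\<close>, \<open>m = v \<mu>\<close> and \<open>h = \<one>\<^sub>Q + \<Sum> 2\<^bsup>-k\<^esup> |f\<^sub>k|\<^bsup>r\<^sub>0\<^esup> w / m\<close> for a cube \<open>Q\<close>, so that \<open>h\<close> is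
  integrable with respect to \<open>m\<close>, and test the hypothesis with
  \<open>w\<^sub>0 = v\<^bsup>r\<^sub>0/\<delta>\<^sub>0\<^esup> (M\<^sub>\<mu> h)\<^bsup>-(1 - r\<^sub>0/p\<^sub>0)\<^esup>\<close>. As \<open>M\<^sub>\<mu> h \<ge> h\<close> almost everywhere, the norm of \<open>f\<^sub>k\<close> on the right hand
  side of the hypothesis grows at most like a fixed power of \<open>2\<^sup>k\<close>. On the left hand side one splits
  \<open>{|g\<^sub>k| > t}\<close> along \<open>m\<^sup>\<sigma> M\<^sub>\<mu> h = t\<^sup>q\<close> with \<open>\<sigma> = q / s\<^sub>0\<close>, which needs the mixed weak type inequality
  \<open>m\<^bsup>1-\<sigma>\<^esup>({m\<^sup>\<sigma> M\<^sub>\<mu> h > \<lambda>}) \<le> C/\<lambda> \<integral> |h| m\<close>. The latter rests on the reverse Hoelder inequality for \<open>m\<close>.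
\<close>

section \<open>Cubes and the Vitali covering lemma\<close>

text \<open>The hypothesis forces the test weight to be built from M_\<mu>, whereas h is only known
  to be integrable with respect to m = v \<mu>. The A_1 condition bridges the gap through M_\<mu> h
  \<le> A M_m h, so finiteness and weak type need to be known only for M_m. The weight in the
  conclusion is m^(1-\<sigma>). For s_0 = \<infinity> one has \<sigma> = 0 and the ordinary weak
  type inequality for m is enough; for \<sigma> > 0 the factor m^\<sigma> enters the level set, and
  this is the obstacle that calls for reverse Hoelder. The prescribed growth comes from the factors
  2^(-k) in h: they cost 2^(k \<kappa>) in the hypothesis, \<kappa> = 1/r_0 - 1/p_0, hence 2^(k c)
  after taking the q_0-th power, where c = \<kappa> q_0 = q_0/q - 1. A bad pair whose norm has a
  q-th power above 2^(k (c+1)) therefore gives 2^k below a fixed constant, which fails for large k.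
  The second Lorentz index \<alpha> r_0/p_0 is the one that appears when W \<le> B s^(-(p_0-r_0)) w
  on {|f| > s} is inserted into the Lorentz integral with indices p_0 and \<alpha>.\<close>

definition cube :: "'a::euclidean_space \<times> real \<Rightarrow> 'a set" where
  "cube p = cbox (fst p) (fst p + snd p *\<^sub>R One)"

text \<open>The concentric cube of three times the side length. Cubes are handled through lower
  corner and side length, so that dilations act on these data and the Vitali selection can compare
  sizes.\<close>

definition triple :: "'a::euclidean_space \<times> real \<Rightarrow> 'a \<times> real" where
  "triple p = (fst p - snd p *\<^sub>R One, 3 * snd p)"

lemma mem_cube: "x \<in> cube p \<longleftrightarrow> (\<forall>i\<in>Basis. fst p \<bullet> i \<le> x \<bullet> i \<and> x \<bullet> i \<le> fst p \<bullet> i + snd p)"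
  by (auto simp: cube_def mem_box inner_simps)

lemma mem_interior_cube:
  "x \<in> interior (cube p) \<longleftrightarrow> (\<forall>i\<in>Basis. fst p \<bullet> i < x \<bullet> i \<and> x \<bullet> i < fst p \<bullet> i + snd p)"
  by (auto simp: cube_def interior_cbox mem_box inner_simps)

lemma in_cubes_iff: "Q \<in> cubes \<longleftrightarrow> (\<exists>p. 0 < snd p \<and> Q = cube p)"
  by (auto simp: cubes_def cube_def)

lemma cube_in_cubes [simp]: "0 < snd p \<Longrightarrow> cube p \<in> cubes"
  unfolding in_cubes_iff by blast

lemma cube_sets [measurable, simp]: "cube p \<in> sets lebesgue"
  by (auto simp: cube_def)

lemma snd_triple [simp]: "snd (triple p) = 3 * snd p"
  by (simp add: triple_def)

lemma cube_subset_triple: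
  assumes "cube p \<inter> cube q \<noteq> {}" "snd p \<le> snd q"
  shows "cube p \<subseteq> cube (triple q)"
proof -
  obtain z where z: "z \<in> cube p" "z \<in> cube q"
    using assms by auto
  show ?thesis
  proof
    fix x assume x: "x \<in> cube p"
    { fix i :: 'a assume i: "i \<in> Basis"
      have "fst p \<bullet> i \<le> x \<bullet> i" "x \<bullet> i \<le> fst p \<bullet> i + snd p" "fst p \<bullet> i \<le> z \<bullet> i" "z \<bullet> i \<le> fst p \<bullet> i + snd p"
        "fst q \<bullet> i \<le> z \<bullet> i" "z \<bullet> i \<le> fst q \<bullet> i + snd q"
        using i x z by (auto simp: mem_cube)
      then have "fst q \<bullet> i - snd q \<le> x \<bullet> i" "x \<bullet> i \<le> fst q \<bullet> i - snd q + 3 * snd q"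
        using assms(2) by auto }
    then show "x \<in> cube (triple q)"
      by (simp add: mem_cube triple_def inner_diff_left)
  qed
qed

lemma cube_ne: "0 < snd p \<Longrightarrow> cube p \<noteq> {}"
proof -
  assume "0 < snd p"
  then have "fst p \<in> cube p" by (simp add: mem_cube)
  then show ?thesis by blast
qed

text \<open>Greedy selection: a largest cube is kept, every cube meeting it lies in its triple, and
  the induction continues with the cubes disjoint from it.\<close>

lemma vitali_finite:
  fixes S :: "('a::euclidean_space \<times> real) set"
  assumes "finite S" "\<And>p. p \<in> S \<Longrightarrow> 0 < snd p"
  shows "\<exists>T\<subseteq>S. disjoint_family_on cube T \<and> (\<forall>p\<in>S. \<exists>q\<in>T. cube p \<subseteq> cube (triple q))"
  using assms
proof (induction S rule: finite_psubset_induct)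
  case (psubset S)
  show ?case
  proof (cases "S = {}")
    case False
    obtain q where q: "q \<in> S" "\<And>p. p \<in> S \<Longrightarrow> snd p \<le> snd q"
      using finite_imageI[OF \<open>finite S\<close>, of snd] False Max_in[of "snd ` S"] Max_ge[of "snd ` S"]
      by (metis (no_types, lifting) image_iff image_is_empty)
    let ?S' = "{p\<in>S. cube p \<inter> cube q = {}}"
    have "?S' \<subset> S"
      using q(1) cube_ne[of q] psubset.prems by auto
    from psubset.IH[OF this] psubset.prems obtain T where
      T: "T \<subseteq> ?S'" "disjoint_family_on cube T" "\<And>p. p \<in> ?S' \<Longrightarrow> \<exists>q\<in>T. cube p \<subseteq> cube (triple q)"
      by auto
    have "disjoint_family_on cube (insert q T)"
      using T(1,2) unfolding disjoint_family_on_def by blast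
    moreover have "\<exists>r\<in>insert q T. cube p \<subseteq> cube (triple r)" if "p \<in> S" for p
      using T(3)[of p] cube_subset_triple[of p q] q(2)[of p] that by blast
    ultimately show ?thesis
      using T(1) q(1) by (intro exI[of _ "insert q T"]) blast
  qed (auto simp: disjoint_family_on_def)
qed

text \<open>Two measures occur because the K-mass of a triple is compared with the L-mass of the
  cube: for weak type, L has the density |g|; for reverse Hoelder, it is Lebesgue measure on a level
  set. Interiors make the union open, so that Lindelof reduces it to a countable union and
  continuity from below to finite ones.\<close>

lemma vitali_bound:
  fixes K L :: "'a::euclidean_space measure"
  assumes K: "sets K = sets lebesgue" and L: "sets L = sets lebesgue"
    and C: "\<And>p. p \<in> C \<Longrightarrow> 0 < snd p"
    and bnd: "\<And>p. p \<in> C \<Longrightarrow> emeasure K (cube (triple p)) \<le> c * emeasure L (cube p)"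
  shows "emeasure K (\<Union>p\<in>C. interior (cube p)) \<le> c * emeasure L (space L)"
proof -
  have spL: "space L = UNIV" using sets_eq_imp_space_eq[OF L] by simp
  have "\<And>S. S \<in> (\<lambda>p. interior (cube p)) ` C \<Longrightarrow> open S" by auto
  from Lindelof[OF this] obtain F where F: "F \<subseteq> (\<lambda>p. interior (cube p)) ` C" "countable F"
      "\<Union>F = (\<Union>p\<in>C. interior (cube p))"
    by metis
  then obtain C' where C': "C' \<subseteq> C" "countable C'" "F = (\<lambda>p. interior (cube p)) ` C'"
    by (metis countable_subset_image)
  have fin: "emeasure K (\<Union>p\<in>S. interior (cube p)) \<le> c * emeasure L (space L)"
    if S: "finite S" "S \<subseteq> C" for S
  proof -
    from vitali_finite[of S] S C obtain T where T: "T \<subseteq> S" "disjoint_family_on cube T"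
        "\<And>p. p \<in> S \<Longrightarrow> \<exists>q\<in>T. cube p \<subseteq> cube (triple q)"
      by (metis subsetD)
    have finT: "finite T" using T S finite_subset by auto
    have "emeasure K (\<Union>p\<in>S. interior (cube p)) \<le> emeasure K (\<Union>q\<in>T. cube (triple q))"
    proof (rule emeasure_mono)
      show "(\<Union>p\<in>S. interior (cube p)) \<subseteq> (\<Union>q\<in>T. cube (triple q))"
        using T(3) interior_subset by fastforce
      show "(\<Union>q\<in>T. cube (triple q)) \<in> sets K"
        using finT by (auto simp: K)
    qed
    also have "\<dots> \<le> (\<Sum>q\<in>T. emeasure K (cube (triple q)))"
      using finT by (intro emeasure_subadditive_finite) (auto simp: K)
    also have "\<dots> \<le> (\<Sum>q\<in>T. c * emeasure L (cube q))"
      using bnd T(1) S(2) by (intro sum_mono) blast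
    also have "\<dots> = c * emeasure L (\<Union>q\<in>T. cube q)"
      using finT T(2) by (subst sum_emeasure[symmetric]) (auto simp: L sum_distrib_left)
    also have "\<dots> \<le> c * emeasure L (space L)"
      by (intro mult_left_mono emeasure_mono) (auto simp: spL L)
    finally show ?thesis .
  qed
  show ?thesis
  proof (cases "C' = {}")
    case True
    then show ?thesis using C' F by simp
  next
    case False
    define e where "e = from_nat_into C'"
    have e: "range e = C'" using C' False by (simp add: e_def range_from_nat_into)
    define A where "A n = (\<Union>p\<in>e ` {..<n}. interior (cube p))" for n :: nat
    have "(\<Union>p\<in>C. interior (cube p)) = \<Union>F" using F by simp
    also have "\<dots> = (\<Union>p\<in>range e. interior (cube p))" using C' e by simp
    also have "\<dots> = (\<Union>n. A n)"
      unfolding A_def by (auto intro: lessI)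
    finally have "emeasure K (\<Union>p\<in>C. interior (cube p)) = emeasure K (\<Union>n. A n)" by simp
    also have "\<dots> = (SUP n. emeasure K (A n))"
    proof (rule SUP_emeasure_incseq[symmetric])
      show "range A \<subseteq> sets K" unfolding A_def by (auto simp: K)
      show "incseq A" unfolding A_def incseq_def by force
    qed
    also have "\<dots> \<le> c * emeasure L (space L)"
    proof (rule SUP_least)
      fix n
      show "emeasure K (A n) \<le> c * emeasure L (space L)"
        unfolding A_def by (rule fin) (use e C' in auto)
    qed
    finally show ?thesis .
  qed
qed

section \<open>The maximal function of a doubling measure\<close>

lemma ennreal_less_divide_iff:
  fixes a b t :: ennreal
  assumes "0 < b" "b < \<infinity>"
  shows "t < a / b \<longleftrightarrow> t * b < a"
proof -
  have "a / b \<le> t \<longleftrightarrow> a \<le> t * b"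
  proof
    assume "a / b \<le> t"
    then have "a / b * b \<le> t * b" by (rule mult_right_mono) simp
    then show "a \<le> t * b" using assms by (simp add: ennreal_divide_times)
  next
    assume "a \<le> t * b"
    then show "a / b \<le> t" using assms by (intro divide_le_posI_ennreal) (auto simp: mult.commute)
  qed
  then show ?thesis by (meson not_le)
qed

text \<open>\<open>null_sets_K\<close> says that K is absolutely continuous. Differentiation relies
  on it, since there Lebesgue sets are approximated by F_sigma sets up to a Lebesgue null
  set.\<close>

locale doubling_measure =
  fixes K :: "'a::euclidean_space measure" and D :: real
  assumes sets_K [measurable_cong, simp]: "sets K = sets lebesgue"
    and cube_pos: "0 < snd p \<Longrightarrow> 0 < emeasure K (cube p)"
    and cube_finite: "0 < snd p \<Longrightarrow> emeasure K (cube p) < \<infinity>"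
    and doubling: "0 < snd p \<Longrightarrow> emeasure K (cube (triple p)) \<le> ennreal D * emeasure K (cube p)"
    and D_nonneg: "0 \<le> D"
    and null_sets_K: "N \<in> null_sets lebesgue \<Longrightarrow> N \<in> null_sets K"
begin

lemma space_K [simp]: "space K = UNIV"
  using sets_eq_imp_space_eq[OF sets_K] by simp

lemma measurable_K: "f \<in> borel_measurable K \<longleftrightarrow> f \<in> borel_measurable lebesgue"
  by (intro iffI) (auto cong: measurable_cong_sets)

lemma sigma_finite_K: "sigma_finite_measure K"
proof
  define C where "C n = cube (- (real n *\<^sub>R One) :: 'a, 2 * real (Suc n))" for n
  have "x \<in> (\<Union>n. C n)" for x :: 'a
  proof -
    obtain n where "norm x \<le> real n" using real_arch_simple by blast
    have "\<bar>x \<bullet> i\<bar> \<le> real n" if "i \<in> Basis" for i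
      using Basis_le_norm[OF that, of x] \<open>norm x \<le> real n\<close> by linarith
    then have "x \<in> C n"
      unfolding C_def mem_cube by (auto simp: abs_le_iff) (smt (verit))+
    then show ?thesis by blast
  qed
  moreover have "emeasure K (C n) \<noteq> \<infinity>" for n
    unfolding C_def using cube_finite[of "(- (real n *\<^sub>R One) :: 'a, 2 * real (Suc n))"] by simp
  ultimately show "\<exists>A. countable A \<and> A \<subseteq> sets K \<and> \<Union>A = space K \<and> (\<forall>a\<in>A. emeasure K a \<noteq> \<infinity>)"
    by (intro exI[of _ "range C"]) (auto simp: C_def)
qed

lemma maximal_function_greater_iff:
  "t < maximal_function K g x \<longleftrightarrow>
     (\<exists>p. 0 < snd p \<and> x \<in> cube p \<and> t * emeasure K (cube p) < (\<integral>\<^sup>+y\<in>cube p. ennreal \<bar>g y\<bar> \<partial>K))"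
proof -
  have "t < maximal_function K g x \<longleftrightarrow> (\<exists>Q\<in>cubes. x \<in> Q \<and> t < average K Q g)"
    by (auto simp: maximal_function_def less_SUP_iff)
  also have "\<dots> \<longleftrightarrow> (\<exists>p. 0 < snd p \<and> x \<in> cube p \<and> t < average K (cube p) g)"
    using cube_in_cubes by (metis in_cubes_iff)
  finally show ?thesis
    unfolding average_def using ennreal_less_divide_iff[OF cube_pos cube_finite] by blast
qed

lemma maximal_function_ge:
  assumes "0 < snd p" "x \<in> cube p"
  shows "average K (cube p) g \<le> maximal_function K g x"
  unfolding maximal_function_def by (rule SUP_upper) (use assms in simp)

text \<open>The maximal function uses closed cubes. A strict inequality survives a slight
  enlargement, by continuity from above along cubes decreasing to the given one, so the point may be
  taken in the interior; this makes superlevel sets open.\<close>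

lemma enlarge_cube:
  assumes p: "0 < snd p" and t: "t * emeasure K (cube p) < (\<integral>\<^sup>+y\<in>cube p. ennreal \<bar>g y\<bar> \<partial>K)"
    and top: "t < \<infinity>" and [measurable]: "g \<in> borel_measurable lebesgue"
  shows "\<exists>q. 0 < snd q \<and> cube p \<subseteq> interior (cube q) \<and>
           t * emeasure K (cube q) < (\<integral>\<^sup>+y\<in>cube q. ennreal \<bar>g y\<bar> \<partial>K)"
proof -
  define d where "d n = inverse (real (Suc n))" for n
  have d: "0 < d n" for n by (simp add: d_def)
  define q where "q n = (fst p - d n *\<^sub>R One, snd p + 2 * d n)" for n
  have q: "0 < snd (q n)" for n using p d[of n] by (simp add: q_def)
  have sub: "cube p \<subseteq> interior (cube (q n))" for n
  proof
    fix x assume x: "x \<in> cube p"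
    show "x \<in> interior (cube (q n))"
      unfolding mem_interior_cube
    proof
      fix i :: 'a assume i: "i \<in> Basis"
      then show "fst (q n) \<bullet> i < x \<bullet> i \<and> x \<bullet> i < fst (q n) \<bullet> i + snd (q n)"
        using x[unfolded mem_cube, rule_format, OF i] d[of n] by (simp add: q_def inner_diff_left)
    qed
  qed
  have dec: "decseq (\<lambda>n. cube (q n))"
  proof (rule decseq_SucI, rule subsetI)
    fix n x assume x: "x \<in> cube (q (Suc n))"
    have "d (Suc n) \<le> d n" by (simp add: d_def)
    show "x \<in> cube (q n)"
      unfolding mem_cube
    proof
      fix i :: 'a assume i: "i \<in> Basis"
      then show "fst (q n) \<bullet> i \<le> x \<bullet> i \<and> x \<bullet> i \<le> fst (q n) \<bullet> i + snd (q n)"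
        using x[unfolded mem_cube, rule_format, OF i] \<open>d (Suc n) \<le> d n\<close>
        by (simp add: q_def inner_diff_left)
    qed
  qed
  have Int: "(\<Inter>n. cube (q n)) = cube p"
  proof (intro equalityI subsetI INT_I)
    fix x assume x: "x \<in> (\<Inter>n. cube (q n))"
    have lim: "d \<longlonglongrightarrow> 0" unfolding d_def by (rule LIMSEQ_inverse_real_of_nat)
    show "x \<in> cube p"
      unfolding mem_cube
    proof (intro ballI conjI)
      fix i :: 'a assume i: "i \<in> Basis"
      have 1: "fst p \<bullet> i - d n \<le> x \<bullet> i" "x \<bullet> i \<le> fst p \<bullet> i + snd p + d n" for n
      proof -
        have "x \<in> cube (q n)" using x by blast
        from this[unfolded mem_cube, rule_format, OF i] i
        show "fst p \<bullet> i - d n \<le> x \<bullet> i" "x \<bullet> i \<le> fst p \<bullet> i + snd p + d n"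
          by (auto simp: q_def inner_diff_left)
      qed
      have "(\<lambda>n. fst p \<bullet> i - d n) \<longlonglongrightarrow> fst p \<bullet> i - 0"
        by (intro tendsto_intros lim)
      then show "fst p \<bullet> i \<le> x \<bullet> i" using 1(1) by (simp add: LIMSEQ_le_const2)
      have "(\<lambda>n. fst p \<bullet> i + snd p + d n) \<longlonglongrightarrow> fst p \<bullet> i + snd p + 0"
        by (intro tendsto_intros lim)
      then show "x \<bullet> i \<le> fst p \<bullet> i + snd p" using 1(2) by (simp add: LIMSEQ_le_const)
    qed
  qed (use sub interior_subset in blast)
  have "(\<lambda>n. emeasure K (cube (q n))) \<longlonglongrightarrow> emeasure K (\<Inter>n. cube (q n))"
    using cube_finite[OF q] dec by (intro Lim_emeasure_decseq) (auto simp: less_top)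
  then have "(\<lambda>n. t * emeasure K (cube (q n))) \<longlonglongrightarrow> t * emeasure K (cube p)"
    using top unfolding Int by (intro ennreal_tendsto_cmult) auto
  from order_tendstoD(2)[OF this t] obtain n where
    "t * emeasure K (cube (q n)) < (\<integral>\<^sup>+y\<in>cube p. ennreal \<bar>g y\<bar> \<partial>K)"
    by (auto simp: eventually_sequentially)
  also have "\<dots> \<le> (\<integral>\<^sup>+y\<in>cube (q n). ennreal \<bar>g y\<bar> \<partial>K)"
    using sub[of n] interior_subset by (intro nn_integral_mono) (auto simp: indicator_def)
  finally show ?thesis using sub q by blast
qed

lemma superlevel_set_eq:
  assumes "g \<in> borel_measurable lebesgue"
  shows "{x. t < maximal_function K g x} =
     (\<Union>p\<in>{p. 0 < snd p \<and> t * emeasure K (cube p) < (\<integral>\<^sup>+y\<in>cube p. ennreal \<bar>g y\<bar> \<partial>K)}. interior (cube p))"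
proof (intro set_eqI iffI)
  fix x assume x: "x \<in> {x. t < maximal_function K g x}"
  then obtain p where p: "0 < snd p" "x \<in> cube p" "t * emeasure K (cube p) < (\<integral>\<^sup>+y\<in>cube p. ennreal \<bar>g y\<bar> \<partial>K)"
    using maximal_function_greater_iff by auto
  have "t < \<infinity>"
    using x by (metis mem_Collect_eq infinity_ennreal_def less_le_trans top_greatest)
  from enlarge_cube[OF p(1,3) this assms] p(2)
  show "x \<in> (\<Union>p\<in>{p. 0 < snd p \<and> t * emeasure K (cube p) < (\<integral>\<^sup>+y\<in>cube p. ennreal \<bar>g y\<bar> \<partial>K)}. interior (cube p))"
    by blast
next
  fix x assume "x \<in> (\<Union>p\<in>{p. 0 < snd p \<and> t * emeasure K (cube p) < (\<integral>\<^sup>+y\<in>cube p. ennreal \<bar>g y\<bar> \<partial>K)}. interior (cube p))"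
  then show "x \<in> {x. t < maximal_function K g x}"
    using interior_subset by (subst mem_Collect_eq, subst maximal_function_greater_iff) blast
qed

lemma open_superlevel_set:
  assumes "g \<in> borel_measurable lebesgue"
  shows "open {x. t < maximal_function K g x}"
  unfolding superlevel_set_eq[OF assms] by auto

lemma borel_measurable_maximal_function:
  assumes "g \<in> borel_measurable lebesgue"
  shows "maximal_function K g \<in> borel_measurable borel"
proof (rule borel_measurableI_greater)
  fix t
  show "{x \<in> space borel. t < maximal_function K g x} \<in> sets borel"
    using open_superlevel_set[OF assms] by simp
qed

lemma borel_measurable_lebesgue_maximal_function [measurable]:
  assumes "g \<in> borel_measurable lebesgue"
  shows "maximal_function K g \<in> borel_measurable lebesgue"
  using borel_measurable_maximal_function[OF assms] measurable_completion[of _ lborel] by auto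

text \<open>Vitali with L = |g| K: a cube whose average exceeds t satisfies K(triple) \<le> D
  K(cube) \<le> (D/t) L(cube).\<close>

lemma weak_type:
  assumes g [measurable]: "g \<in> borel_measurable lebesgue" and t: "0 < t"
  shows "ennreal t * emeasure K {x. ennreal t < maximal_function K g x}
           \<le> ennreal D * (\<integral>\<^sup>+x. ennreal \<bar>g x\<bar> \<partial>K)"
proof -
  let ?L = "density K (\<lambda>x. ennreal \<bar>g x\<bar>)"
  have gK [measurable]: "g \<in> borel_measurable K" by (simp add: measurable_K)
  have "emeasure K {x. ennreal t < maximal_function K g x} \<le> ennreal (D / t) * emeasure ?L (space ?L)"
    unfolding superlevel_set_eq[OF g]
  proof (rule vitali_bound)
    fix p :: "'a \<times> real"
    assume p: "p \<in> {p. 0 < snd p \<and> ennreal t * emeasure K (cube p) < (\<integral>\<^sup>+y\<in>cube p. ennreal \<bar>g y\<bar> \<partial>K)}"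
    then have "emeasure K (cube (triple p)) \<le> ennreal D * emeasure K (cube p)" using doubling by simp
    also have "\<dots> = ennreal (D / t) * (ennreal t * emeasure K (cube p))"
      using t D_nonneg by (simp add: mult.assoc[symmetric] ennreal_mult[symmetric])
    also have "\<dots> \<le> ennreal (D / t) * (\<integral>\<^sup>+y\<in>cube p. ennreal \<bar>g y\<bar> \<partial>K)"
      using p by (intro mult_left_mono) auto
    also have "\<dots> = ennreal (D / t) * emeasure ?L (cube p)"
      by (subst emeasure_density) auto
    finally show "emeasure K (cube (triple p)) \<le> ennreal (D / t) * emeasure ?L (cube p)" .
  qed auto
  then have "ennreal t * emeasure K {x. ennreal t < maximal_function K g x}
      \<le> ennreal t * (ennreal (D / t) * emeasure ?L (space ?L))"
    by (rule mult_left_mono) simp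
  also have "\<dots> = ennreal D * emeasure ?L (space ?L)"
    using t D_nonneg by (simp add: mult.assoc[symmetric] ennreal_mult[symmetric])
  also have "emeasure ?L (space ?L) = (\<integral>\<^sup>+x. ennreal \<bar>g x\<bar> \<partial>K)"
    by (subst emeasure_density) auto
  finally show ?thesis .
qed

end

section \<open>Powers of extended nonnegative numbers and the layer cake formula\<close>

lemma ennreal_powr_ennreal: "0 \<le> r \<Longrightarrow> ennreal_powr (ennreal r) c = ennreal (r powr c)"
  by (simp add: ennreal_powr_def)

lemma ennreal_powr_top [simp]: "ennreal_powr \<infinity> c = \<infinity>" "ennreal_powr top c = top"
  by (simp_all add: ennreal_powr_def)

lemma ennreal_powr_0 [simp]: "ennreal_powr 0 c = 0"
  by (simp add: ennreal_powr_def)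

lemma borel_measurable_ennreal_powr [measurable]:
  "(\<lambda>x. ennreal_powr x c) \<in> borel_measurable borel"
  unfolding ennreal_powr_def by measurable

text \<open>The inner integral of the layer cake formula, with the value \<infinity>
  included.\<close>

lemma nn_integral_powr_kernel:
  assumes c: "0 < c"
  shows "(\<integral>\<^sup>+t\<in>{0<..}. ennreal (c * t powr (c - 1)) * indicator {t. ennreal t < y} t \<partial>lborel) = ennreal_powr y c"
    (is "?I y = _")
proof -
  have fin: "?I (ennreal r) = ennreal (r powr c)" if r: "0 \<le> r" for r
  proof -
    have "((\<lambda>t. c * t powr (c - 1)) has_integral c * (r powr ((c - 1) + 1) / ((c - 1) + 1))) {0..r}"
      using c r by (intro has_integral_mult_right has_integral_powr_from_0) auto
    then have "((\<lambda>t. c * t powr (c - 1)) has_integral r powr c) {0..r}" using c by simp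
    from nn_integral_has_integral_lebesgue[OF _ this]
    have *: "(\<integral>\<^sup>+t. ennreal (indicator {0..r} t * (c * t powr (c - 1))) \<partial>lborel) = ennreal (r powr c)"
      using c by auto
    have "?I (ennreal r) = (\<integral>\<^sup>+t. ennreal (indicator {0..r} t * (c * t powr (c - 1))) \<partial>lborel)"
    proof (rule nn_integral_cong_AE)
      have "AE t in lborel. t \<noteq> r" by (rule AE_lborel_singleton)
      then show "AE t in lborel. ennreal (c * t powr (c - 1)) * indicator {t. ennreal t < ennreal r} t * indicator {0<..} t =
                 ennreal (indicator {0..r} t * (c * t powr (c - 1)))"
        by eventually_elim (use r c in \<open>auto simp: indicator_def ennreal_less_iff not_less\<close>)
    qed
    with * show ?thesis by simp
  qed
  show ?thesis
  proof (cases y)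
    case (real r)
    then show ?thesis using fin by (simp add: ennreal_powr_ennreal)
  next
    case top
    \<comment> \<open>The integral dominates r^c for every r, so it cannot equal a finite u: take r
      = (u + 1)^(1/c).\<close>
    have ge: "ennreal (r powr c) \<le> ?I top" if "0 \<le> r" for r
      unfolding fin[OF that, symmetric]
      by (intro nn_integral_mono mult_right_mono mult_left_mono)
         (auto simp: indicator_def less_top[symmetric])
    have "?I top = top"
    proof (cases "?I top")
      case (real u)
      have "ennreal (((u + 1) powr (1 / c)) powr c) \<le> ennreal u"
        using ge[of "(u + 1) powr (1 / c)"] real by simp
      moreover have "((u + 1) powr (1 / c)) powr c = u + 1"
        using c real by (simp add: powr_powr)
      ultimately show ?thesis using real by (simp add: ennreal_le_iff2)
    qed
    then show ?thesis using top by simp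
  qed
qed

text \<open>Tonelli's theorem applied to the kernel above; sigma-finiteness is there for this
  exchange.\<close>

lemma layer_cake:
  fixes G :: "'a \<Rightarrow> ennreal"
  assumes M: "sigma_finite_measure M" and G [measurable]: "G \<in> borel_measurable M" and c: "0 < c"
  shows "(\<integral>\<^sup>+x. ennreal_powr (G x) c \<partial>M) =
    (\<integral>\<^sup>+t\<in>{0<..}. ennreal (c * t powr (c - 1)) * emeasure M {x\<in>space M. ennreal t < G x} \<partial>lborel)"
proof -
  interpret pair_sigma_finite lborel M
    using M sigma_finite_lborel by (simp add: pair_sigma_finite_def)
  have "(\<integral>\<^sup>+x. ennreal_powr (G x) c \<partial>M) =
      (\<integral>\<^sup>+x. \<integral>\<^sup>+t. ennreal (c * t powr (c - 1)) * indicator {t. ennreal t < G x} t * indicator {0<..} t \<partial>lborel \<partial>M)"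
    by (simp add: nn_integral_powr_kernel[OF c])
  also have "\<dots> = (\<integral>\<^sup>+t. \<integral>\<^sup>+x. ennreal (c * t powr (c - 1)) * indicator {t. ennreal t < G x} t * indicator {0<..} t \<partial>M \<partial>lborel)"
    by (rule Fubini') (simp add: indicator_def cong: if_cong)
  also have "\<dots> = (\<integral>\<^sup>+t\<in>{0<..}. ennreal (c * t powr (c - 1)) * emeasure M {x\<in>space M. ennreal t < G x} \<partial>lborel)"
  proof (rule nn_integral_cong)
    fix t :: real
    have "(\<integral>\<^sup>+x. ennreal (c * t powr (c - 1)) * indicator {t. ennreal t < G x} t * indicator {0<..} t \<partial>M) =
       (\<integral>\<^sup>+x. ennreal (c * t powr (c - 1)) * indicator {0<..} t * indicator {x\<in>space M. ennreal t < G x} x \<partial>M)"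
      by (intro nn_integral_cong) (auto simp: indicator_def)
    also have "\<dots> = ennreal (c * t powr (c - 1)) * indicator {0<..} t * emeasure M {x\<in>space M. ennreal t < G x}"
      by (intro nn_integral_cmult_indicator) simp
    finally show "(\<integral>\<^sup>+x. ennreal (c * t powr (c - 1)) * indicator {t. ennreal t < G x} t * indicator {0<..} t \<partial>M) =
       ennreal (c * t powr (c - 1)) * emeasure M {x\<in>space M. ennreal t < G x} * indicator {0<..} t"
      by (simp add: ac_simps)
  qed
  finally show ?thesis .
qed

section \<open>Strong type estimates\<close>

context doubling_measure
begin

text \<open>The part of g with 2 |g| \<le> t contributes at most t/2 to an average, so an average
  above t forces the average of the remaining part \<open>g1\<close> above t/2.\<close>

lemma weak_type_truncated:
  assumes g [measurable]: "g \<in> borel_measurable lebesgue" and t: "0 < t"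
  shows "ennreal t * emeasure K {x. ennreal t < maximal_function K g x}
           \<le> ennreal (2 * D) * (\<integral>\<^sup>+x. ennreal \<bar>g x\<bar> * indicator {x. t < 2 * \<bar>g x\<bar>} x \<partial>K)"
proof -
  define g1 where "g1 x = g x * indicator {x. t < 2 * \<bar>g x\<bar>} x" for x
  have g1 [measurable]: "g1 \<in> borel_measurable lebesgue" unfolding g1_def by measurable
  have gK [measurable]: "g \<in> borel_measurable K" "g1 \<in> borel_measurable K"
    by (simp_all add: measurable_K)
  have "{x. ennreal t < maximal_function K g x} \<subseteq> {x. ennreal (t / 2) < maximal_function K g1 x}"
  proof (intro subsetI CollectI)
    fix x assume "x \<in> {x. ennreal t < maximal_function K g x}"
    then obtain p where p: "0 < snd p" "x \<in> cube p"
        "ennreal t * emeasure K (cube p) < (\<integral>\<^sup>+y\<in>cube p. ennreal \<bar>g y\<bar> \<partial>K)"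
      using maximal_function_greater_iff by auto
    have "(\<integral>\<^sup>+y\<in>cube p. ennreal \<bar>g y\<bar> \<partial>K)
        \<le> (\<integral>\<^sup>+y. ennreal \<bar>g1 y\<bar> * indicator (cube p) y + ennreal (t / 2) * indicator (cube p) y \<partial>K)"
    proof (rule nn_integral_mono)
      fix y
      have "\<bar>g y\<bar> \<le> \<bar>g1 y\<bar> + t / 2" using t by (auto simp: g1_def indicator_def)
      then have "ennreal \<bar>g y\<bar> \<le> ennreal \<bar>g1 y\<bar> + ennreal (t / 2)"
        using t ennreal_leI by (fastforce simp: ennreal_plus[symmetric] simp del: ennreal_plus)
      then show "ennreal \<bar>g y\<bar> * indicator (cube p) y \<le>
          ennreal \<bar>g1 y\<bar> * indicator (cube p) y + ennreal (t / 2) * indicator (cube p) y"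
        by (auto simp: indicator_def)
    qed
    also have "\<dots> = (\<integral>\<^sup>+y\<in>cube p. ennreal \<bar>g1 y\<bar> \<partial>K) + ennreal (t / 2) * emeasure K (cube p)"
      by (subst nn_integral_add) (auto simp: nn_integral_cmult_indicator)
    finally have le: "(\<integral>\<^sup>+y\<in>cube p. ennreal \<bar>g y\<bar> \<partial>K) \<le> \<dots>" .
    have "ennreal t * emeasure K (cube p) = ennreal (t / 2) * emeasure K (cube p) + ennreal (t / 2) * emeasure K (cube p)"
      using t by (simp add: distrib_right[symmetric] ennreal_plus[symmetric] del: ennreal_plus)
    then have "ennreal (t / 2) * emeasure K (cube p) + ennreal (t / 2) * emeasure K (cube p)
        < (\<integral>\<^sup>+y\<in>cube p. ennreal \<bar>g1 y\<bar> \<partial>K) + ennreal (t / 2) * emeasure K (cube p)"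
      using less_le_trans[OF p(3) le] by (simp only:)
    then have "ennreal (t / 2) * emeasure K (cube p) < (\<integral>\<^sup>+y\<in>cube p. ennreal \<bar>g1 y\<bar> \<partial>K)"
      by (meson add_right_mono not_le)
    with p show "ennreal (t / 2) < maximal_function K g1 x"
      using maximal_function_greater_iff by blast
  qed
  then have "ennreal t * emeasure K {x. ennreal t < maximal_function K g x}
      \<le> ennreal t * emeasure K {x. ennreal (t / 2) < maximal_function K g1 x}"
    using open_superlevel_set[OF g1] by (intro mult_left_mono emeasure_mono) auto
  also have "\<dots> = ennreal 2 * (ennreal (t / 2) * emeasure K {x. ennreal (t / 2) < maximal_function K g1 x})"
  proof -
    have "ennreal t = ennreal 2 * ennreal (t / 2)"
      using t by (subst ennreal_mult[symmetric]) auto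
    then show ?thesis by (simp only: mult.assoc)
  qed
  also have "\<dots> \<le> ennreal 2 * (ennreal D * (\<integral>\<^sup>+x. ennreal \<bar>g1 x\<bar> \<partial>K))"
    using t by (intro mult_left_mono weak_type) auto
  also have "\<dots> = ennreal (2 * D) * (\<integral>\<^sup>+x. ennreal \<bar>g x\<bar> * indicator {x. t < 2 * \<bar>g x\<bar>} x \<partial>K)"
    using D_nonneg by (auto simp: ennreal_mult mult.assoc g1_def indicator_def intro!: arg_cong2[where f="(*)"] nn_integral_cong)
  finally show ?thesis .
qed

text \<open>Marcinkiewicz interpolation between weak type (1,1) and the bound on L^\<infinity>: the
  truncated weak type estimate is integrated against P t^(P-1).\<close>

lemma strong_type:
  assumes P: "1 < P"
  shows "\<exists>C\<ge>0. \<forall>g\<in>borel_measurable lebesgue.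
    (\<integral>\<^sup>+x. ennreal_powr (maximal_function K g x) P \<partial>K) \<le> ennreal C * (\<integral>\<^sup>+x. ennreal (\<bar>g x\<bar> powr P) \<partial>K)"
proof (intro exI conjI ballI)
  \<comment> \<open>2 D comes from the truncated weak type estimate, the rest from integrating P
    t^(P-2) over 0 < t < 2 |g|.\<close>
  define C where "C = 2 * D * P / (P - 1) * 2 powr (P - 1)"
  show "0 \<le> C" using P D_nonneg by (simp add: C_def)
  fix g :: "'a \<Rightarrow> real" assume g [measurable]: "g \<in> borel_measurable lebesgue"
  have gK [measurable]: "g \<in> borel_measurable K" by (simp add: measurable_K)
  interpret pair_sigma_finite lborel K
    by (rule pair_sigma_finite.intro[OF sigma_finite_lborel sigma_finite_K])
  have mK [measurable]: "maximal_function K g \<in> borel_measurable K"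
    unfolding measurable_K by (rule borel_measurable_lebesgue_maximal_function[OF g])
  have "(\<integral>\<^sup>+x. ennreal_powr (maximal_function K g x) P \<partial>K) =
     (\<integral>\<^sup>+t\<in>{0<..}. ennreal (P * t powr (P - 1)) * emeasure K {x. ennreal t < maximal_function K g x} \<partial>lborel)"
    using P by (subst layer_cake[OF sigma_finite_K mK]) auto
  also have "\<dots> \<le> (\<integral>\<^sup>+t. \<integral>\<^sup>+x. ennreal (2 * D * P / (P - 1)) *
       (ennreal ((P - 1) * t powr ((P - 1) - 1)) * indicator {t. ennreal t < ennreal (2 * \<bar>g x\<bar>)} t * indicator {0<..} t) * ennreal \<bar>g x\<bar> \<partial>K \<partial>lborel)"
  proof (rule nn_integral_mono)
    fix t :: real
    show "ennreal (P * t powr (P - 1)) * emeasure K {x. ennreal t < maximal_function K g x} * indicator {0<..} t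
      \<le> (\<integral>\<^sup>+x. ennreal (2 * D * P / (P - 1)) *
       (ennreal ((P - 1) * t powr ((P - 1) - 1)) * indicator {t. ennreal t < ennreal (2 * \<bar>g x\<bar>)} t * indicator {0<..} t) * ennreal \<bar>g x\<bar> \<partial>K)"
    proof (cases "0 < t")
      case True
      have e: "P * t powr (P - 1) = P * t powr (P - 2) * t"
        using True by (simp add: powr_diff power2_eq_square)
      have "ennreal (P * t powr (P - 1)) * emeasure K {x. ennreal t < maximal_function K g x}
         = ennreal (P * t powr (P - 2)) * (ennreal t * emeasure K {x. ennreal t < maximal_function K g x})"
        unfolding e using True P by (simp add: ennreal_mult mult.assoc)
      also have "\<dots> \<le> ennreal (P * t powr (P - 2)) * (ennreal (2 * D) * (\<integral>\<^sup>+x. ennreal \<bar>g x\<bar> * indicator {x. t < 2 * \<bar>g x\<bar>} x \<partial>K))"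
        using True by (intro mult_left_mono weak_type_truncated) auto
      also have "\<dots> = ennreal (2 * D * P * t powr (P - 2)) * (\<integral>\<^sup>+x. ennreal \<bar>g x\<bar> * indicator {x. t < 2 * \<bar>g x\<bar>} x \<partial>K)"
        using True P D_nonneg
        by (subst mult.assoc[symmetric], subst ennreal_mult[symmetric]) (auto simp: ac_simps)
      also have "\<dots> = (\<integral>\<^sup>+x. ennreal (2 * D * P * t powr (P - 2)) * (ennreal \<bar>g x\<bar> * indicator {x. t < 2 * \<bar>g x\<bar>} x) \<partial>K)"
        by (subst nn_integral_cmult) auto
      also have "\<dots> = (\<integral>\<^sup>+x. ennreal (2 * D * P / (P - 1)) *
       (ennreal ((P - 1) * t powr ((P - 1) - 1)) * indicator {t. ennreal t < ennreal (2 * \<bar>g x\<bar>)} t * indicator {0<..} t) * ennreal \<bar>g x\<bar> \<partial>K)"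
        using True P D_nonneg
        by (intro nn_integral_cong)
           (auto simp: indicator_def ennreal_less_iff ennreal_mult[symmetric] divide_simps)
      finally show ?thesis using True by simp
    qed simp
  qed
  also have "\<dots> = (\<integral>\<^sup>+x. \<integral>\<^sup>+t. ennreal (2 * D * P / (P - 1)) *
       (ennreal ((P - 1) * t powr ((P - 1) - 1)) * indicator {t. ennreal t < ennreal (2 * \<bar>g x\<bar>)} t * indicator {0<..} t) * ennreal \<bar>g x\<bar> \<partial>lborel \<partial>K)"
    by (rule Fubini'[symmetric]) (simp add: indicator_def cong: if_cong)
  also have "\<dots> = (\<integral>\<^sup>+x. ennreal C * ennreal (\<bar>g x\<bar> powr P) \<partial>K)"
  proof (rule nn_integral_cong)
    fix x
    have "(\<integral>\<^sup>+t. ennreal (2 * D * P / (P - 1)) *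
       (ennreal ((P - 1) * t powr ((P - 1) - 1)) * indicator {t. ennreal t < ennreal (2 * \<bar>g x\<bar>)} t * indicator {0<..} t) * ennreal \<bar>g x\<bar> \<partial>lborel)
       = ennreal (2 * D * P / (P - 1)) * ennreal_powr (ennreal (2 * \<bar>g x\<bar>)) (P - 1) * ennreal \<bar>g x\<bar>"
      using P nn_integral_powr_kernel[of "P - 1" "ennreal (2 * \<bar>g x\<bar>)"]
      by (simp add: nn_integral_multc nn_integral_cmult)
    also have "\<dots> = ennreal (C * (\<bar>g x\<bar> powr (P - 1) * \<bar>g x\<bar>))"
      using P D_nonneg by (subst ennreal_powr_ennreal)
        (auto simp: C_def powr_mult ennreal_mult[symmetric] ac_simps)
    also have "\<bar>g x\<bar> powr (P - 1) * \<bar>g x\<bar> = \<bar>g x\<bar> powr P"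
      by (cases "g x = 0") (auto simp: powr_diff)
    finally show "(\<integral>\<^sup>+t. ennreal (2 * D * P / (P - 1)) *
       (ennreal ((P - 1) * t powr ((P - 1) - 1)) * indicator {t. ennreal t < ennreal (2 * \<bar>g x\<bar>)} t * indicator {0<..} t) * ennreal \<bar>g x\<bar> \<partial>lborel)
       = ennreal C * ennreal (\<bar>g x\<bar> powr P)"
      using \<open>0 \<le> C\<close> by (simp add: ennreal_mult)
  qed
  also have "\<dots> = ennreal C * (\<integral>\<^sup>+x. ennreal (\<bar>g x\<bar> powr P) \<partial>K)"
    by (rule nn_integral_cmult) simp
  finally show "(\<integral>\<^sup>+x. ennreal_powr (maximal_function K g x) P \<partial>K) \<le> ennreal C * (\<integral>\<^sup>+x. ennreal (\<bar>g x\<bar> powr P) \<partial>K)" .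
qed

end

section \<open>Differentiation\<close>

lemma small_cube_subset:
  fixes x :: "'a::euclidean_space"
  assumes "open U" "x \<in> U"
  shows "\<exists>d>0. \<forall>p. x \<in> cube p \<longrightarrow> snd p < d \<longrightarrow> cube p \<subseteq> U"
proof -
  obtain e where e: "e > 0" "ball x e \<subseteq> U" using assms open_contains_ball by blast
  define d where "d = e / real DIM('a)"
  have d: "0 < d" using e by (simp add: d_def)
  moreover have "cube p \<subseteq> U" if "x \<in> cube p" "snd p < d" for p
  proof
    fix y assume y: "y \<in> cube p"
    have *: "\<bar>(y - x) \<bullet> i\<bar> \<le> snd p" if "i \<in> Basis" for i
      using \<open>x \<in> cube p\<close> y that unfolding mem_cube inner_diff_left by (smt (verit))
    have "norm (y - x) \<le> (\<Sum>i\<in>Basis. \<bar>(y - x) \<bullet> i\<bar>)" by (rule norm_le_l1)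
    also have "\<dots> \<le> (\<Sum>i\<in>(Basis::'a set). snd p)" by (intro sum_mono *)
    also have "\<dots> = real DIM('a) * snd p" by simp
    also have "\<dots> < e" using that(2) e by (simp add: d_def field_simps)
    finally have "y \<in> ball x e" by (simp add: dist_norm norm_minus_commute)
    then show "y \<in> U" using e by blast
  qed
  ultimately show ?thesis by blast
qed

context doubling_measure
begin

lemma emeasure_K_Inter_null:
  fixes B :: "nat \<Rightarrow> 'a set"
  assumes meas: "\<And>n. B n \<in> sets lebesgue" and dec: "decseq B" and fin: "emeasure K (B 0) < \<infinity>"
    and null: "(\<Inter>n. B n) \<in> null_sets lebesgue"
  shows "(\<lambda>n. emeasure K (B n)) \<longlonglongrightarrow> 0"
proof -
  have "emeasure K (B n) \<le> emeasure K (B 0)" for n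
    using dec meas by (intro emeasure_mono) (auto simp: decseq_def)
  then have "(\<lambda>n. emeasure K (B n)) \<longlonglongrightarrow> emeasure K (\<Inter>n. B n)"
    using meas dec fin by (intro Lim_emeasure_decseq) (auto simp: less_top intro: le_less_trans)
  moreover have "emeasure K (\<Inter>n. B n) = 0"
    using null_sets_K[OF null] by auto
  ultimately show ?thesis by simp
qed

text \<open>Near a point of A, small cubes avoid any finite union of closed subsets of the
  complement. What remains of the complement has small mass, so by weak type the maximal function of
  its indicator is at most c outside a small set. Varying c costs only a countable union of null
  sets.\<close>

lemma density_point:
  assumes A: "A \<in> sets lebesgue" and c: "0 < c"
  shows "AE x in K. x \<in> A \<longrightarrow> (\<exists>d>0. \<forall>p. 0 < snd p \<longrightarrow> snd p < d \<longrightarrow> x \<in> cube p \<longrightarrow>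
            emeasure K (cube p - A) \<le> ennreal c * emeasure K (cube p))"
proof -
  have "- A \<in> sets lebesgue" using A by (simp add: Compl_in_sets_lebesgue)
  then obtain C N where CN: "fsigma C" "N \<in> null_sets lebesgue" "C \<union> N = - A" "disjnt C N"
    by (rule lebesgue_set_almost_fsigma)
  from CN(1) obtain F :: "nat \<Rightarrow> 'a set" where F: "range F \<subseteq> Collect closed" "C = \<Union>(range F)"
    by cases (rule that, auto)
  \<comment> \<open>Bounded pieces: continuity from above needs finite mass, and every point is
    interior to some \<open>Q m\<close>.\<close>
  define Q where "Q m = cube (- (real (Suc m) *\<^sub>R One) :: 'a, 2 * real (Suc m))" for m
  define Z where "Z m n = (Q m - A) - (\<Union>i\<le>n. F i)" for m n
  have Fs: "F i \<in> sets lebesgue" for i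
  proof -
    have "closed (F i)" using F(1) by auto
    then show ?thesis by simp
  qed
  have Z: "Z m n \<in> sets lebesgue" for m n
    unfolding Z_def Q_def using A Fs by (intro sets.Diff sets.finite_UN) auto
  have Z_lim: "(\<lambda>n. emeasure K (Z m n)) \<longlonglongrightarrow> 0" for m
  proof (rule emeasure_K_Inter_null[OF Z])
    show "decseq (Z m)" unfolding decseq_def Z_def by (auto intro: order_trans)
    have "emeasure K (Z m 0) \<le> emeasure K (Q m)"
      by (intro emeasure_mono) (auto simp: Z_def Q_def)
    also have "\<dots> < \<infinity>" unfolding Q_def by (rule cube_finite) simp
    finally show "emeasure K (Z m 0) < \<infinity>" .
    have "(\<Inter>n. Z m n) \<subseteq> N"
      using CN(3) F(2) unfolding Z_def by blast
    then show "(\<Inter>n. Z m n) \<in> null_sets lebesgue"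
      using null_sets_subset[OF CN(2), of "\<Inter>n. Z m n"] Z by blast
  qed
  \<comment> \<open>By weak type the mass of \<open>S m n\<close> is at most D / c times that of
    \<open>Z m n\<close>, so the intersection over n is null.\<close>
  define S where "S m n = {x. ennreal c < maximal_function K (indicat_real (Z m n)) x}" for m n
  have Sm: "S m n \<in> sets K" for m n
  proof -
    have "maximal_function K (indicat_real (Z m n)) \<in> borel_measurable lebesgue"
      using Z by (intro borel_measurable_lebesgue_maximal_function) simp
    from measurable_sets[OF this, of "{ennreal c<..}"] show ?thesis
      by (simp add: S_def vimage_def greaterThan_def)
  qed
  have S0: "(\<Inter>n. S m n) \<in> null_sets K" for m
  proof -
    have "ennreal c * emeasure K (\<Inter>n. S m n) \<le> ennreal D * emeasure K (Z m n)" for n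
    proof -
      have "ennreal c * emeasure K (\<Inter>n. S m n) \<le> ennreal c * emeasure K (S m n)"
        using Sm by (intro mult_left_mono emeasure_mono) auto
      also have "\<dots> \<le> ennreal D * (\<integral>\<^sup>+x. ennreal \<bar>indicat_real (Z m n) x\<bar> \<partial>K)"
        unfolding S_def using Z c by (intro weak_type) auto
      also have "(\<integral>\<^sup>+x. ennreal \<bar>indicat_real (Z m n) x\<bar> \<partial>K) = emeasure K (Z m n)"
        using Z by (simp add: ennreal_indicator)
      finally show ?thesis .
    qed
    moreover have "(\<lambda>n. ennreal D * emeasure K (Z m n)) \<longlonglongrightarrow> ennreal D * 0"
      by (intro ennreal_tendsto_cmult Z_lim) simp
    ultimately have "ennreal c * emeasure K (\<Inter>n. S m n) \<le> 0"
      by (intro LIMSEQ_le_const) auto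
    then have "emeasure K (\<Inter>n. S m n) = 0" using c by simp
    then show ?thesis using Sm by (intro null_setsI) auto
  qed
  have good: "x \<in> A \<longrightarrow> (\<exists>d>0. \<forall>p. 0 < snd p \<longrightarrow> snd p < d \<longrightarrow> x \<in> cube p \<longrightarrow>
            emeasure K (cube p - A) \<le> ennreal c * emeasure K (cube p))"
    if x: "x \<notin> (\<Union>m. \<Inter>n. S m n)" for x
  proof
    assume xA: "x \<in> A"
    obtain m where m: "norm x \<le> real m" using real_arch_simple by blast
    have xQ: "x \<in> interior (Q m)"
      unfolding Q_def mem_interior_cube
    proof
      fix i :: 'a assume i: "i \<in> Basis"
      have "\<bar>x \<bullet> i\<bar> \<le> real m" using Basis_le_norm[OF i, of x] m by linarith
      then show "fst (- (real (Suc m) *\<^sub>R One), 2 * real (Suc m)) \<bullet> i < x \<bullet> i \<and>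
          x \<bullet> i < fst (- (real (Suc m) *\<^sub>R One), 2 * real (Suc m)) \<bullet> i + snd (- (real (Suc m) *\<^sub>R (One::'a)), 2 * real (Suc m))"
        using i \<open>\<bar>x \<bullet> i\<bar> \<le> real m\<close> by (simp add: abs_le_iff)
    qed
    obtain n where n: "x \<notin> S m n" using x by blast
    define U where "U = interior (Q m) - (\<Union>i\<le>n. F i)"
    have "x \<notin> F i" for i using xA CN(3) F(2) by blast
    then have "x \<in> U" using xQ by (simp add: U_def)
    moreover have "open U" unfolding U_def using F(1) by (intro open_Diff open_interior closed_UN) auto
    ultimately obtain d where d: "d > 0" "\<And>p. x \<in> cube p \<Longrightarrow> snd p < d \<Longrightarrow> cube p \<subseteq> U"
      using small_cube_subset by metis
    have "emeasure K (cube p - A) \<le> ennreal c * emeasure K (cube p)"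
      if p: "0 < snd p" "snd p < d" "x \<in> cube p" for p
    proof -
      have sub: "cube p - A \<subseteq> cube p \<inter> Z m n"
        using d(2)[OF p(3,2)] interior_subset by (fastforce simp: U_def Z_def)
      have "emeasure K (cube p - A) \<le> emeasure K (cube p \<inter> Z m n)"
        using sub Z by (intro emeasure_mono) auto
      also have "\<dots> = (\<integral>\<^sup>+y\<in>cube p. ennreal \<bar>indicat_real (Z m n) y\<bar> \<partial>K)"
      proof -
        have "(\<integral>\<^sup>+y\<in>cube p. ennreal \<bar>indicat_real (Z m n) y\<bar> \<partial>K) =
            (\<integral>\<^sup>+y. indicator (cube p \<inter> Z m n) y \<partial>K)"
          by (intro nn_integral_cong) (auto simp: indicator_def)
        then show ?thesis using Z by simp
      qed
      also have "\<dots> \<le> ennreal c * emeasure K (cube p)"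
        using n p maximal_function_greater_iff[of "ennreal c" "indicat_real (Z m n)" x]
        unfolding S_def mem_Collect_eq not_less[symmetric] by blast
      finally show ?thesis .
    qed
    then show "\<exists>d>0. \<forall>p. 0 < snd p \<longrightarrow> snd p < d \<longrightarrow> x \<in> cube p \<longrightarrow>
            emeasure K (cube p - A) \<le> ennreal c * emeasure K (cube p)"
      using d(1) by blast
  qed
  have "(\<Union>m. \<Inter>n. S m n) \<in> null_sets K" using S0 by auto
  then show ?thesis by (rule AE_I') (use good in blast)
qed

text \<open>The lower half of Lebesgue's differentiation theorem, which makes sense also for
  functions that are not locally integrable. If t < r < |h x| with r rational and x is a density
  point of {|h| > r}, this set fills so much of a small cube that the average exceeds t.\<close>

lemma differentiation:
  assumes h [measurable]: "h \<in> borel_measurable lebesgue"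
  shows "AE x in K. \<forall>t. 0 \<le> t \<longrightarrow> t < \<bar>h x\<bar> \<longrightarrow> (\<exists>d>0. \<forall>p. 0 < snd p \<longrightarrow> snd p < d \<longrightarrow> x \<in> cube p \<longrightarrow>
            ennreal t * emeasure K (cube p) < (\<integral>\<^sup>+y\<in>cube p. ennreal \<bar>h y\<bar> \<partial>K))"
proof -
  define A where "A r = {x. real_of_rat r < \<bar>h x\<bar>}" for r
  have A [measurable]: "A r \<in> sets lebesgue" for r
  proof -
    have "{x\<in>space lebesgue. real_of_rat r < \<bar>h x\<bar>} \<in> sets lebesgue" by measurable
    then show ?thesis by (simp add: A_def)
  qed
  have hK [measurable]: "h \<in> borel_measurable K" by (simp add: measurable_K)
  have "AE x in K. \<forall>r. \<forall>n. x \<in> A r \<longrightarrow> (\<exists>d>0. \<forall>p. 0 < snd p \<longrightarrow> snd p < d \<longrightarrow> x \<in> cube p \<longrightarrow>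
      emeasure K (cube p - A r) \<le> ennreal (inverse (real (Suc n))) * emeasure K (cube p))"
    by (subst AE_all_countable, intro allI, subst AE_all_countable, intro allI, rule density_point) auto
  then show ?thesis
  proof eventually_elim
    case (elim x)
    show ?case
    proof (intro allI impI)
      fix t :: real assume t: "0 \<le> t" "t < \<bar>h x\<bar>"
      obtain r where r: "t < real_of_rat r" "real_of_rat r < \<bar>h x\<bar>"
        using of_rat_dense[OF t(2)] by blast
      \<comment> \<open>Then r (1 - e) = t, so an exceptional fraction below e can be
        tolerated.\<close>
      define e where "e = 1 - t / real_of_rat r"
      have r0: "0 < real_of_rat r" using r t by linarith
      have e: "0 < e" using r(1) r0 unfolding e_def by (simp only: diff_gt_0_iff_gt divide_less_eq_1_pos)
      obtain n where n: "inverse (real (Suc n)) < e" using reals_Archimedean[OF e] by blast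
      have xA: "x \<in> A r" using r by (simp add: A_def)
      obtain d where d: "d > 0" "\<And>p. 0 < snd p \<Longrightarrow> snd p < d \<Longrightarrow> x \<in> cube p \<Longrightarrow>
          emeasure K (cube p - A r) \<le> ennreal (inverse (real (Suc n))) * emeasure K (cube p)"
        using elim xA by blast
      have "ennreal t * emeasure K (cube p) < (\<integral>\<^sup>+y\<in>cube p. ennreal \<bar>h y\<bar> \<partial>K)"
        if p: "0 < snd p" "snd p < d" "x \<in> cube p" for p
      proof -
        have fm: "cube p \<in> fmeasurable K" using cube_finite[OF p(1)] by (auto simp: fmeasurable_def)
        have fmd: "cube p - A r \<in> fmeasurable K" "cube p \<inter> A r \<in> fmeasurable K"
          using A by (auto intro!: fmeasurable_Diff fmeasurable_Int_fmeasurable fm)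
        define a b c where "a = measure K (cube p \<inter> A r)" and "b = measure K (cube p - A r)" and "c = measure K (cube p)"
        have abc: "c = a + b"
          using measure_Union[of K "cube p \<inter> A r" "cube p - A r"] fmeasurableD2[OF fmd(1)] fmeasurableD2[OF fmd(2)]
            fmeasurableD[OF fmd(1)] fmeasurableD[OF fmd(2)]
          unfolding a_def b_def c_def by (simp add: Int_Diff_Un Int_Diff_disjoint infinity_ennreal_def)
        have ec: "emeasure K (cube p) = ennreal c" "emeasure K (cube p - A r) = ennreal b"
            "emeasure K (cube p \<inter> A r) = ennreal a"
          unfolding a_def b_def c_def using fm fmd by (simp_all add: emeasure_eq_measure2)
        have c0: "0 < c" using cube_pos[OF p(1)] ec by simp
        have "ennreal b \<le> ennreal (inverse (real (Suc n))) * ennreal c"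
          using d(2)[OF p] by (simp only: ec)
        then have "b \<le> inverse (real (Suc n)) * c"
          using c0 by (simp add: ennreal_mult[symmetric])
        also have "\<dots> < e * c" using n c0 by simp
        finally have "(1 - e) * c < a" using abc by (simp add: algebra_simps)
        moreover have "1 - e = t / real_of_rat r" by (simp add: e_def)
        ultimately have "t * c < real_of_rat r * a" using r0 by (simp add: field_simps)
        then have "ennreal t * emeasure K (cube p) < ennreal (real_of_rat r) * emeasure K (cube p \<inter> A r)"
        proof -
          have "ennreal (t * c) < ennreal (real_of_rat r * a)"
            using \<open>t * c < real_of_rat r * a\<close> t(1) c0 by (subst ennreal_less_iff) auto
          then show ?thesis unfolding ec using t c0 r0 a_def by (simp add: ennreal_mult)
        qed
        also have "\<dots> = (\<integral>\<^sup>+y. ennreal (real_of_rat r) * indicator (cube p \<inter> A r) y \<partial>K)"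
          by (subst nn_integral_cmult_indicator) auto
        also have "\<dots> \<le> (\<integral>\<^sup>+y\<in>cube p. ennreal \<bar>h y\<bar> \<partial>K)"
          by (intro nn_integral_mono) (auto simp: indicator_def A_def intro!: ennreal_leI)
        finally show ?thesis .
      qed
      then show "\<exists>d>0. \<forall>p. 0 < snd p \<longrightarrow> snd p < d \<longrightarrow> x \<in> cube p \<longrightarrow>
            ennreal t * emeasure K (cube p) < (\<integral>\<^sup>+y\<in>cube p. ennreal \<bar>h y\<bar> \<partial>K)"
        using d(1) by blast
    qed
  qed
qed

text \<open>If it failed, the value of the maximal function would itself be an admissible t in the
  differentiation lemma, and a small cube at x would exceed it.\<close>

lemma abs_le_maximal_function:
  assumes "h \<in> borel_measurable lebesgue"
  shows "AE x in K. ennreal \<bar>h x\<bar> \<le> maximal_function K h x"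
  using differentiation[OF assms]
proof eventually_elim
  case (elim x)
  show ?case
  proof (rule ccontr)
    assume "\<not> ?thesis"
    then have "maximal_function K h x < ennreal \<bar>h x\<bar>" by simp
    then obtain t where t: "0 \<le> t" "maximal_function K h x = ennreal t" "t < \<bar>h x\<bar>"
      by (cases "maximal_function K h x") (auto simp: ennreal_less_iff)
    with elim obtain d where d: "d > 0" "\<And>p. 0 < snd p \<Longrightarrow> snd p < d \<Longrightarrow> x \<in> cube p \<Longrightarrow>
            ennreal t * emeasure K (cube p) < (\<integral>\<^sup>+y\<in>cube p. ennreal \<bar>h y\<bar> \<partial>K)" by blast
    have "x \<in> cube (x, d / 2)" using d by (simp add: mem_cube)
    with d have "ennreal t < maximal_function K h x"
      by (subst maximal_function_greater_iff) (intro exI[of _ "(x, d / 2)"], auto)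
    then show False using t by simp
  qed
qed

end

section \<open>Weights of class \<open>A\<^sub>\<infinity>\<close>\<close>

lemma sets_weight_measure [simp, measurable_cong]: "sets (weight_measure m) = sets lebesgue"
  by (simp add: weight_measure_def)

lemma space_weight_measure [simp]: "space (weight_measure m) = UNIV"
  by (simp add: weight_measure_def)

lemma weight_measurable [measurable_dest]: "weight m \<Longrightarrow> m \<in> borel_measurable lebesgue"
  by (simp add: weight_def)

lemma weight_pos: "weight m \<Longrightarrow> AE x in lebesgue. 0 < m x"
  by (simp add: weight_def)

lemma weight_powr: "weight m \<Longrightarrow> weight (\<lambda>x. m x powr a)"
  unfolding weight_def by (auto elim: eventually_mono)

lemma weight_mult: "weight m \<Longrightarrow> weight m' \<Longrightarrow> weight (\<lambda>x. m x * m' x)"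
  unfolding weight_def by (auto elim: eventually_elim2)

lemma emeasure_weight_measure:
  "weight m \<Longrightarrow> A \<in> sets lebesgue \<Longrightarrow> emeasure (weight_measure m) A = (\<integral>\<^sup>+x\<in>A. ennreal (m x) \<partial>lebesgue)"
  unfolding weight_measure_def by (subst emeasure_density) auto

lemma nn_integral_weight_measure:
  "weight m \<Longrightarrow> f \<in> borel_measurable lebesgue \<Longrightarrow>
    (\<integral>\<^sup>+x. f x \<partial>weight_measure m) = (\<integral>\<^sup>+x. ennreal (m x) * f x \<partial>lebesgue)"
  unfolding weight_measure_def by (subst nn_integral_density) auto

lemma set_nn_integral_weight_measure:
  assumes "weight m" "f \<in> borel_measurable lebesgue" "A \<in> sets lebesgue"
  shows "(\<integral>\<^sup>+x\<in>A. f x \<partial>weight_measure m) = (\<integral>\<^sup>+x\<in>A. ennreal (m x) * f x \<partial>lebesgue)"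
  using assms by (subst nn_integral_weight_measure) (auto simp: mult.assoc)

lemma AE_weight_measure_iff:
  assumes "weight m"
  shows "(AE x in weight_measure m. P x) \<longleftrightarrow> (AE x in lebesgue. P x)"
proof -
  have "(AE x in weight_measure m. P x) \<longleftrightarrow> (AE x in lebesgue. 0 < ennreal (m x) \<longrightarrow> P x)"
    unfolding weight_measure_def using assms by (subst AE_density) auto
  also have "\<dots> \<longleftrightarrow> (AE x in lebesgue. P x)"
    using weight_pos[OF assms] by (intro iffI; elim AE_mp) (auto elim: eventually_mono)
  finally show ?thesis .
qed

lemma null_sets_weight_measure:
  assumes "weight m"
  shows "null_sets (weight_measure m) = null_sets lebesgue"
proof (rule set_eqI)
  fix N :: "'a set"
  have "N \<in> null_sets M \<longleftrightarrow> N \<in> sets M \<and> (AE x in M. x \<notin> N)" for M :: "'a measure"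
    using AE_iff_null_sets[of N M] by blast
  then show "N \<in> null_sets (weight_measure m) \<longleftrightarrow> N \<in> null_sets lebesgue"
    using AE_weight_measure_iff[OF assms, of "\<lambda>x. x \<notin> N"] by simp
qed

lemma weight_measure_cong:
  assumes "weight m" "weight m'" "AE x in lebesgue. m x = m' x"
  shows "weight_measure m = weight_measure m'"
  unfolding weight_measure_def using assms by (intro density_cong) (auto elim: eventually_mono)

lemma weight_measure_mono:
  assumes m: "weight m" "weight m'" and A: "A \<in> sets lebesgue" and c: "0 \<le> c"
    and le: "AE x in lebesgue. x \<in> A \<longrightarrow> m x \<le> c * m' x"
  shows "emeasure (weight_measure m) A \<le> ennreal c * emeasure (weight_measure m') A"
proof -
  have "emeasure (weight_measure m) A = (\<integral>\<^sup>+x\<in>A. ennreal (m x) \<partial>lebesgue)"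
    by (rule emeasure_weight_measure[OF m(1) A])
  also have "\<dots> \<le> (\<integral>\<^sup>+x. ennreal c * (ennreal (m' x) * indicator A x) \<partial>lebesgue)"
  proof (rule nn_integral_mono_AE)
    show "AE x in lebesgue. ennreal (m x) * indicator A x \<le> ennreal c * (ennreal (m' x) * indicator A x)"
      using le
    proof eventually_elim
      case (elim x)
      then show ?case
        using c by (auto simp: indicator_def ennreal_mult'[symmetric] intro!: ennreal_leI)
    qed
  qed
  also have "\<dots> = ennreal c * emeasure (weight_measure m') A"
    using m A by (subst nn_integral_cmult) (auto simp: emeasure_weight_measure)
  finally show ?thesis .
qed

section \<open>Volumes and averages of cubes\<close>

definition vol :: "'a::euclidean_space \<times> real \<Rightarrow> real" where
  "vol p = snd p ^ DIM('a)"

lemma emeasure_cube: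
  fixes p :: "'a::euclidean_space \<times> real"
  assumes "0 < snd p"
  shows "emeasure lebesgue (cube p) = ennreal (vol p)"
proof -
  have "emeasure lborel (cube p) = ennreal (\<Prod>b\<in>Basis. (fst p + snd p *\<^sub>R One - fst p) \<bullet> b)"
    unfolding cube_def using assms by (intro emeasure_lborel_cbox) (auto simp: inner_simps)
  also have "(\<Prod>b\<in>Basis. (fst p + snd p *\<^sub>R One - fst p) \<bullet> b) = (\<Prod>b\<in>(Basis::'a set). snd p)"
    by (intro prod.cong) auto
  finally show ?thesis by (simp add: vol_def cube_def)
qed

lemma vol_pos: "0 < snd p \<Longrightarrow> 0 < vol p"
  by (simp add: vol_def)

lemma vol_triple: "vol (triple p) = 3 ^ DIM('a) * vol (p :: 'a::euclidean_space \<times> real)"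
  by (simp add: vol_def power_mult_distrib)

lemma doubling_measure_lebesgue: "doubling_measure (lebesgue :: 'a::euclidean_space measure) (3 ^ DIM('a))"
proof
  fix p :: "'a \<times> real" assume p: "0 < snd p"
  show "emeasure lebesgue (cube (triple p)) \<le> ennreal (3 ^ DIM('a)) * emeasure lebesgue (cube p)"
    using p vol_pos[OF p] by (subst (1 2) emeasure_cube) (auto simp: vol_triple ennreal_mult[symmetric])
  show "0 < emeasure lebesgue (cube p)" "emeasure lebesgue (cube p) < \<infinity>"
    using vol_pos[OF p] unfolding emeasure_cube[OF p] by simp_all
qed auto

text \<open>Chebyshev's inequality for a level set inside a cube.\<close>

lemma weight_measure_cube_lower:
  assumes p: "0 < snd p" and "weight u" "0 \<le> c" and A: "A \<in> sets lebesgue" "A \<subseteq> cube p"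
    and le: "\<And>x. x \<in> A \<Longrightarrow> c \<le> u x"
  shows "ennreal c * emeasure lebesgue A \<le> emeasure (weight_measure u) (cube p)"
proof -
  have "ennreal c * emeasure lebesgue A = (\<integral>\<^sup>+x. ennreal c * indicator A x \<partial>lebesgue)"
    using A by (simp add: nn_integral_cmult_indicator)
  also have "\<dots> \<le> (\<integral>\<^sup>+x\<in>cube p. ennreal (u x) \<partial>lebesgue)"
    using A le by (intro nn_integral_mono) (auto simp: indicator_def intro!: ennreal_leI)
  also have "\<dots> = emeasure (weight_measure u) (cube p)"
    using assms by (simp add: emeasure_weight_measure)
  finally show ?thesis .
qed

lemma weight_measure_cube_pos:
  assumes "weight m" "0 < snd p"
  shows "0 < emeasure (weight_measure m) (cube p)"
proof (rule ccontr)
  assume "\<not> 0 < emeasure (weight_measure m) (cube p)"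
  then have "cube p \<in> null_sets (weight_measure m)" by (intro null_setsI) auto
  then have "emeasure lebesgue (cube p) = 0"
    unfolding null_sets_weight_measure[OF assms(1)] by auto
  then show False using emeasure_cube[OF assms(2)] vol_pos[OF assms(2)] by simp
qed

definition avg :: "('a::euclidean_space \<Rightarrow> real) \<Rightarrow> 'a \<times> real \<Rightarrow> real" where
  "avg m p = measure (weight_measure m) (cube p) / vol p"

text \<open>A quantitative form of the \<open>A\<^sub>\<infinity>\<close> condition: it passes from \<open>\<mu>\<close> to \<open>v \<mu>\<close> for
  \<open>v \<in> A\<^sub>1(\<mu>)\<close>, and doubling and the reverse Hoelder inequality follow from it alone.\<close>

definition spread :: "('a::euclidean_space \<Rightarrow> real) \<Rightarrow> bool" where
  "spread m \<longleftrightarrow> weight m \<and> (\<forall>p. 0 < snd p \<longrightarrow> emeasure (weight_measure m) (cube p) < \<infinity>) \<and>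
     (\<forall>\<eta>>0. \<exists>b>0. \<forall>p. 0 < snd p \<longrightarrow>
        emeasure lebesgue {x\<in>cube p. m x \<le> b * avg m p} \<le> ennreal (\<eta> * vol p))"

locale spread_weight =
  fixes m :: "'a::euclidean_space \<Rightarrow> real"
  assumes spread: "spread m"
begin

lemma weight_m: "weight m" and mass_finite: "0 < snd p \<Longrightarrow> emeasure (weight_measure m) (cube p) < \<infinity>"
  using spread unfolding spread_def by blast+

lemma m_measurable [measurable]: "m \<in> borel_measurable lebesgue"
  using weight_m by (rule weight_measurable)

lemma mass_pos: "0 < snd p \<Longrightarrow> 0 < emeasure (weight_measure m) (cube p)"
  by (rule weight_measure_cube_pos[OF weight_m])

lemma emeasure_eq_avg:
  assumes p: "0 < snd p"
  shows "emeasure (weight_measure m) (cube p) = ennreal (avg m p * vol p)"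
  using mass_finite[OF p] vol_pos[OF p]
  by (simp add: avg_def emeasure_eq_ennreal_measure less_top)

lemma avg_pos: assumes p: "0 < snd p" shows "0 < avg m p"
  using mass_pos[OF p] vol_pos[OF p] emeasure_eq_avg[OF p]
  by (simp add: zero_less_mult_iff)

lemma emeasure_level:
  assumes "0 < snd p" "emeasure lebesgue {x\<in>cube p. m x \<le> t} \<le> ennreal (e * vol p)" "0 \<le> e" "e \<le> 1"
  shows "ennreal ((1 - e) * vol p) \<le> emeasure lebesgue {x\<in>cube p. t < m x}"
proof -
  have [measurable]: "{x\<in>cube p. m x \<le> t} \<in> sets lebesgue" "{x\<in>cube p. t < m x} \<in> sets lebesgue"
  proof -
    have "cube p \<inter> {x\<in>space lebesgue. m x \<le> t} \<in> sets lebesgue" "cube p \<inter> {x\<in>space lebesgue. t < m x} \<in> sets lebesgue"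
      by (intro sets.Int; measurable)+
    then show "{x\<in>cube p. m x \<le> t} \<in> sets lebesgue" "{x\<in>cube p. t < m x} \<in> sets lebesgue"
      by (simp_all add: Int_def)
  qed
  have "ennreal (vol p) = emeasure lebesgue ({x\<in>cube p. m x \<le> t} \<union> {x\<in>cube p. t < m x})"
    unfolding emeasure_cube[OF assms(1), symmetric] by (intro arg_cong2[where f=emeasure]) auto
  also have "\<dots> \<le> emeasure lebesgue {x\<in>cube p. m x \<le> t} + emeasure lebesgue {x\<in>cube p. t < m x}"
    by (intro emeasure_subadditive) auto
  also have "\<dots> \<le> ennreal (e * vol p) + emeasure lebesgue {x\<in>cube p. t < m x}"
    using assms(2) by (rule add_right_mono)
  finally have le: "ennreal (vol p) \<le> ennreal (e * vol p) + emeasure lebesgue {x\<in>cube p. t < m x}" .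
  show ?thesis
  proof (cases "emeasure lebesgue {x\<in>cube p. t < m x}")
    case (real r)
    then have "vol p \<le> e * vol p + r"
      using le assms vol_pos[OF assms(1)] by (simp add: ennreal_plus[symmetric] del: ennreal_plus)
    then show ?thesis using real by (simp add: algebra_simps ennreal_leI)
  qed simp
qed

lemma level_sets_measurable [measurable, simp]: "{x\<in>cube p. t < m x} \<in> sets lebesgue"
proof -
  have "cube p \<inter> {x\<in>space lebesgue. t < m x} \<in> sets lebesgue"
    by (intro sets.Int; measurable)
  then show ?thesis by (simp add: Int_def)
qed

text \<open>The defining condition at \<eta> = 1/2. The cap b \<le> 1 is for the reverse Hoelder
  argument, where for instance b t < N has to follow from t < N.\<close>

lemma half_level: "\<exists>b>0. b \<le> 1 \<and> (\<forall>p. 0 < snd p \<longrightarrow> ennreal (vol p / 2) \<le> emeasure lebesgue {x\<in>cube p. b * avg m p < m x})"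
proof -
  obtain b where b: "b > 0" "\<And>p. 0 < snd p \<Longrightarrow> emeasure lebesgue {x\<in>cube p. m x \<le> b * avg m p} \<le> ennreal (1/2 * vol p)"
    using spread by (auto simp: spread_def dest!: spec[of _ "1/2::real"])
  have "ennreal (vol p / 2) \<le> emeasure lebesgue {x\<in>cube p. min b 1 * avg m p < m x}" if p: "0 < snd p" for p
  proof -
    have "ennreal (vol p / 2) \<le> emeasure lebesgue {x\<in>cube p. b * avg m p < m x}"
      using emeasure_level[OF p b(2)[OF p]] by simp
    also have "\<dots> \<le> emeasure lebesgue {x\<in>cube p. min b 1 * avg m p < m x}"
    proof (rule emeasure_mono)
      have "min b 1 * avg m p \<le> b * avg m p" using avg_pos[OF p] by (intro mult_right_mono) auto
      then show "{x\<in>cube p. b * avg m p < m x} \<subseteq> {x\<in>cube p. min b 1 * avg m p < m x}" by auto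
    qed simp
    finally show ?thesis .
  qed
  then show ?thesis using b(1) by (intro exI[of _ "min b 1"]) auto
qed

text \<open>Off a small part of the triple, m exceeds b times its average over the triple. The
  factor 3^n in \<eta> is the volume ratio: the exceptional part has at most half the volume of the
  inner cube, so the other half bounds the mass of that cube from below.\<close>

lemma avg_triple_le: "\<exists>c>0. \<forall>p. 0 < snd p \<longrightarrow> avg m (triple p) \<le> c * avg m p"
proof -
  define \<eta> :: real where "\<eta> = 1 / (2 * 3 ^ DIM('a))"
  have "\<eta> > 0" by (simp add: \<eta>_def)
  then obtain b where b: "b > 0" "\<And>p. 0 < snd p \<Longrightarrow> emeasure lebesgue {x\<in>cube p. m x \<le> b * avg m p} \<le> ennreal (\<eta> * vol p)"
    using spread by (auto simp: spread_def)
  have "avg m (triple p) \<le> 2 / b * avg m p" if p: "0 < snd p" for p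
  proof -
    have sub: "cube p \<subseteq> cube (triple p)"
      using cube_subset_triple[of p p] cube_ne[OF p] by simp
    have p3: "0 < snd (triple p)" using p by simp
    let ?t = "b * avg m (triple p)"
    have "{x\<in>cube (triple p). m x \<le> ?t} \<in> sets lebesgue"
    proof -
      have "cube (triple p) \<inter> {x\<in>space lebesgue. m x \<le> ?t} \<in> sets lebesgue"
        by (intro sets.Int; measurable)
      then show ?thesis by (simp add: Int_def)
    qed
    then have "emeasure lebesgue {x\<in>cube p. m x \<le> ?t} \<le> emeasure lebesgue {x\<in>cube (triple p). m x \<le> ?t}"
      using sub by (intro emeasure_mono) auto
    also have "\<dots> \<le> ennreal (\<eta> * vol (triple p))" using b(2)[OF p3] .
    also have "\<eta> * vol (triple p) = 1/2 * vol p" by (simp add: vol_triple \<eta>_def)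
    finally have "ennreal ((1 - 1/2) * vol p) \<le> emeasure lebesgue {x\<in>cube p. ?t < m x}"
      by (intro emeasure_level p) auto
    then have "ennreal ?t * ennreal ((1 - 1/2) * vol p) \<le> ennreal ?t * emeasure lebesgue {x\<in>cube p. ?t < m x}"
      by (rule mult_left_mono) simp
    also have "\<dots> \<le> emeasure (weight_measure m) (cube p)"
      using avg_pos[OF p3] b(1) by (intro weight_measure_cube_lower p weight_m) auto
    finally have "ennreal (?t * (vol p / 2)) \<le> ennreal (avg m p * vol p)"
      using avg_pos[OF p3] b(1) vol_pos[OF p]
      by (subst ennreal_mult) (auto simp: emeasure_eq_avg[OF p])
    then have "?t * (vol p / 2) \<le> avg m p * vol p"
      using avg_pos[OF p] vol_pos[OF p] by (simp add: ennreal_le_iff)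
    then show ?thesis using vol_pos[OF p] b(1) by (simp add: field_simps)
  qed
  then show ?thesis using b(1) by (intro exI[of _ "2 / b"]) auto
qed

section \<open>Measures whose density is a power of the weight\<close>

abbreviation pm :: "real \<Rightarrow> 'a measure" where
  "pm a \<equiv> weight_measure (\<lambda>x. m x powr a)"

lemma pm_1: "pm 1 = weight_measure m"
  using weight_pos[OF weight_m]
  by (intro weight_measure_cong weight_powr weight_m) (auto elim: eventually_mono)

text \<open>Since m > b avg on half of the cube, this side of the comparison with avg^a holds for
  every a > 0. The other side is Jensen's inequality for a \<le> 1 and the reverse Hoelder
  inequality for a slightly above 1.\<close>

lemma pm_lower:
  assumes a: "0 < a"
  shows "\<exists>c>0. \<forall>p. 0 < snd p \<longrightarrow> ennreal (c * avg m p powr a * vol p) \<le> emeasure (pm a) (cube p)"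
proof -
  obtain b where b: "b > 0" "\<And>p. 0 < snd p \<Longrightarrow> ennreal (vol p / 2) \<le> emeasure lebesgue {x\<in>cube p. b * avg m p < m x}"
    using half_level by blast
  have "ennreal (b powr a / 2 * avg m p powr a * vol p) \<le> emeasure (pm a) (cube p)" if p: "0 < snd p" for p
  proof -
    let ?A = "{x\<in>cube p. b * avg m p < m x}"
    have "ennreal (b powr a / 2 * avg m p powr a * vol p) = ennreal ((b * avg m p) powr a) * ennreal (vol p / 2)"
      using b(1) avg_pos[OF p] vol_pos[OF p] by (simp add: powr_mult ennreal_mult[symmetric])
    also have "\<dots> \<le> ennreal ((b * avg m p) powr a) * emeasure lebesgue ?A"
      using b(2)[OF p] by (rule mult_left_mono) simp
    also have "\<dots> \<le> emeasure (pm a) (cube p)"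
      using a b(1) avg_pos[OF p]
      by (intro weight_measure_cube_lower p weight_powr weight_m) (auto intro!: powr_mono2)
    finally show ?thesis .
  qed
  then show ?thesis using b(1) by (intro exI[of _ "b powr a / 2"]) auto
qed

text \<open>A crude tangent line for a concave power: the first summand suffices for y \<le> A, the
  second for y > A. With A the average over a cube, integration gives Jensen's inequality up to a
  factor 2.\<close>

lemma powr_le_tangent:
  fixes y A a :: real
  assumes "0 < y" "0 < A" "0 < a" "a \<le> 1"
  shows "y powr a \<le> A powr a + A powr (a - 1) * y"
proof (cases "y \<le> A")
  case True
  then have "y powr a \<le> A powr a" using assms by (intro powr_mono2) auto
  moreover have "0 \<le> A powr (a - 1) * y" using assms by simp
  ultimately show ?thesis by linarith
next
  case False
  have "y powr a = y powr (a - 1) * y" using assms by (simp add: powr_diff)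
  also have "\<dots> \<le> A powr (a - 1) * y"
    using False assms by (intro mult_right_mono powr_mono2') auto
  finally show ?thesis using powr_ge_zero[of A a] by linarith
qed

lemma pm_upper:
  assumes a: "0 < a" "a \<le> 1" and p: "0 < snd p"
  shows "emeasure (pm a) (cube p) \<le> ennreal (2 * avg m p powr a * vol p)"
proof -
  let ?A = "avg m p"
  have A: "0 < ?A" by (rule avg_pos[OF p])
  have "emeasure (pm a) (cube p) = (\<integral>\<^sup>+x\<in>cube p. ennreal (m x powr a) \<partial>lebesgue)"
    by (intro emeasure_weight_measure weight_powr weight_m) simp
  also have "\<dots> \<le> (\<integral>\<^sup>+x. ennreal (?A powr a) * indicator (cube p) x + ennreal (?A powr (a - 1)) * (ennreal (m x) * indicator (cube p) x) \<partial>lebesgue)"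
  proof (rule nn_integral_mono_AE)
    show "AE x in lebesgue. ennreal (m x powr a) * indicator (cube p) x \<le>
        ennreal (?A powr a) * indicator (cube p) x + ennreal (?A powr (a - 1)) * (ennreal (m x) * indicator (cube p) x)"
      using weight_pos[OF weight_m]
    proof eventually_elim
      case (elim x)
      then show ?case
        using powr_le_tangent[OF elim A a]
        by (auto simp: indicator_def ennreal_mult[symmetric] ennreal_plus[symmetric] simp del: ennreal_plus intro!: ennreal_leI)
    qed
  qed
  also have "\<dots> = ennreal (?A powr a) * emeasure lebesgue (cube p) + ennreal (?A powr (a - 1)) * emeasure (weight_measure m) (cube p)"
    by (subst nn_integral_add) (auto simp: nn_integral_cmult_indicator nn_integral_cmult emeasure_weight_measure weight_m)
  also have "\<dots> = ennreal (?A powr a * vol p + ?A powr (a - 1) * (?A * vol p))"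
    using A vol_pos[OF p] by (simp add: emeasure_cube[OF p] emeasure_eq_avg[OF p] ennreal_mult)
  also have "?A powr (a - 1) * (?A * vol p) = ?A powr a * vol p"
    using A by (simp add: powr_diff)
  finally show ?thesis by (simp add: mult_ac)
qed

text \<open>Once the mass of m^a is comparable with avg^a vol on both sides, doubling is inherited
  from the averages of m. This is applied for a \<le> 1 and for the reverse Hoelder
  exponent.\<close>

lemma pm_doubling:
  assumes a: "0 < a"
    and upper: "\<And>p. 0 < snd p \<Longrightarrow> emeasure (pm a) (cube p) \<le> ennreal (C * avg m p powr a * vol p)" and C: "0 \<le> C"
  shows "\<exists>D. doubling_measure (pm a) D"
proof -
  obtain c where c: "c > 0" "\<And>p. 0 < snd p \<Longrightarrow> ennreal (c * avg m p powr a * vol p) \<le> emeasure (pm a) (cube p)"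
    using pm_lower[OF a] by blast
  obtain d where d: "d > 0" "\<And>p. 0 < snd p \<Longrightarrow> avg m (triple p) \<le> d * avg m p"
    using avg_triple_le by blast
  define D where "D = C * d powr a * 3 ^ DIM('a) / c"
  have D: "0 \<le> D" using c d C by (simp add: D_def)
  have "doubling_measure (pm a) D"
  proof
    fix p :: "'a \<times> real" assume p: "0 < snd p"
    have p3: "0 < snd (triple p)" using p by simp
    have "0 < ennreal (c * avg m p powr a * vol p)"
      using c avg_pos[OF p] vol_pos[OF p] by simp
    then show "0 < emeasure (pm a) (cube p)" using c(2)[OF p] by (rule less_le_trans)
    show "emeasure (pm a) (cube p) < \<infinity>" using upper[OF p] by (rule le_less_trans) simp
    have "emeasure (pm a) (cube (triple p)) \<le> ennreal (C * avg m (triple p) powr a * vol (triple p))"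
      by (rule upper[OF p3])
    also have "C * avg m (triple p) powr a * vol (triple p) \<le> C * (d * avg m p) powr a * vol (triple p)"
      using d(2)[OF p] avg_pos[OF p3] a C vol_pos[OF p3]
      by (intro mult_right_mono mult_left_mono powr_mono2) auto
    also have "\<dots> = D * (c * avg m p powr a * vol p)"
      using c d avg_pos[OF p] by (simp add: D_def vol_triple powr_mult)
    finally have "emeasure (pm a) (cube (triple p)) \<le> ennreal (D * (c * avg m p powr a * vol p))"
      by (simp add: ennreal_leI)
    also have "\<dots> = ennreal D * ennreal (c * avg m p powr a * vol p)"
      using D c(1) vol_pos[OF p] by (subst ennreal_mult) auto
    also have "\<dots> \<le> ennreal D * emeasure (pm a) (cube p)"
      using c(2)[OF p] by (rule mult_left_mono) simp
    finally show "emeasure (pm a) (cube (triple p)) \<le> ennreal D * emeasure (pm a) (cube p)" .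
  qed (use D in \<open>auto simp: null_sets_weight_measure weight_powr weight_m\<close>)
  then show ?thesis by blast
qed

end

section \<open>The reverse Hoelder inequality\<close>

text \<open>The homothety of ratio s centred at x. The point keeps its relative position in the
  cube, so it stays interior and the cubes are nested in s.\<close>

definition shrink :: "'a::euclidean_space \<Rightarrow> real \<Rightarrow> 'a \<times> real \<Rightarrow> 'a \<times> real" where
  "shrink x s p = (x + s *\<^sub>R (fst p - x), s * snd p)"

lemma snd_shrink [simp]: "snd (shrink x s p) = s * snd p"
  by (simp add: shrink_def)

lemma shrink_1 [simp]: "shrink x 1 p = p"
  by (simp add: shrink_def)

lemma vol_shrink: "vol (shrink x s (p :: 'a::euclidean_space \<times> real)) = s ^ DIM('a) * vol p"
  by (simp add: vol_def power_mult_distrib)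

lemma mem_interior_shrink:
  assumes x: "x \<in> interior (cube p)" and s: "0 < s"
  shows "x \<in> interior (cube (shrink x s p))"
  unfolding mem_interior_cube
proof
  fix i :: 'a assume i: "i \<in> Basis"
  have "fst p \<bullet> i < x \<bullet> i" "x \<bullet> i < fst p \<bullet> i + snd p"
    using x i by (auto simp: mem_interior_cube)
  then have "0 < s * (x \<bullet> i - fst p \<bullet> i)" "0 < s * (fst p \<bullet> i + snd p - x \<bullet> i)"
    using s by simp_all
  then show "fst (shrink x s p) \<bullet> i < x \<bullet> i \<and> x \<bullet> i < fst (shrink x s p) \<bullet> i + snd (shrink x s p)"
    by (simp add: shrink_def inner_simps algebra_simps)
qed

lemma shrink_mono:
  assumes x: "x \<in> cube p" and s: "s \<le> t"
  shows "cube (shrink x s p) \<subseteq> cube (shrink x t p)"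
proof
  fix z assume z: "z \<in> cube (shrink x s p)"
  show "z \<in> cube (shrink x t p)"
    unfolding mem_cube
  proof
    fix i :: 'a assume i: "i \<in> Basis"
    have "fst p \<bullet> i \<le> x \<bullet> i" "x \<bullet> i \<le> fst p \<bullet> i + snd p"
      using x i by (auto simp: mem_cube)
    then have "s * (x \<bullet> i - fst p \<bullet> i) \<le> t * (x \<bullet> i - fst p \<bullet> i)"
        "s * (fst p \<bullet> i + snd p - x \<bullet> i) \<le> t * (fst p \<bullet> i + snd p - x \<bullet> i)"
      using s by (auto intro!: mult_right_mono)
    moreover have "fst (shrink x s p) \<bullet> i \<le> z \<bullet> i" "z \<bullet> i \<le> fst (shrink x s p) \<bullet> i + snd (shrink x s p)"
      using z i by (auto simp: mem_cube)
    ultimately show "fst (shrink x t p) \<bullet> i \<le> z \<bullet> i \<and> z \<bullet> i \<le> fst (shrink x t p) \<bullet> i + snd (shrink x t p)"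
      by (simp add: shrink_def inner_simps algebra_simps)
  qed
qed

lemma AE_interior_cube: "AE x in lebesgue. x \<in> cube p \<longrightarrow> x \<in> interior (cube p)"
proof -
  have "negligible (cube p - interior (cube p))"
    unfolding cube_def interior_cbox by (rule negligible_frontier_interval)
  then show ?thesis
    by (intro AE_I'[of "cube p - interior (cube p)"]) (auto simp: negligible_iff_null_sets)
qed

context spread_weight
begin

text \<open>A Calderon-Zygmund stopping argument in which a continuous family of cubes shrinking to
  x replaces the dyadic ones: small members have average above lv, the original cube does not, and a
  scale close to the critical one is chosen.\<close>

lemma stopping_cube:
  fixes lv :: real
  assumes x: "x \<in> interior (cube p)" and p: "0 < snd p" and lv: "avg m p \<le> lv"
    and small: "\<exists>d>0. \<forall>q. 0 < snd q \<longrightarrow> snd q < d \<longrightarrow> x \<in> cube q \<longrightarrow> lv < avg m q"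
  shows "\<exists>q. 0 < snd q \<and> cube q \<subseteq> cube p \<and> x \<in> interior (cube q) \<and> lv < avg m q \<and> avg m q \<le> 2 ^ DIM('a) * lv"
proof -
  have xp: "x \<in> cube p" using x interior_subset by blast
  define S where "S = {s. 0 < s \<and> s \<le> 1 \<and> lv < avg m (shrink x s p)}"
  obtain d where d: "d > 0" "\<And>q. 0 < snd q \<Longrightarrow> snd q < d \<Longrightarrow> x \<in> cube q \<Longrightarrow> lv < avg m q"
    using small by blast
  define s0 where "s0 = min 1 (d / (2 * snd p))"
  have s0: "0 < s0" "s0 \<le> 1" "s0 * snd p < d"
  proof -
    show "0 < s0" "s0 \<le> 1" using d(1) p by (auto simp: s0_def)
    have "s0 * snd p \<le> d / (2 * snd p) * snd p" using p by (intro mult_right_mono) (auto simp: s0_def)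
    also have "\<dots> < d" using p d(1) by simp
    finally show "s0 * snd p < d" .
  qed
  have "s0 \<in> S"
    using s0 d(2)[of "shrink x s0 p"] mem_interior_shrink[OF x s0(1)] interior_subset[of "cube (shrink x s0 p)"] p
    by (auto simp: S_def)
  have bdd: "bdd_above S" by (intro bdd_aboveI[of _ 1]) (auto simp: S_def)
  have "s0 \<le> Sup S" using \<open>s0 \<in> S\<close> bdd by (rule cSup_upper)
  \<comment> \<open>A scale above half the supremum is good enough: the doubled scale, capped at 1,
    gives average at most lv, and passing to it enlarges the volume by a factor of at most
    2^n.\<close>
  then have "Sup S / 2 < Sup S" using s0 by simp
  then obtain s where s: "s \<in> S" "Sup S / 2 < s"
    using less_cSup_iff[OF _ bdd] \<open>s0 \<in> S\<close> by blast
  have s1: "0 < s" "s \<le> 1" "lv < avg m (shrink x s p)" using s by (auto simp: S_def)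
  have sp: "0 < snd (shrink x s p)" using s1 p by simp
  have sub: "cube (shrink x s p) \<subseteq> cube p" using shrink_mono[OF xp s1(2)] by simp
  define t where "t = min 1 (2 * s)"
  have t: "0 < t" "s \<le> t" "t \<le> 1" "t \<le> 2 * s" using s1 by (auto simp: t_def)
  have tp: "0 < snd (shrink x t p)" using t p by simp
  have "avg m (shrink x t p) \<le> lv"
  proof (cases "2 * s \<le> 1")
    case True
    have "2 * s \<notin> S" using cSup_upper[OF _ bdd, of "2 * s"] s(2) by auto
    then show ?thesis using True s1 by (auto simp: S_def t_def min_def)
  next
    case False
    then show ?thesis using lv by (simp add: t_def)
  qed
  moreover have "avg m (shrink x s p) \<le> 2 ^ DIM('a) * avg m (shrink x t p)"
  proof -
    have "emeasure (weight_measure m) (cube (shrink x s p)) \<le> emeasure (weight_measure m) (cube (shrink x t p))"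
      using shrink_mono[OF xp t(2)] by (intro emeasure_mono) auto
    then have le: "avg m (shrink x s p) * vol (shrink x s p) \<le> avg m (shrink x t p) * vol (shrink x t p)"
      unfolding emeasure_eq_avg[OF sp] emeasure_eq_avg[OF tp]
      using avg_pos[OF tp] vol_pos[OF tp] by (subst (asm) ennreal_le_iff) auto
    also have "vol (shrink x t p) \<le> 2 ^ DIM('a) * vol (shrink x s p)"
    proof -
      have "t ^ DIM('a) \<le> (2 * s) ^ DIM('a)" using t by (intro power_mono) auto
      then show ?thesis using vol_pos[OF p] by (simp add: vol_shrink power_mult_distrib)
    qed
    finally have "avg m (shrink x s p) * vol (shrink x s p) \<le> avg m (shrink x t p) * (2 ^ DIM('a) * vol (shrink x s p))"
      using avg_pos[OF tp] by simp
    then show ?thesis using vol_pos[OF sp] by (simp add: mult_ac)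
  qed
  moreover have "2 ^ DIM('a) * avg m (shrink x t p) \<le> 2 ^ DIM('a) * lv"
    using \<open>avg m (shrink x t p) \<le> lv\<close> by (intro mult_left_mono) auto
  ultimately have "avg m (shrink x s p) \<le> 2 ^ DIM('a) * lv" by linarith
  then show ?thesis
    using sp sub s1 mem_interior_shrink[OF x s1(1)] by (intro exI[of _ "shrink x s p"]) simp
qed

lemma doubling_weight_measure: "\<exists>D. doubling_measure (weight_measure m) D"
proof -
  have "\<exists>D. doubling_measure (pm 1) D"
  proof (rule pm_doubling)
    show "emeasure (pm 1) (cube p) \<le> ennreal (2 * avg m p powr 1 * vol p)" if "0 < snd p" for p
      by (rule pm_upper) (use that in simp_all)
  qed simp_all
  then show ?thesis by (simp only: pm_1)
qed

text \<open>In a stopping cube q the average is comparable with lv, so the triple of q has mass at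
  most a multiple of lv vol q, while m > b lv on at least half of q. Vitali adds this up; by
  differentiation the interiors of the stopping cubes cover {m > lv} almost everywhere.\<close>

lemma level_set_estimate:
  "\<exists>b c. 0 < b \<and> b \<le> 1 \<and> 0 \<le> c \<and> (\<forall>p lv. 0 < snd p \<longrightarrow> avg m p \<le> lv \<longrightarrow>
     emeasure (weight_measure m) {x\<in>cube p. lv < m x} \<le> ennreal (c * lv) * emeasure lebesgue {x\<in>cube p. b * lv < m x})"
proof -
  obtain b where b: "b > 0" "b \<le> 1" "\<And>p. 0 < snd p \<Longrightarrow> ennreal (vol p / 2) \<le> emeasure lebesgue {x\<in>cube p. b * avg m p < m x}"
    using half_level by blast
  obtain D where "doubling_measure (weight_measure m) D" using doubling_weight_measure by blast
  then interpret W: doubling_measure "weight_measure m" D .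
  \<comment> \<open>D from the triples, 2^n from the stopping cubes, 2 from the half of each
    cube.\<close>
  define c where "c = D * 2 ^ DIM('a) * 2"
  have c: "0 \<le> c" using W.D_nonneg by (simp add: c_def)
  have "emeasure (weight_measure m) {x\<in>cube p. lv < m x} \<le> ennreal (c * lv) * emeasure lebesgue {x\<in>cube p. b * lv < m x}"
    if p: "0 < snd p" and lv: "avg m p \<le> lv" for p lv
  proof -
    have lv0: "0 < lv" using avg_pos[OF p] lv by simp
    define C where "C = {q. 0 < snd q \<and> cube q \<subseteq> cube p \<and> lv < avg m q \<and> avg m q \<le> 2 ^ DIM('a) * lv}"
    define A where "A = {x\<in>cube p. b * lv < m x}"
    let ?L = "density lebesgue (indicator A)"
    have A [measurable]: "A \<in> sets lebesgue" by (simp add: A_def)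
    have L: "emeasure ?L B = emeasure lebesgue (A \<inter> B)" if "B \<in> sets lebesgue" for B
      using that by (subst emeasure_density) (auto simp flip: indicator_inter_arith)
    have "emeasure (weight_measure m) (\<Union>q\<in>C. interior (cube q)) \<le> ennreal (c * lv) * emeasure ?L (space ?L)"
    proof (rule vitali_bound)
      fix q assume q: "q \<in> C"
      then have q0: "0 < snd q" and qp: "cube q \<subseteq> cube p" and q1: "lv < avg m q" "avg m q \<le> 2 ^ DIM('a) * lv"
        by (auto simp: C_def)
      have "emeasure (weight_measure m) (cube (triple q)) \<le> ennreal D * emeasure (weight_measure m) (cube q)"
        by (rule W.doubling[OF q0])
      also have "\<dots> = ennreal D * ennreal (avg m q * vol q)" by (simp only: emeasure_eq_avg[OF q0])
      also have "\<dots> \<le> ennreal D * ennreal (2 ^ DIM('a) * lv * vol q)"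
        using q1 vol_pos[OF q0] by (intro mult_left_mono ennreal_leI mult_right_mono) auto
      also have "\<dots> = ennreal (c * lv) * ennreal (vol q / 2)"
        using W.D_nonneg c lv0 vol_pos[OF q0] by (simp add: ennreal_mult[symmetric] c_def)
      also have "\<dots> \<le> ennreal (c * lv) * emeasure lebesgue {x\<in>cube q. b * avg m q < m x}"
        using b(3)[OF q0] by (rule mult_left_mono) simp
      also have "\<dots> \<le> ennreal (c * lv) * emeasure ?L (cube q)"
      proof (intro mult_left_mono)
        have "b * lv \<le> b * avg m q" using q1 b by simp
        then have "{x\<in>cube q. b * avg m q < m x} \<subseteq> A \<inter> cube q" using qp by (auto simp: A_def)
        then show "emeasure lebesgue {x\<in>cube q. b * avg m q < m x} \<le> emeasure ?L (cube q)"
          unfolding L[OF cube_sets] using A by (intro emeasure_mono) auto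
      qed simp
      finally show "emeasure (weight_measure m) (cube (triple q)) \<le> ennreal (c * lv) * emeasure ?L (cube q)" .
    qed (auto simp: C_def)
    also have "emeasure ?L (space ?L) = emeasure lebesgue A"
      using L[of UNIV] by simp
    finally have bound: "emeasure (weight_measure m) (\<Union>q\<in>C. interior (cube q)) \<le> ennreal (c * lv) * emeasure lebesgue A" .
    have "AE x in lebesgue. x \<in> {x\<in>cube p. lv < m x} \<longrightarrow> x \<in> (\<Union>q\<in>C. interior (cube q))"
      using doubling_measure.differentiation[OF doubling_measure_lebesgue m_measurable] AE_interior_cube[of p] weight_pos[OF weight_m]
    proof eventually_elim
      case (elim x)
      show ?case
      proof
        assume x: "x \<in> {x\<in>cube p. lv < m x}"
        then have "lv < \<bar>m x\<bar>" by auto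
        with elim(1) lv0 obtain d where d: "d > 0" "\<And>q. 0 < snd q \<Longrightarrow> snd q < d \<Longrightarrow> x \<in> cube q \<Longrightarrow>
            ennreal lv * emeasure lebesgue (cube q) < (\<integral>\<^sup>+y\<in>cube q. ennreal \<bar>m y\<bar> \<partial>lebesgue)"
          using less_imp_le by blast
        have "lv < avg m q" if q: "0 < snd q" "snd q < d" "x \<in> cube q" for q
        proof -
          have "ennreal (lv * vol q) = ennreal lv * emeasure lebesgue (cube q)"
            unfolding emeasure_cube[OF q(1)] using lv0 by (simp add: ennreal_mult')
          also have "\<dots> < (\<integral>\<^sup>+y\<in>cube q. ennreal \<bar>m y\<bar> \<partial>lebesgue)" by (rule d(2)[OF q])
          also have "\<dots> = (\<integral>\<^sup>+y\<in>cube q. ennreal (m y) \<partial>lebesgue)"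
            using weight_pos[OF weight_m] by (intro nn_integral_cong_AE) (auto elim: eventually_mono)
          also have "\<dots> = ennreal (avg m q * vol q)"
            by (simp add: emeasure_weight_measure[OF weight_m, symmetric] emeasure_eq_avg[OF q(1)])
          finally show ?thesis using lv0 vol_pos[OF q(1)] by (simp add: ennreal_less_iff)
        qed
        then show "x \<in> (\<Union>q\<in>C. interior (cube q))"
          using stopping_cube[OF _ p lv, of x] elim(2) x d(1) unfolding C_def by blast
      qed
    qed
    then have "AE x in weight_measure m. x \<in> {x\<in>cube p. lv < m x} \<longrightarrow> x \<in> (\<Union>q\<in>C. interior (cube q))"
      by (subst AE_weight_measure_iff[OF weight_m])
    then have "emeasure (weight_measure m) {x\<in>cube p. lv < m x} \<le> emeasure (weight_measure m) (\<Union>q\<in>C. interior (cube q))"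
    proof (rule emeasure_mono_AE)
      have "open (\<Union>q\<in>C. interior (cube q))" by auto
      then show "(\<Union>q\<in>C. interior (cube q)) \<in> sets (weight_measure m)" by simp
    qed
    with bound show ?thesis unfolding A_def by simp
  qed
  then show ?thesis using b c by blast
qed

end

context spread_weight
begin

text \<open>Gehring's argument: the level set estimate is integrated against e t^(e-1). Levels below
  the average give the right hand side; higher levels give back at most half of the left hand side,
  which can be absorbed because truncation at N keeps it finite.\<close>

lemma truncated_reverse_Hoelder:
  assumes bc: "0 < b" "b \<le> 1" "0 \<le> c"
    and level: "\<And>lv. avg m p \<le> lv \<Longrightarrow> emeasure (weight_measure m) {x\<in>cube p. lv < m x}
        \<le> ennreal (c * lv) * emeasure lebesgue {x\<in>cube p. b * lv < m x}"
    and p: "0 < snd p" and e: "0 < e" "e \<le> 1" "2 * e * c \<le> b\<^sup>2" and N: "0 < N"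
  shows "(\<integral>\<^sup>+x\<in>cube p. ennreal (m x * min (m x) N powr e) \<partial>lebesgue) \<le> ennreal (2 * avg m p powr (1 + e) * vol p)"
proof -
  let ?W = "weight_measure m" and ?A = "avg m p"
  have A: "0 < ?A" by (rule avg_pos[OF p])
  obtain D where "doubling_measure ?W D" using doubling_weight_measure by blast
  then have sfW: "sigma_finite_measure ?W" by (rule doubling_measure.sigma_finite_K)
  have sfL: "sigma_finite_measure (lebesgue :: 'a measure)"
    using doubling_measure_lebesgue by (rule doubling_measure.sigma_finite_K)
  \<comment> \<open>m is positive only almost everywhere; the maximum with 0 makes T nonnegative at
    every point.\<close>
  define T where "T x = max 0 (min (m x) N)" for x
  have T [measurable]: "T \<in> borel_measurable lebesgue" unfolding T_def by measurable
  define J where "J = (\<integral>\<^sup>+x\<in>cube p. ennreal (m x * T x powr e) \<partial>lebesgue)"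
  define G where "G x = ennreal (T x) * indicator (cube p) x" for x
  have G [measurable]: "G \<in> borel_measurable lebesgue" unfolding G_def by measurable
  have GW [measurable]: "G \<in> borel_measurable ?W" using G by simp
  \<comment> \<open>For t < N the set {H > t} contains {m > b t} within the cube.\<close>
  define H where "H x = ennreal (T x / b) * indicator (cube p) x" for x
  have H [measurable]: "H \<in> borel_measurable lebesgue" unfolding H_def by measurable
  have T0: "0 \<le> T x" for x by (simp add: T_def)
  have powr_ind: "ennreal_powr (ennreal (f x) * indicator (cube p) x) a = ennreal (f x powr a) * indicator (cube p) x"
    if "\<And>x. 0 \<le> f x" for a x and f :: "'a \<Rightarrow> real"
    using that by (auto simp: indicator_def ennreal_powr_ennreal ennreal_powr_def)
  have J_eq: "J = (\<integral>\<^sup>+x. ennreal_powr (G x) e \<partial>?W)"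
    unfolding G_def J_def
    using weight_pos[OF weight_m]
    by (subst nn_integral_weight_measure[OF weight_m])
       (auto intro!: nn_integral_cong_AE elim!: eventually_mono simp: ennreal_mult indicator_def ennreal_powr_ennreal T0)
  also have "\<dots> = (\<integral>\<^sup>+t\<in>{0<..}. ennreal (e * t powr (e - 1)) * emeasure ?W {x\<in>space ?W. ennreal t < G x} \<partial>lborel)"
    by (rule layer_cake[OF sfW GW e(1)])
  also have "\<dots> \<le> (\<integral>\<^sup>+t. ennreal (e * t powr (e - 1)) * indicator {t. ennreal t < ennreal ?A} t * indicator {0<..} t * emeasure ?W (cube p)
      + ennreal (e * c) * (ennreal ((1 + e) * t powr ((1 + e) - 1)) * emeasure lebesgue {x\<in>space lebesgue. ennreal t < H x} * indicator {0<..} t) \<partial>lborel)"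
  proof (rule nn_integral_mono)
    fix t :: real
    show "ennreal (e * t powr (e - 1)) * emeasure ?W {x\<in>space ?W. ennreal t < G x} * indicator {0<..} t
      \<le> ennreal (e * t powr (e - 1)) * indicator {t. ennreal t < ennreal ?A} t * indicator {0<..} t * emeasure ?W (cube p)
      + ennreal (e * c) * (ennreal ((1 + e) * t powr ((1 + e) - 1)) * emeasure lebesgue {x\<in>space lebesgue. ennreal t < H x} * indicator {0<..} t)"
    proof (cases "0 < t")
      case t: True
      show ?thesis
      proof (cases "t < ?A")
        case True
        have "{x\<in>space ?W. ennreal t < G x} \<subseteq> cube p" by (auto simp: G_def indicator_def split: if_splits)
        then have "emeasure ?W {x\<in>space ?W. ennreal t < G x} \<le> emeasure ?W (cube p)"
          by (rule emeasure_mono) simp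
        then have "ennreal (e * t powr (e - 1)) * emeasure ?W {x\<in>space ?W. ennreal t < G x}
            \<le> ennreal (e * t powr (e - 1)) * emeasure ?W (cube p)"
          by (rule mult_left_mono) simp
        then show ?thesis
          using t True by (simp add: ennreal_less_iff add_increasing2)
      next
        case False
        have sub: "{x\<in>space ?W. ennreal t < G x} \<subseteq> {x\<in>cube p. t < m x}"
          using t by (auto simp: G_def indicator_def T_def ennreal_less_iff split: if_splits)
        have "emeasure ?W {x\<in>space ?W. ennreal t < G x} \<le> ennreal (c * t) * emeasure lebesgue {x\<in>space lebesgue. ennreal t < H x}"
        proof (cases "t < N")
          case True
          have "emeasure ?W {x\<in>space ?W. ennreal t < G x} \<le> emeasure ?W {x\<in>cube p. t < m x}"
            using sub by (rule emeasure_mono) simp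
          also have "\<dots> \<le> ennreal (c * t) * emeasure lebesgue {x\<in>cube p. b * t < m x}"
            using False by (intro level) simp
          also have "\<dots> \<le> ennreal (c * t) * emeasure lebesgue {x\<in>space lebesgue. ennreal t < H x}"
          proof (intro mult_left_mono emeasure_mono subsetI)
            fix x assume x: "x \<in> {x\<in>cube p. b * t < m x}"
            have "b * t \<le> 1 * t" using bc t by (intro mult_right_mono) auto
            with x True have "b * t < T x" by (auto simp: T_def)
            then have "t < T x / b" using bc(1) by (simp add: field_simps)
            then show "x \<in> {x\<in>space lebesgue. ennreal t < H x}"
              using x t by (simp add: H_def ennreal_less_iff)
          next
            show "{x\<in>space lebesgue. ennreal t < H x} \<in> sets lebesgue" by measurable
          qed simp
          finally show ?thesis .
        next
          case False
          then have "{x\<in>space ?W. ennreal t < G x} = {}"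
            using t by (auto simp: G_def indicator_def T_def ennreal_less_iff split: if_splits)
          then show ?thesis by (simp only: emeasure_empty zero_le)
        qed
        then have "ennreal (e * t powr (e - 1)) * emeasure ?W {x\<in>space ?W. ennreal t < G x}
          \<le> ennreal (e * t powr (e - 1)) * (ennreal (c * t) * emeasure lebesgue {x\<in>space lebesgue. ennreal t < H x})"
          by (rule mult_left_mono) simp
        also have "\<dots> = ennreal (e * c * t powr e) * emeasure lebesgue {x\<in>space lebesgue. ennreal t < H x}"
        proof -
          have "e * t powr (e - 1) * (c * t) = e * c * t powr e" using t by (simp add: powr_diff)
          moreover have "ennreal (e * t powr (e - 1)) * ennreal (c * t) = ennreal (e * t powr (e - 1) * (c * t))"
            using e t bc by (intro ennreal_mult[symmetric]) auto
          ultimately show ?thesis by (simp only: mult.assoc[symmetric])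
        qed
        \<comment> \<open>The factor 1 + e completes the kernel of exponent 1 + e, so that the layer
          cake formula applies to H.\<close>
        also have "\<dots> \<le> ennreal (e * c * ((1 + e) * t powr e)) * emeasure lebesgue {x\<in>space lebesgue. ennreal t < H x}"
        proof (intro mult_right_mono ennreal_leI)
          have "t powr e \<le> (1 + e) * t powr e" using e by (simp add: distrib_right)
          then show "e * c * t powr e \<le> e * c * ((1 + e) * t powr e)" using e bc by (intro mult_left_mono) auto
        qed simp
        also have "\<dots> = ennreal (e * c) * (ennreal ((1 + e) * t powr ((1 + e) - 1)) * emeasure lebesgue {x\<in>space lebesgue. ennreal t < H x})"
          using e bc by (simp add: ennreal_mult mult.assoc)
        finally show ?thesis using t by (simp add: add_increasing)
      qed
    qed simp
  qed
  also have "\<dots> = (\<integral>\<^sup>+t\<in>{0<..}. ennreal (e * t powr (e - 1)) * indicator {t. ennreal t < ennreal ?A} t \<partial>lborel) * emeasure ?W (cube p)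
     + ennreal (e * c) * (\<integral>\<^sup>+t\<in>{0<..}. ennreal ((1 + e) * t powr ((1 + e) - 1)) * emeasure lebesgue {x\<in>space lebesgue. ennreal t < H x} \<partial>lborel)"
  proof -
    have meas: "(\<lambda>t. emeasure lebesgue {x\<in>space lebesgue. ennreal t < H x}) \<in> borel_measurable lborel"
    proof -
      have "(\<lambda>t. emeasure lebesgue {x\<in>space lebesgue. ennreal t < H x}) \<in> borel_measurable borel"
      proof -
        interpret L: sigma_finite_measure "lebesgue :: 'a measure" by (rule sfL)
        have "(\<lambda>t. emeasure lebesgue {x\<in>space lebesgue. ennreal t < H x})
            = (\<lambda>t. emeasure lebesgue (Pair t -` {z\<in>space (borel \<Otimes>\<^sub>M lebesgue). ennreal (fst z) < H (snd z)}))"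
          by (intro ext arg_cong2[where f=emeasure]) (auto simp: space_pair_measure)
        also have "\<dots> \<in> borel_measurable borel"
          by (rule L.measurable_emeasure_Pair) measurable
        finally show ?thesis .
      qed
      then show ?thesis by simp
    qed
    note [measurable] = meas meas[simplified]
    show ?thesis
      by (subst nn_integral_add) (auto simp: nn_integral_multc nn_integral_cmult)
  qed
  also have "\<dots> = ennreal (?A powr e) * emeasure ?W (cube p) + ennreal (e * c) * (\<integral>\<^sup>+x. ennreal_powr (H x) (1 + e) \<partial>lebesgue)"
    using e A by (subst nn_integral_powr_kernel[OF e(1)], subst layer_cake[OF sfL H, symmetric])
       (auto simp: ennreal_powr_ennreal)
  also have "\<dots> \<le> ennreal (?A powr (1 + e) * vol p) + ennreal (1/2) * J"
  proof (rule add_mono)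
    show "ennreal (?A powr e) * emeasure ?W (cube p) \<le> ennreal (?A powr (1 + e) * vol p)"
      using A vol_pos[OF p] by (simp add: emeasure_eq_avg[OF p] ennreal_mult[symmetric] powr_add mult_ac)
    have "ennreal (e * c) * (\<integral>\<^sup>+x. ennreal_powr (H x) (1 + e) \<partial>lebesgue)
        = (\<integral>\<^sup>+x. ennreal (e * c) * ennreal_powr (H x) (1 + e) \<partial>lebesgue)"
      by (rule nn_integral_cmult[symmetric]) measurable
    also have "\<dots> \<le> (\<integral>\<^sup>+x. ennreal (1/2) * (ennreal (m x * T x powr e) * indicator (cube p) x) \<partial>lebesgue)"
    proof (rule nn_integral_mono_AE)
      show "AE x in lebesgue. ennreal (e * c) * ennreal_powr (H x) (1 + e) \<le> ennreal (1/2) * (ennreal (m x * T x powr e) * indicator (cube p) x)"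
        using weight_pos[OF weight_m]
      proof eventually_elim
        case (elim x)
        have Tx: "0 < T x" "T x \<le> m x" using elim N by (auto simp: T_def)
        have "e * c * (T x / b) powr (1 + e) = e * c * (T x * T x powr e) / b powr (1 + e)"
          using Tx bc by (simp add: powr_divide powr_add)
        also have "\<dots> \<le> e * c * (m x * T x powr e) / b powr (1 + e)"
          using Tx e bc by (intro divide_right_mono mult_left_mono mult_right_mono) auto
        \<comment> \<open>As b \<le> 1 and e \<le> 1, b^2 is a lower bound for b^(1+e); hence the
          form of the condition 2 e c \<le> b^2.\<close>
        also have "\<dots> \<le> e * c * (m x * T x powr e) / b powr 2"
          using Tx e bc elim by (intro divide_left_mono powr_mono') (auto intro!: mult_nonneg_nonneg mult_pos_pos)
        also have "\<dots> = e * c / b\<^sup>2 * (m x * T x powr e)" using bc by (simp add: powr_numeral)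
        also have "\<dots> \<le> 1/2 * (m x * T x powr e)"
          using e bc elim by (intro mult_right_mono) (auto simp: field_simps)
        finally have "ennreal (e * c * (T x / b) powr (1 + e)) \<le> ennreal (1/2 * (m x * T x powr e))"
          by (rule ennreal_leI)
        moreover have "ennreal (e * c) * ennreal_powr (H x) (1 + e) = ennreal (e * c * (T x / b) powr (1 + e)) * indicator (cube p) x"
        proof -
          have "ennreal_powr (H x) (1 + e) = ennreal ((T x / b) powr (1 + e)) * indicator (cube p) x"
            unfolding H_def using powr_ind[of "\<lambda>x. T x / b" x "1 + e"] T0 bc by simp
          then show ?thesis using e bc by (simp add: ennreal_mult mult.assoc)
        qed
        moreover have "ennreal (1/2) * (ennreal (m x * T x powr e) * indicator (cube p) x) = ennreal (1/2 * (m x * T x powr e)) * indicator (cube p) x"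
          using elim by (subst mult.assoc[symmetric], subst ennreal_mult[symmetric]) auto
        ultimately show ?case by (simp only: mult_right_mono zero_le)
      qed
    qed
    also have "\<dots> = ennreal (1/2) * J"
      unfolding J_def by (rule nn_integral_cmult) measurable
    finally show "ennreal (e * c) * (\<integral>\<^sup>+x. ennreal_powr (H x) (1 + e) \<partial>lebesgue) \<le> ennreal (1/2) * J" .
  qed
  finally have Jle: "J \<le> ennreal (?A powr (1 + e) * vol p) + ennreal (1/2) * J" .
  \<comment> \<open>A bound that depends on N, used to see that J is finite.\<close>
  have "J \<le> ennreal (N powr e) * emeasure ?W (cube p)"
  proof -
    have "J \<le> (\<integral>\<^sup>+x. ennreal (N powr e) * (ennreal (m x) * indicator (cube p) x) \<partial>lebesgue)"
      unfolding J_def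
    proof (rule nn_integral_mono_AE)
      show "AE x in lebesgue. ennreal (m x * T x powr e) * indicator (cube p) x \<le> ennreal (N powr e) * (ennreal (m x) * indicator (cube p) x)"
        using weight_pos[OF weight_m]
      proof eventually_elim
        case (elim x)
        have "T x powr e \<le> N powr e" using e N T0 by (intro powr_mono2) (auto simp: T_def)
        then show ?case
          using elim by (auto simp: indicator_def ennreal_mult[symmetric] intro!: ennreal_leI)
      qed
    qed
    also have "\<dots> = ennreal (N powr e) * emeasure ?W (cube p)"
      by (subst nn_integral_cmult) (auto simp: emeasure_weight_measure weight_m)
    finally show ?thesis .
  qed
  also have "\<dots> < \<infinity>" using mass_finite[OF p] by (simp add: ennreal_mult_less_top)
  finally have "J < \<infinity>" .
  then obtain j where j: "J = ennreal j" "0 \<le> j" by (cases J) auto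
  have "j \<le> ?A powr (1 + e) * vol p + 1/2 * j"
  proof -
    have "ennreal (1/2) * J = ennreal (1/2 * j)"
      unfolding j(1) by (rule ennreal_mult[symmetric]) (use j in auto)
    then have "ennreal j \<le> ennreal (?A powr (1 + e) * vol p) + ennreal (1/2 * j)"
      using Jle unfolding j(1) by (simp only:)
    also have "\<dots> = ennreal (?A powr (1 + e) * vol p + 1/2 * j)"
      by (rule ennreal_plus[symmetric]) (use j vol_pos[OF p] in auto)
    finally show ?thesis using j(2) vol_pos[OF p] by (subst (asm) ennreal_le_iff) auto
  qed
  then have "J \<le> ennreal (2 * ?A powr (1 + e) * vol p)"
    unfolding j by (intro ennreal_leI) simp
  moreover have "(\<integral>\<^sup>+x\<in>cube p. ennreal (m x * min (m x) N powr e) \<partial>lebesgue) = J"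
    unfolding J_def using weight_pos[OF weight_m] N
    by (intro nn_integral_cong_AE) (auto elim!: eventually_mono simp: T_def)
  ultimately show ?thesis by simp
qed

text \<open>The truncated bound is uniform in N, so Fatou's lemma removes the truncation.\<close>

lemma reverse_Hoelder:
  "\<exists>e>0. \<forall>p. 0 < snd p \<longrightarrow> emeasure (pm (1 + e)) (cube p) \<le> ennreal (2 * avg m p powr (1 + e) * vol p)"
proof -
  obtain b c where bc: "0 < b" "b \<le> 1" "0 \<le> c" "\<And>p lv. 0 < snd p \<Longrightarrow> avg m p \<le> lv \<Longrightarrow>
     emeasure (weight_measure m) {x\<in>cube p. lv < m x} \<le> ennreal (c * lv) * emeasure lebesgue {x\<in>cube p. b * lv < m x}"
    using level_set_estimate by blast
  \<comment> \<open>Chosen for 2 e c \<le> b^2; the summand 1 covers c = 0.\<close>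
  define e where "e = min 1 (b\<^sup>2 / (2 * c + 1))"
  have e: "0 < e" "e \<le> 1" using bc by (auto simp: e_def)
  have "e * (2 * c) \<le> b\<^sup>2 / (2 * c + 1) * (2 * c)"
    using bc by (intro mult_right_mono) (auto simp: e_def)
  also have "\<dots> \<le> b\<^sup>2" using bc by (simp add: divide_simps mult_left_mono)
  finally have e3: "2 * e * c \<le> b\<^sup>2" by (simp add: mult_ac)
  have "emeasure (pm (1 + e)) (cube p) \<le> ennreal (2 * avg m p powr (1 + e) * vol p)" if p: "0 < snd p" for p
  proof -
    let ?g = "\<lambda>n x. ennreal (m x * min (m x) (real (Suc n)) powr e) * indicator (cube p) x"
    have "emeasure (pm (1 + e)) (cube p) = (\<integral>\<^sup>+x\<in>cube p. ennreal (m x powr (1 + e)) \<partial>lebesgue)"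
      by (intro emeasure_weight_measure weight_powr weight_m) simp
    also have "\<dots> = (\<integral>\<^sup>+x. liminf (\<lambda>n. ?g n x) \<partial>lebesgue)"
    proof (rule nn_integral_cong_AE)
      show "AE x in lebesgue. ennreal (m x powr (1 + e)) * indicator (cube p) x = liminf (\<lambda>n. ?g n x)"
        using weight_pos[OF weight_m]
      proof eventually_elim
        case (elim x)
        obtain n0 where n0: "m x \<le> real n0" using real_arch_simple by blast
        have "eventually (\<lambda>n. ?g n x = ennreal (m x powr (1 + e)) * indicator (cube p) x) sequentially"
          using eventually_ge_at_top[of n0]
        proof eventually_elim
          case (elim n)
          then have "min (m x) (real (Suc n)) = m x" using n0 by simp
          then show ?case using \<open>0 < m x\<close> by (simp add: powr_add)
        qed
        then have "(\<lambda>n. ?g n x) \<longlonglongrightarrow> ennreal (m x powr (1 + e)) * indicator (cube p) x"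
          by (rule tendsto_eventually)
        then show ?case by (intro lim_imp_Liminf[symmetric]) auto
      qed
    qed
    also have "\<dots> \<le> liminf (\<lambda>n. \<integral>\<^sup>+x. ?g n x \<partial>lebesgue)"
      by (rule nn_integral_liminf) measurable
    also have "\<dots> \<le> ennreal (2 * avg m p powr (1 + e) * vol p)"
      using truncated_reverse_Hoelder[OF bc(1,2,3) bc(4)[OF p] p e e3]
      by (intro Liminf_le) (auto intro!: always_eventually)
    finally show ?thesis .
  qed
  then show ?thesis using e by blast
qed

end

section \<open>Weights of class \<open>A\<^sub>1\<close> and \<open>A\<^sub>p\<close>\<close>

text \<open>Turns the condition on extended numbers into real constants: A is uniform, and c is a
  lower bound of v on the individual cube that later cancels.\<close>

lemma A1_class_const:
  assumes \<mu>: "weight \<mu>" and v: "v \<in> A1_class (weight_measure \<mu>)"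
    and fin: "\<And>p. 0 < snd p \<Longrightarrow> emeasure (weight_measure \<mu>) (cube p) < \<infinity>"
  shows "\<exists>A>0. \<forall>p. 0 < snd p \<longrightarrow> (\<exists>c>0. (AE x in lebesgue. x \<in> cube p \<longrightarrow> c \<le> v x) \<and>
    emeasure (weight_measure (\<lambda>x. v x * \<mu> x)) (cube p) \<le> ennreal (A * c) * emeasure (weight_measure \<mu>) (cube p))"
proof -
  let ?M = "weight_measure \<mu>"
  have wv: "weight v" and S: "(SUP Q\<in>cubes. average ?M Q v / ess_inf_on ?M Q v) < \<infinity>"
    using v by (auto simp: A1_class_def)
  have [measurable]: "v \<in> borel_measurable lebesgue" "\<mu> \<in> borel_measurable lebesgue"
    using wv \<mu> by (auto simp: weight_def)
  obtain B where B: "0 \<le> B" "(SUP Q\<in>cubes. average ?M Q v / ess_inf_on ?M Q v) = ennreal B"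
    using S by (cases "SUP Q\<in>cubes. average ?M Q v / ess_inf_on ?M Q v") auto
  \<comment> \<open>2 compensates for c being half of the essential infimum; B + 1 makes A
    positive.\<close>
  define A where "A = 2 * (B + 1)"
  have "\<exists>c>0. (AE x in lebesgue. x \<in> cube p \<longrightarrow> c \<le> v x) \<and>
    emeasure (weight_measure (\<lambda>x. v x * \<mu> x)) (cube p) \<le> ennreal (A * c) * emeasure ?M (cube p)" if p: "0 < snd p" for p
  proof -
    let ?Q = "cube p" and ?W = "weight_measure (\<lambda>x. v x * \<mu> x)"
    let ?a = "average ?M ?Q v" and ?e = "ess_inf_on ?M ?Q v"
    have M: "0 < emeasure ?M ?Q" "emeasure ?M ?Q < \<infinity>"
      using weight_measure_cube_pos[OF \<mu> p] fin[OF p] by auto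
    have W: "0 < emeasure ?W ?Q" using weight_measure_cube_pos[OF weight_mult[OF wv \<mu>] p] .
    have W_eq: "emeasure ?W ?Q = ?a * emeasure ?M ?Q"
    proof -
      have "emeasure ?W ?Q = (\<integral>\<^sup>+x\<in>?Q. ennreal \<bar>v x\<bar> \<partial>?M)"
        unfolding emeasure_weight_measure[OF weight_mult[OF wv \<mu>] cube_sets]
        using weight_pos[OF wv] weight_pos[OF \<mu>]
        by (subst set_nn_integral_weight_measure[OF \<mu>])
           (auto intro!: nn_integral_cong_AE elim!: eventually_elim2 simp: ennreal_mult mult.commute)
      then show ?thesis
        unfolding average_def using M by (simp add: ennreal_divide_times)
    qed
    have "?a / ?e \<le> ennreal B"
      unfolding B(2)[symmetric] using p by (intro SUP_upper) simp
    have a0: "0 < ?a" using W W_eq M by (metis gr_zeroI mult_zero_left)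
    have e0: "0 < ?e"
    proof (rule ccontr)
      assume "\<not> 0 < ?e"
      then have "?a / ?e = \<infinity>" using a0 by (simp add: ennreal_divide_zero)
      then show False using \<open>?a / ?e \<le> ennreal B\<close> by (simp add: top_unique)
    qed
    have ess: "\<exists>c>t. AE x in lebesgue. x \<in> ?Q \<longrightarrow> c \<le> ennreal (v x)" if "t < ?e" for t
      using that unfolding ess_inf_on_def less_Sup_iff AE_weight_measure_iff[OF \<mu>] by auto
    \<comment> \<open>An infinite essential infimum would force v \<ge> n for all n almost
      everywhere on a cube of positive mass.\<close>
    have einf: "?e < \<infinity>"
    proof (rule ccontr)
      assume "\<not> ?e < \<infinity>"
      then have top: "?e = top" by (metis infinity_ennreal_def less_top)
      have "AE x in lebesgue. x \<in> ?Q \<longrightarrow> ennreal (real n) \<le> ennreal (v x)" for n :: nat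
        using ess[of "ennreal (real n)"] top by (auto elim: eventually_mono intro: order_trans less_imp_le)
      then have "AE x in lebesgue. \<forall>n::nat. x \<in> ?Q \<longrightarrow> ennreal (real n) \<le> ennreal (v x)"
        by (subst AE_all_countable) blast
      then have "AE x in lebesgue. x \<notin> ?Q"
        using weight_pos[OF wv]
      proof eventually_elim
        case (elim x)
        obtain n where "v x < real n" using reals_Archimedean2 by blast
        with elim show ?case by (auto dest!: spec[of _ n])
      qed
      then have "?Q \<in> null_sets lebesgue" by (subst AE_iff_null_sets) auto
      then have "?Q \<in> null_sets ?M" by (simp add: null_sets_weight_measure[OF \<mu>])
      then show False using M by auto
    qed
    obtain e where e: "?e = ennreal e" "0 < e"
      using e0 einf by (cases ?e) auto
    \<comment> \<open>Half of the essential infimum lies strictly below the supremum defining it, so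
      some almost everywhere lower bound exceeds it.\<close>
    obtain c' where c': "ennreal (e / 2) < c'" "AE x in lebesgue. x \<in> ?Q \<longrightarrow> c' \<le> ennreal (v x)"
      using ess[of "ennreal (e / 2)"] e by (auto simp: ennreal_less_iff)
    have "AE x in lebesgue. x \<in> ?Q \<longrightarrow> e / 2 \<le> v x"
      using c'(2) weight_pos[OF wv]
    proof eventually_elim
      case (elim x)
      show ?case
      proof
        assume "x \<in> ?Q"
        with elim(1) have "c' \<le> ennreal (v x)" by blast
        with c'(1) have "ennreal (e / 2) < ennreal (v x)" by (rule less_le_trans)
        then show "e / 2 \<le> v x" using elim(2) e by (simp add: ennreal_less_iff)
      qed
    qed
    moreover have "emeasure ?W ?Q \<le> ennreal (A * (e / 2)) * emeasure ?M ?Q"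
    proof -
      have "?a = ?a / ?e * ?e" using e by (simp add: ennreal_divide_times)
      also have "\<dots> \<le> ennreal B * ?e" using \<open>?a / ?e \<le> ennreal B\<close> by (rule mult_right_mono) simp
      also have "\<dots> \<le> ennreal (A * (e / 2))"
        unfolding e(1) A_def using B e by (simp add: ennreal_mult[symmetric] distrib_right ennreal_leI)
      finally show ?thesis unfolding W_eq by (rule mult_right_mono) simp
    qed
    ultimately show ?thesis using e by (intro exI[of _ "e / 2"]) auto
  qed
  moreover have "0 < A" using B by (simp add: A_def)
  ultimately show ?thesis by blast
qed

text \<open>As v \<ge> c on the cube and its \<mu>-average is at most A c, the set {v \<mu> \<le> (b
  / A) avg(v \<mu>)} lies in {\<mu> \<le> b avg(\<mu>)} up to a null set.\<close>

lemma A1_class_spread: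
  assumes \<mu>: "spread \<mu>" and v: "v \<in> A1_class (weight_measure \<mu>)"
  shows "spread (\<lambda>x. v x * \<mu> x)"
proof -
  interpret mu: spread_weight \<mu> using \<mu> by unfold_locales
  let ?m = "\<lambda>x. v x * \<mu> x"
  have wv: "weight v" using v by (simp add: A1_class_def)
  obtain A where A: "A > 0" "\<And>p. 0 < snd p \<Longrightarrow> \<exists>c>0. (AE x in lebesgue. x \<in> cube p \<longrightarrow> c \<le> v x) \<and>
    emeasure (weight_measure ?m) (cube p) \<le> ennreal (A * c) * emeasure (weight_measure \<mu>) (cube p)"
    using A1_class_const[OF mu.weight_m v mu.mass_finite] by blast
  have fin: "emeasure (weight_measure ?m) (cube p) < \<infinity>" if "0 < snd p" for p
    using A(2)[OF that] mu.mass_finite[OF that] by (auto simp: ennreal_mult_less_top intro: le_less_trans)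
  have "\<exists>b>0. \<forall>p. 0 < snd p \<longrightarrow> emeasure lebesgue {x\<in>cube p. ?m x \<le> b * avg ?m p} \<le> ennreal (\<eta> * vol p)"
    if \<eta>: "0 < \<eta>" for \<eta>
  proof -
    obtain b where b: "b > 0" "\<And>p. 0 < snd p \<Longrightarrow> emeasure lebesgue {x\<in>cube p. \<mu> x \<le> b * avg \<mu> p} \<le> ennreal (\<eta> * vol p)"
      using \<mu> \<eta> unfolding spread_def by blast
    have "emeasure lebesgue {x\<in>cube p. ?m x \<le> b / A * avg ?m p} \<le> ennreal (\<eta> * vol p)" if p: "0 < snd p" for p
    proof -
      obtain c where c: "c > 0" "AE x in lebesgue. x \<in> cube p \<longrightarrow> c \<le> v x"
        "emeasure (weight_measure ?m) (cube p) \<le> ennreal (A * c) * emeasure (weight_measure \<mu>) (cube p)"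
        using A(2)[OF p] by blast
      have "ennreal (avg ?m p * vol p) = emeasure (weight_measure ?m) (cube p)"
        using fin[OF p] vol_pos[OF p] by (simp add: avg_def emeasure_eq_ennreal_measure less_top)
      also have "\<dots> \<le> ennreal (A * c * (avg \<mu> p * vol p))"
        using c(3) A(1) c(1) by (simp add: mu.emeasure_eq_avg[OF p] ennreal_mult'[symmetric])
      finally have "avg ?m p * vol p \<le> A * c * (avg \<mu> p * vol p)"
        using A(1) c(1) mu.avg_pos[OF p] vol_pos[OF p] by (subst (asm) ennreal_le_iff) auto
      then have le: "avg ?m p \<le> A * c * avg \<mu> p" using vol_pos[OF p] by (simp add: mult.assoc[symmetric])
      have "emeasure lebesgue {x\<in>cube p. ?m x \<le> b / A * avg ?m p} \<le> emeasure lebesgue {x\<in>cube p. \<mu> x \<le> b * avg \<mu> p}"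
      proof (rule emeasure_mono_AE)
        show "AE x in lebesgue. x \<in> {x\<in>cube p. ?m x \<le> b / A * avg ?m p} \<longrightarrow> x \<in> {x\<in>cube p. \<mu> x \<le> b * avg \<mu> p}"
          using c(2) weight_pos[OF mu.weight_m]
        proof eventually_elim
          case (elim x)
          show ?case
          proof
            assume x: "x \<in> {x\<in>cube p. ?m x \<le> b / A * avg ?m p}"
            then have "c * \<mu> x \<le> v x * \<mu> x" using elim by (intro mult_right_mono) auto
            also have "\<dots> \<le> b / A * avg ?m p" using x by simp
            also have "\<dots> \<le> b / A * (A * c * avg \<mu> p)" using le b A by (intro mult_left_mono) auto
            also have "\<dots> = c * (b * avg \<mu> p)" using A by simp
            finally show "x \<in> {x\<in>cube p. \<mu> x \<le> b * avg \<mu> p}" using x c(1) by simp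
          qed
        qed
        have "cube p \<inter> {x\<in>space lebesgue. \<mu> x \<le> b * avg \<mu> p} \<in> sets lebesgue"
          by (intro sets.Int; measurable)
        then show "{x\<in>cube p. \<mu> x \<le> b * avg \<mu> p} \<in> sets lebesgue" by (simp add: Int_def)
      qed
      also have "\<dots> \<le> ennreal (\<eta> * vol p)" by (rule b(2)[OF p])
      finally show ?thesis .
    qed
    then show ?thesis using b(1) A(1) by (intro exI[of _ "b / A"]) simp
  qed
  then show ?thesis
    unfolding spread_def using fin weight_mult[OF wv mu.weight_m] by blast
qed

text \<open>Replacing \<mu> by v \<mu> multiplies the integral of |h| over a cube by at least c and
  the mass of the cube by at most A c, so c cancels from the averages.\<close>

lemma A1_class_maximal_function_le:
  assumes \<mu>: "spread \<mu>" and v: "v \<in> A1_class (weight_measure \<mu>)"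
  shows "\<exists>A>0. \<forall>h\<in>borel_measurable lebesgue. \<forall>x.
    maximal_function (weight_measure \<mu>) h x \<le> ennreal A * maximal_function (weight_measure (\<lambda>x. v x * \<mu> x)) h x"
proof -
  interpret mu: spread_weight \<mu> using \<mu> by unfold_locales
  let ?m = "\<lambda>x. v x * \<mu> x" and ?M = "weight_measure \<mu>" and ?W = "weight_measure (\<lambda>x. v x * \<mu> x)"
  interpret m: spread_weight ?m using A1_class_spread[OF \<mu> v] by unfold_locales
  have wv: "weight v" using v by (simp add: A1_class_def)
  obtain A where A: "A > 0" "\<And>p. 0 < snd p \<Longrightarrow> \<exists>c>0. (AE x in lebesgue. x \<in> cube p \<longrightarrow> c \<le> v x) \<and>
    emeasure ?W (cube p) \<le> ennreal (A * c) * emeasure ?M (cube p)"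
    using A1_class_const[OF mu.weight_m v mu.mass_finite] by blast
  obtain D where D: "doubling_measure ?W D" using m.doubling_weight_measure by blast
  have "maximal_function ?M h x \<le> ennreal A * maximal_function ?W h x"
    if h [measurable]: "h \<in> borel_measurable lebesgue" for h x
    unfolding maximal_function_def[of ?M]
  proof (rule SUP_least)
    fix Q assume "Q \<in> {Q \<in> cubes. x \<in> Q}"
    then obtain p where p: "0 < snd p" "x \<in> cube p" and Q: "Q = cube p" unfolding in_cubes_iff by blast
    obtain c where c: "c > 0" "AE x in lebesgue. x \<in> cube p \<longrightarrow> c \<le> v x"
        "emeasure ?W (cube p) \<le> ennreal (A * c) * emeasure ?M (cube p)"
      using A(2)[OF p(1)] by blast
    define I J where "I = (\<integral>\<^sup>+y\<in>cube p. ennreal \<bar>h y\<bar> \<partial>?M)" and "J = (\<integral>\<^sup>+y\<in>cube p. ennreal \<bar>h y\<bar> \<partial>?W)"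
    have IJ: "ennreal c * I \<le> J"
    proof -
      have "ennreal c * I = (\<integral>\<^sup>+y. ennreal c * (ennreal (\<mu> y) * ennreal \<bar>h y\<bar> * indicator (cube p) y) \<partial>lebesgue)"
        unfolding I_def by (subst set_nn_integral_weight_measure[OF mu.weight_m]) (auto simp: nn_integral_cmult)
      also have "\<dots> \<le> (\<integral>\<^sup>+y. ennreal (?m y) * ennreal \<bar>h y\<bar> * indicator (cube p) y \<partial>lebesgue)"
      proof (rule nn_integral_mono_AE)
        show "AE y in lebesgue. ennreal c * (ennreal (\<mu> y) * ennreal \<bar>h y\<bar> * indicator (cube p) y)
          \<le> ennreal (?m y) * ennreal \<bar>h y\<bar> * indicator (cube p) y"
          using c(2) weight_pos[OF mu.weight_m]
        proof eventually_elim
          case (elim y)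
          show ?case
          proof (cases "y \<in> cube p")
            case True
            have "ennreal c * (ennreal (\<mu> y) * ennreal \<bar>h y\<bar>) = ennreal (c * \<mu> y * \<bar>h y\<bar>)"
              using c elim by (simp add: ennreal_mult mult.assoc)
            also have "\<dots> \<le> ennreal (?m y * \<bar>h y\<bar>)"
              using elim True by (intro ennreal_leI mult_right_mono) auto
            also have "\<dots> = ennreal (?m y) * ennreal \<bar>h y\<bar>" by (rule ennreal_mult'') simp
            finally show ?thesis using True by simp
          qed simp
        qed
      qed
      also have "\<dots> = J" unfolding J_def
        by (subst set_nn_integral_weight_measure[OF m.weight_m]) (auto simp: mult.assoc)
      finally show ?thesis .
    qed
    define M W where "M = avg \<mu> p * vol p" and "W = avg ?m p * vol p"
    have MW: "0 < M" "0 < W" "W \<le> A * c * M"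
    proof -
      show "0 < M" "0 < W" using mu.avg_pos[OF p(1)] m.avg_pos[OF p(1)] vol_pos[OF p(1)] by (simp_all add: M_def W_def)
      have "ennreal W \<le> ennreal (A * c) * ennreal M"
        using c(3) unfolding M_def W_def mu.emeasure_eq_avg[OF p(1)] m.emeasure_eq_avg[OF p(1)] .
      then have "ennreal W \<le> ennreal (A * c * M)" using A c \<open>0 < M\<close> by (simp add: ennreal_mult)
      then show "W \<le> A * c * M" using A c \<open>0 < M\<close> by (subst (asm) ennreal_le_iff) auto
    qed
    have "I / ennreal M \<le> ennreal A * (J / ennreal W)"
    proof (cases J)
      case top
      then have "J / ennreal W = \<infinity>" using MW by (simp add: ennreal_top_divide)
      then show ?thesis using A by (simp add: ennreal_mult_eq_top_iff)
    next
      case (real j)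
      then have "I \<noteq> top" using IJ c(1) by (auto simp: ennreal_mult_top top_unique)
      then obtain i where i: "I = ennreal i" "0 \<le> i" by (cases I) auto
      have "c * i \<le> j" using IJ real i c by (simp add: ennreal_mult[symmetric])
      have "i * W \<le> i * (A * c * M)" using MW i by (intro mult_left_mono) auto
      also have "\<dots> = A * (c * i) * M" by simp
      also have "\<dots> \<le> A * j * M" using \<open>c * i \<le> j\<close> A MW by (intro mult_right_mono mult_left_mono) auto
      finally have "i / M \<le> A * (j / W)" using MW by (simp add: field_simps)
      then show ?thesis
        using i real MW A by (simp add: divide_ennreal ennreal_mult[symmetric] ennreal_leI)
    qed
    also have "J / ennreal W = average ?W (cube p) h"
      unfolding average_def J_def W_def m.emeasure_eq_avg[OF p(1)] ..
    also have "\<dots> \<le> maximal_function ?W h x"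
      using doubling_measure.maximal_function_ge[OF D p] .
    finally show "average ?M Q h \<le> ennreal A * maximal_function ?W h x"
      unfolding average_def I_def M_def Q mu.emeasure_eq_avg[OF p(1)] by (simp add: mult_left_mono)
  qed
  then show ?thesis using A(1) by blast
qed

section \<open>Muckenhoupt classes relative to Lebesgue measure\<close>

lemma spread_1: "spread (\<lambda>x::'a::euclidean_space. 1)"
  and weight_measure_1: "weight_measure (\<lambda>x::'a. 1) = lebesgue"
proof -
  show eq: "weight_measure (\<lambda>x::'a. 1) = lebesgue"
    unfolding weight_measure_def by (simp add: density_1)
  have avg: "avg (\<lambda>x::'a. 1) p = 1" if "0 < snd p" for p
    unfolding avg_def eq using vol_pos[OF that] emeasure_cube[OF that] by (simp add: measure_def)
  have "emeasure (weight_measure (\<lambda>x::'a. 1)) (cube p) < \<infinity>" if "0 < snd p" for p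
    unfolding eq emeasure_cube[OF that] by simp
  moreover have "emeasure lebesgue {x\<in>cube p. (1::real) \<le> 1/2 * avg (\<lambda>x::'a. 1) p} \<le> ennreal (\<eta> * vol p)"
    if "0 < snd p" for p \<eta>
    unfolding avg[OF that] by simp
  moreover have "weight (\<lambda>x::'a. 1)" by (simp add: weight_def)
  moreover have "(0::real) < 1/2" by simp
  ultimately show "spread (\<lambda>x::'a. 1)"
    unfolding spread_def by blast
qed

lemma average_weight:
  assumes "weight u" "0 < snd p"
  shows "average lebesgue (cube p) u = emeasure (weight_measure u) (cube p) / ennreal (vol p)"
  unfolding average_def emeasure_cube[OF assms(2)] emeasure_weight_measure[OF assms(1) cube_sets]
proof -
  have "(\<integral>\<^sup>+x\<in>cube p. ennreal \<bar>u x\<bar> \<partial>lebesgue) = (\<integral>\<^sup>+x\<in>cube p. ennreal (u x) \<partial>lebesgue)"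
    using weight_pos[OF assms(1)] by (intro nn_integral_cong_AE) (auto elim: eventually_mono)
  then show "(\<integral>\<^sup>+x\<in>cube p. ennreal \<bar>u x\<bar> \<partial>lebesgue) / ennreal (vol p) =
      (\<integral>\<^sup>+x\<in>cube p. ennreal (u x) \<partial>lebesgue) / ennreal (vol p)" by simp
qed

text \<open>Chebyshev for the dual weight u = w^(-1/(r-1)): where w is small u is large, and the A_r
  condition bounds the average of u by (B / avg w)^(1/(r-1)).\<close>

lemma Ap_class_spread:
  assumes p: "1 < r" and w: "w \<in> Ap_class r"
  shows "spread w"
proof -
  define u where "u x = w x powr (- 1 / (r - 1))" for x
  have ww: "weight w" and S: "(SUP Q\<in>cubes. average lebesgue Q w *
            ennreal_powr (average lebesgue Q u) (r - 1)) < \<infinity>"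
    using w p unfolding Ap_class_def u_def by simp_all
  have wu: "weight u" unfolding u_def by (rule weight_powr[OF ww])
  have [measurable]: "w \<in> borel_measurable lebesgue" "u \<in> borel_measurable lebesgue"
    using ww wu by (auto simp: weight_def)
  obtain B0 where B0: "0 \<le> B0" "(SUP Q\<in>cubes. average lebesgue Q w *
            ennreal_powr (average lebesgue Q u) (r - 1)) = ennreal B0"
    using S by (cases "SUP Q\<in>cubes. average lebesgue Q w * ennreal_powr (average lebesgue Q u) (r - 1)") auto
  \<comment> \<open>Shifted to be positive, since b is defined by a division by B.\<close>
  define B where "B = B0 + 1"
  have B: "0 < B" using B0 by (simp add: B_def)
  \<comment> \<open>Local integrability of w and u is a consequence of the condition: an infinite
    factor times a positive one would be infinite.\<close>
  have main: "emeasure (weight_measure w) (cube p) < \<infinity> \<and> emeasure (weight_measure u) (cube p) < \<infinity> \<and>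
      0 < avg w p \<and> 0 < avg u p \<and> avg w p * avg u p powr (r - 1) \<le> B" if q: "0 < snd p" for p
  proof -
    let ?X = "emeasure (weight_measure w) (cube p)" and ?Y = "emeasure (weight_measure u) (cube p)"
    have XY: "0 < ?X" "0 < ?Y" using weight_measure_cube_pos[OF ww q] weight_measure_cube_pos[OF wu q] by auto
    have le: "?X / ennreal (vol p) * ennreal_powr (?Y / ennreal (vol p)) (r - 1) \<le> ennreal B"
    proof -
      have "?X / ennreal (vol p) * ennreal_powr (?Y / ennreal (vol p)) (r - 1) \<le> ennreal B0"
        unfolding average_weight[OF ww q, symmetric] average_weight[OF wu q, symmetric] B0(2)[symmetric]
        using q by (intro SUP_upper) simp
      also have "\<dots> \<le> ennreal B" using B0 by (simp add: B_def)
      finally show ?thesis .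
    qed
    have Yp: "0 < ennreal_powr (?Y / ennreal (vol p)) (r - 1)"
    proof (cases ?Y)
      case (real y)
      then have "0 < y / vol p" using XY vol_pos[OF q] by simp
      then show ?thesis using real vol_pos[OF q] by (force simp: divide_ennreal ennreal_powr_ennreal)
    qed (use vol_pos[OF q] in \<open>simp add: ennreal_top_divide\<close>)
    have X: "?X < \<infinity>"
    proof (rule ccontr)
      assume "\<not> ?X < \<infinity>"
      then have "?X = top" by (metis infinity_ennreal_def less_top)
      then have "?X / ennreal (vol p) * ennreal_powr (?Y / ennreal (vol p)) (r - 1) = top"
        using Yp by (simp add: ennreal_top_divide ennreal_top_mult)
      then show False using le by (simp add: top_unique)
    qed
    have Xp: "0 < ?X / ennreal (vol p)"
      using XY X vol_pos[OF q] by (cases ?X) (auto simp: divide_ennreal)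
    have Y: "?Y < \<infinity>"
    proof (rule ccontr)
      assume "\<not> ?Y < \<infinity>"
      then have "?Y = top" by (metis infinity_ennreal_def less_top)
      then have "?X / ennreal (vol p) * ennreal_powr (?Y / ennreal (vol p)) (r - 1) = top"
        using Xp XY by (auto simp: ennreal_top_divide ennreal_mult_top)
      then show False using le by (simp add: top_unique)
    qed
    have eqs: "?X = ennreal (avg w p * vol p)" "?Y = ennreal (avg u p * vol p)"
      using X Y vol_pos[OF q] by (simp_all add: avg_def emeasure_eq_ennreal_measure less_top)
    have pos: "0 < avg w p" "0 < avg u p"
      using XY vol_pos[OF q] unfolding eqs by (simp_all add: zero_less_mult_iff)
    have "?X / ennreal (vol p) = ennreal (avg w p)" "?Y / ennreal (vol p) = ennreal (avg u p)"
      unfolding eqs using pos vol_pos[OF q] by (simp_all add: divide_ennreal)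
    then have "ennreal (avg w p * avg u p powr (r - 1)) \<le> ennreal B"
      using le pos by (simp add: ennreal_powr_ennreal ennreal_mult)
    then show ?thesis using X Y pos B by (simp add: ennreal_le_iff)
  qed
  have "\<exists>b>0. \<forall>p. 0 < snd p \<longrightarrow> emeasure lebesgue {x\<in>cube p. w x \<le> b * avg w p} \<le> ennreal (\<eta> * vol p)"
    if \<eta>: "0 < \<eta>" for \<eta>
  proof -
    \<comment> \<open>Solves (b B)^(1/(r-1)) = \<eta>.\<close>
    define b where "b = \<eta> powr (r - 1) / B"
    have b: "0 < b" using \<eta> B by (simp add: b_def)
    have "emeasure lebesgue {x\<in>cube p. w x \<le> b * avg w p} \<le> ennreal (\<eta> * vol p)" if q: "0 < snd p" for p
    proof -
      define s where "s = 1 / (r - 1)"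
      have s: "0 < s" "(r - 1) * s = 1" "- 1 / (r - 1) = - s" using p by (auto simp: s_def)
      note m = main[OF q]
      \<comment> \<open>Points where w is not positive form a null set; u need not be large there,
        as \<open>0 powr (- s)\<close> is 0.\<close>
      let ?A = "{x\<in>cube p. w x \<le> b * avg w p}" and ?A' = "{x\<in>cube p. 0 < w x \<and> w x \<le> b * avg w p}"
      define k where "k = (b * avg w p) powr (- s)"
      have k: "0 < k" using b m by (simp add: k_def)
      have "cube p \<inter> {x\<in>space lebesgue. 0 < w x \<and> w x \<le> b * avg w p} \<in> sets lebesgue"
        by (intro sets.Int; measurable)
      then have A': "?A' \<in> sets lebesgue" by (simp add: Int_def)
      have "emeasure lebesgue ?A \<le> emeasure lebesgue ?A'"
        using weight_pos[OF ww] A' by (intro emeasure_mono_AE) (auto elim: eventually_mono)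
      then have "ennreal k * emeasure lebesgue ?A \<le> ennreal k * emeasure lebesgue ?A'"
        by (rule mult_left_mono) simp
      also have "\<dots> \<le> emeasure (weight_measure u) (cube p)"
        using k A' s unfolding k_def u_def s(3)
        by (intro weight_measure_cube_lower q weight_powr ww) (auto intro!: powr_mono2')
      also have "\<dots> = ennreal (avg u p * vol p)"
        using m vol_pos[OF q] by (simp add: avg_def emeasure_eq_ennreal_measure less_top)
      finally have "ennreal k * emeasure lebesgue ?A \<le> ennreal (avg u p * vol p)" .
      then have "ennreal (1 / k) * (ennreal k * emeasure lebesgue ?A) \<le> ennreal (1 / k) * ennreal (avg u p * vol p)"
        by (rule mult_left_mono) simp
      then have "emeasure lebesgue ?A \<le> ennreal (1 / k * (avg u p * vol p))"
        using k m vol_pos[OF q] by (simp add: mult.assoc[symmetric] ennreal_mult[symmetric])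
      also have "1 / k * (avg u p * vol p) \<le> \<eta> * vol p"
      proof -
        have "avg u p = (avg u p powr (r - 1)) powr s" using m s by (simp add: powr_powr)
        also have "\<dots> \<le> (B / avg w p) powr s"
          using m s by (intro powr_mono2) (auto simp: field_simps)
        finally have "1 / k * avg u p \<le> (b * avg w p) powr s * (B / avg w p) powr s"
          using k unfolding k_def by (simp add: powr_minus divide_simps mult_left_mono)
        also have "\<dots> = (\<eta> powr (r - 1)) powr s"
          using b m B by (simp add: powr_mult[symmetric] b_def)
        also have "\<dots> = \<eta>" using \<eta> s by (simp add: powr_powr)
        finally have "1 / k * avg u p * vol p \<le> \<eta> * vol p"
          using vol_pos[OF q] by (intro mult_right_mono) auto
        then show ?thesis by (simp only: mult.assoc)
      qed
      finally show ?thesis by (simp add: ennreal_leI)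
    qed
    then show ?thesis using b by blast
  qed
  then show ?thesis unfolding spread_def using ww main by blast
qed

text \<open>For r = 1 the weight is of class A_1 relative to the constant weight 1, so the product
  lemma for A_1 applies.\<close>

lemma A_infinity_spread:
  assumes "w \<in> A_infinity"
  shows "spread w"
proof -
  obtain r where r: "1 \<le> r" "w \<in> Ap_class r" using assms by (auto simp: A_infinity_def)
  show ?thesis
  proof (cases "r = 1")
    case True
    then have "w \<in> A1_class (weight_measure (\<lambda>x. 1))"
      using r by (simp add: Ap_class_def weight_measure_1)
    from A1_class_spread[OF spread_1 this] show ?thesis by simp
  next
    case False
    then have "1 < r" using r(1) by simp
    then show ?thesis using r(2) by (rule Ap_class_spread)
  qed
qed

section \<open>The mixed weak type inequality\<close>

lemma ennreal_powr_mono: "0 \<le> c \<Longrightarrow> x \<le> y \<Longrightarrow> ennreal_powr x c \<le> ennreal_powr y c"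
  by (cases x; cases y) (auto simp: ennreal_powr_ennreal top_unique intro!: ennreal_leI powr_mono2)

lemma ennreal_powr_mult: "0 \<le> r \<Longrightarrow> 0 < c \<Longrightarrow> ennreal_powr (ennreal r * y) c = ennreal (r powr c) * ennreal_powr y c"
  by (cases y; cases "r = 0")
     (auto simp: ennreal_powr_ennreal ennreal_mult[symmetric] powr_mult ennreal_mult_top)

text \<open>The truncation makes the exponent 1 + b accessible from weak type (1,1): t^b / t is
  integrable at 0 and the levels stop at lv. This gives the factor lv^b and the L^1 norm of
  F.\<close>

lemma (in doubling_measure) truncated_maximal_function_integral:
  assumes F: "F \<in> borel_measurable lebesgue" and b: "0 < b" and lv: "0 < lv"
  shows "(\<integral>\<^sup>+x. ennreal_powr (min (maximal_function K F x) (ennreal lv)) (1 + b) \<partial>K)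
     \<le> ennreal ((1 + b) / b * D * lv powr b) * (\<integral>\<^sup>+x. ennreal \<bar>F x\<bar> \<partial>K)"
proof -
  let ?G = "\<lambda>x. min (maximal_function K F x) (ennreal lv)"
  let ?I = "\<integral>\<^sup>+x. ennreal \<bar>F x\<bar> \<partial>K"
  have G: "?G \<in> borel_measurable K"
    using borel_measurable_lebesgue_maximal_function[OF F] by (simp add: measurable_K)
  have "(\<integral>\<^sup>+x. ennreal_powr (?G x) (1 + b) \<partial>K) =
     (\<integral>\<^sup>+t\<in>{0<..}. ennreal ((1 + b) * t powr ((1 + b) - 1)) * emeasure K {x\<in>space K. ennreal t < ?G x} \<partial>lborel)"
    using b by (intro layer_cake sigma_finite_K G) simp
  also have "\<dots> \<le> (\<integral>\<^sup>+t. ennreal ((1 + b) / b * D) * ?I * (ennreal (b * t powr (b - 1)) * indicator {t. ennreal t < ennreal lv} t * indicator {0<..} t) \<partial>lborel)"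
  proof (rule nn_integral_mono)
    fix t :: real
    show "ennreal ((1 + b) * t powr ((1 + b) - 1)) * emeasure K {x\<in>space K. ennreal t < ?G x} * indicator {0<..} t
      \<le> ennreal ((1 + b) / b * D) * ?I * (ennreal (b * t powr (b - 1)) * indicator {t. ennreal t < ennreal lv} t * indicator {0<..} t)"
    proof (cases "0 < t \<and> t < lv")
      case True
      then have t: "0 < t" "t < lv" by auto
      have sub: "{x\<in>space K. ennreal t < ?G x} \<subseteq> {x. ennreal t < maximal_function K F x}" by auto
      have eq: "(1 + b) * t powr ((1 + b) - 1) = (1 + b) * t powr (b - 1) * t" using t by (simp add: powr_diff)
      have "ennreal ((1 + b) * t powr ((1 + b) - 1)) = ennreal ((1 + b) * t powr (b - 1)) * ennreal t"
        unfolding eq using t b by (intro ennreal_mult) auto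
      then have "ennreal ((1 + b) * t powr ((1 + b) - 1)) * emeasure K {x\<in>space K. ennreal t < ?G x}
        = ennreal ((1 + b) * t powr (b - 1)) * (ennreal t * emeasure K {x\<in>space K. ennreal t < ?G x})"
        by (simp only: mult.assoc)
      also have "\<dots> \<le> ennreal ((1 + b) * t powr (b - 1)) * (ennreal t * emeasure K {x. ennreal t < maximal_function K F x})"
        using open_superlevel_set[OF F] by (intro mult_left_mono emeasure_mono sub) auto
      also have "\<dots> \<le> ennreal ((1 + b) * t powr (b - 1)) * (ennreal D * ?I)"
        by (intro mult_left_mono weak_type F t) auto
      also have "\<dots> = ennreal ((1 + b) / b * D) * ?I * ennreal (b * t powr (b - 1))"
      proof -
        have "(1 + b) * t powr (b - 1) * D = (1 + b) / b * D * (b * t powr (b - 1))" using b by simp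
        then have "ennreal ((1 + b) * t powr (b - 1)) * ennreal D = ennreal ((1 + b) / b * D) * ennreal (b * t powr (b - 1))"
          using b t D_nonneg by (subst (1 2) ennreal_mult[symmetric]) auto
        then show ?thesis by (metis (no_types, lifting) mult.assoc mult.commute)
      qed
      finally show ?thesis using t by (simp add: ennreal_less_iff)
    next
      case False
      then have "{x\<in>space K. ennreal t < ?G x} = {} \<or> t \<le> 0"
        using lv by (auto simp: ennreal_less_iff)
      then show ?thesis by (auto simp: indicator_def)
    qed
  qed
  also have "\<dots> = ennreal ((1 + b) / b * D) * ?I * ennreal_powr (ennreal lv) b"
    using nn_integral_powr_kernel[OF b, of "ennreal lv"] by (subst nn_integral_cmult) auto
  also have "\<dots> = ennreal ((1 + b) / b * D * lv powr b) * ?I"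
  proof -
    have "ennreal ((1 + b) / b * D * lv powr b) = ennreal ((1 + b) / b * D) * ennreal (lv powr b)"
      using b D_nonneg by (intro ennreal_mult) auto
    moreover have "ennreal_powr (ennreal lv) b = ennreal (lv powr b)"
      using lv by (simp add: ennreal_powr_ennreal)
    ultimately show ?thesis by (simp only: mult_ac)
  qed
  finally show ?thesis .
qed

context spread_weight
begin

text \<open>Put \<open>\<nu> = m\<^bsup>1-\<sigma>\<^esup>\<close> and \<open>F = h m\<^sup>\<sigma>\<close>. Off the set where the \<open>\<nu>\<close>-maximal function of \<open>F\<close> exceeds
  the level, the reverse Hoelder inequality dominates a power of the left hand side by a maximal
  function with respect to \<open>m\<^bsup>1+\<epsilon>\<^esup>\<close>, which is of strong type.\<close>

lemma mixed_weak_type_pos: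
  assumes \<sigma>: "0 < \<sigma>" "\<sigma> < 1"
  shows "\<exists>C\<ge>0. \<forall>h\<in>borel_measurable lebesgue. \<forall>lv>0.
    ennreal lv * emeasure (pm (1 - \<sigma>)) {x. ennreal lv < ennreal (m x powr \<sigma>) * maximal_function (weight_measure m) h x}
      \<le> ennreal C * (\<integral>\<^sup>+x. ennreal \<bar>h x\<bar> \<partial>weight_measure m)"
proof -
  define \<theta> where "\<theta> = 1 - \<sigma>"
  have \<theta>: "0 < \<theta>" "\<theta> \<le> 1" using \<sigma> by (auto simp: \<theta>_def)
  obtain e where e: "0 < e" "\<And>p. 0 < snd p \<Longrightarrow> emeasure (pm (1 + e)) (cube p) \<le> ennreal (2 * avg m p powr (1 + e) * vol p)"
    using reverse_Hoelder by blast
  obtain Dm where "doubling_measure (weight_measure m) Dm" using doubling_weight_measure by blast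
  then interpret M: doubling_measure "weight_measure m" Dm .
  obtain Dn where "doubling_measure (pm \<theta>) Dn"
    using pm_doubling[of \<theta> 2] pm_upper[of \<theta>] \<theta> by auto
  then interpret N: doubling_measure "pm \<theta>" Dn .
  obtain Dw where "doubling_measure (pm (1 + e)) Dw"
    using pm_doubling[of "1 + e" 2] e by auto
  then interpret W: doubling_measure "pm (1 + e)" Dw .
  \<comment> \<open>With g = \<phi>^b m^(-e), the identity g^P m^(1+e) = \<phi>^(1+b) m^(1-\<sigma>)
    requires b P = 1 + b and e P = \<sigma> + e. The solution is b = e / \<sigma>, P = (1 + b) /
    b.\<close>
  define b where "b = e / \<sigma>"
  have b: "0 < b" "\<sigma> * b = e" using e \<sigma> by (auto simp: b_def)
  define P where "P = (1 + b) / b"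
  have P: "1 < P" "b * P = 1 + b" using b by (auto simp: P_def)
  obtain Cs where Cs: "0 \<le> Cs" "\<And>g. g \<in> borel_measurable lebesgue \<Longrightarrow>
      (\<integral>\<^sup>+x. ennreal_powr (maximal_function (pm (1 + e)) g x) P \<partial>pm (1 + e)) \<le> ennreal Cs * (\<integral>\<^sup>+x. ennreal (\<bar>g x\<bar> powr P) \<partial>pm (1 + e))"
    using W.strong_type[OF P(1)] by blast
  \<comment> \<open>2^b comes from the factor 2 of Jensen's inequality inside y, the other 2 from
    the reverse Hoelder inequality.\<close>
  define c1 where "c1 = 2 powr b * 2"
  define C1 where "C1 = c1 powr P * Cs * ((1 + b) / b * Dn)"
  have C1: "0 \<le> C1" using Cs N.D_nonneg b by (simp add: C1_def)
  have main: "ennreal lv * emeasure (pm \<theta>) {x. ennreal lv < ennreal (m x powr \<sigma>) * maximal_function (weight_measure m) h x}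
      \<le> ennreal (Dn + C1) * (\<integral>\<^sup>+x. ennreal \<bar>h x\<bar> \<partial>weight_measure m)"
    if h [measurable]: "h \<in> borel_measurable lebesgue" and lv: "0 < lv" for h lv
  proof -
    let ?I = "\<integral>\<^sup>+x. ennreal \<bar>h x\<bar> \<partial>weight_measure m"
    let ?X = "\<lambda>x. ennreal (m x powr \<sigma>) * maximal_function (weight_measure m) h x"
    \<comment> \<open>Since F m^(1-\<sigma>) = h m, integrals of F and h against the two measures
      agree on every set.\<close>
    define F where "F x = h x * m x powr \<sigma>" for x
    have F [measurable]: "F \<in> borel_measurable lebesgue" unfolding F_def by measurable
    have mF: "(\<lambda>x. ennreal \<bar>F x\<bar>) \<in> borel_measurable lebesgue"
      and mh: "(\<lambda>x. ennreal \<bar>h x\<bar>) \<in> borel_measurable lebesgue" by measurable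
    have FI: "(\<integral>\<^sup>+x\<in>A. ennreal \<bar>F x\<bar> \<partial>pm \<theta>) = (\<integral>\<^sup>+x\<in>A. ennreal \<bar>h x\<bar> \<partial>weight_measure m)" if "A \<in> sets lebesgue" for A
      unfolding set_nn_integral_weight_measure[OF weight_powr[OF weight_m] mF that]
        set_nn_integral_weight_measure[OF weight_m mh that]
    proof (rule nn_integral_cong_AE)
      show "AE x in lebesgue. ennreal (m x powr \<theta>) * ennreal \<bar>F x\<bar> * indicator A x = ennreal (m x) * ennreal \<bar>h x\<bar> * indicator A x"
        using weight_pos[OF weight_m]
      proof eventually_elim
        case (elim x)
        have "m x powr \<theta> * m x powr \<sigma> = m x" using elim by (simp add: powr_add[symmetric] \<theta>_def)
        then have "m x powr \<theta> * \<bar>F x\<bar> = m x * \<bar>h x\<bar>" by (simp add: F_def abs_mult mult_ac)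
        then show ?case using elim by (simp add: ennreal_mult[symmetric])
      qed
    qed
    have FI_UNIV: "(\<integral>\<^sup>+x. ennreal \<bar>F x\<bar> \<partial>pm \<theta>) = ?I"
      using FI[of UNIV] by simp
    define G where "G = maximal_function (pm \<theta>) F"
    have G [measurable]: "G \<in> borel_measurable lebesgue" unfolding G_def by measurable
    define \<phi> where "\<phi> x = enn2real (min (G x) (ennreal lv))" for x
    have \<phi>: "ennreal (\<phi> x) = min (G x) (ennreal lv)" "0 \<le> \<phi> x" for x
      unfolding \<phi>_def using ennreal_enn2real[of "min (G x) (ennreal lv)"] by (auto simp: min_less_iff_disj)
    have \<phi>m [measurable]: "\<phi> \<in> borel_measurable lebesgue" unfolding \<phi>_def by measurable
    define g where "g x = \<phi> x powr b * m x powr (- e)" for x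
    have gm [measurable]: "g \<in> borel_measurable lebesgue" unfolding g_def by measurable
    let ?MW = "maximal_function (pm (1 + e)) g"
    have XM [measurable]: "?X \<in> borel_measurable lebesgue" by measurable
    let ?E = "{x. ennreal lv < ?X x \<and> G x \<le> ennreal lv}"
    \<comment> \<open>A cube witnessing lv < X x has an average of F above y, so G > y at all of its
      points and not only at x. As G x \<le> lv, also y < lv, and hence the truncated function
      satisfies \<phi> \<ge> y on the whole cube; averaging g there bounds its maximal function at x
      from below.\<close>
    have key: "ennreal (lv powr b) \<le> ennreal (c1 * m x powr e) * ?MW x"
      if x: "ennreal lv < ?X x" "G x \<le> ennreal lv" for x
    proof -
      have mx: "0 < m x powr \<sigma>" "m x \<noteq> 0" using x by (auto intro: ccontr)
      have "ennreal (lv / m x powr \<sigma>) < maximal_function (weight_measure m) h x"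
      proof (rule ccontr)
        assume "\<not> ?thesis"
        then have "?X x \<le> ennreal (m x powr \<sigma>) * ennreal (lv / m x powr \<sigma>)"
          by (intro mult_left_mono) auto
        also have "\<dots> = ennreal lv" using mx lv by (simp add: ennreal_mult'[symmetric])
        finally show False using x by simp
      qed
      then obtain p where p: "0 < snd p" "x \<in> cube p" and
        pI: "ennreal (lv / m x powr \<sigma>) * emeasure (weight_measure m) (cube p) < (\<integral>\<^sup>+y\<in>cube p. ennreal \<bar>h y\<bar> \<partial>weight_measure m)"
        using M.maximal_function_greater_iff by auto
      let ?A = "avg m p"
      have A: "0 < ?A" by (rule avg_pos[OF p(1)])
      \<comment> \<open>The m-average of |h| exceeds lv / m(x)^\<sigma>. Changing the measure in the
        denominator to m^(1-\<sigma>), of mass at most 2 avg^(1-\<sigma>) vol, gives the factor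
        avg^\<sigma> / 2.\<close>
      define y where "y = lv * ?A powr \<sigma> / (2 * m x powr \<sigma>)"
      have y: "0 < y" using lv A mx by (simp add: y_def)
      have "ennreal y * emeasure (pm \<theta>) (cube p) \<le> ennreal y * ennreal (2 * ?A powr \<theta> * vol p)"
        using pm_upper[OF \<theta> p(1)] by (rule mult_left_mono) simp
      also have "\<dots> = ennreal (lv / m x powr \<sigma> * (?A * vol p))"
      proof -
        have "?A powr \<sigma> * ?A powr \<theta> = ?A" using A by (simp add: powr_add[symmetric] \<theta>_def)
        then have "y * (2 * ?A powr \<theta> * vol p) = lv / m x powr \<sigma> * (?A * vol p)"
          by (simp add: y_def field_simps)
        moreover have "ennreal y * ennreal (2 * ?A powr \<theta> * vol p) = ennreal (y * (2 * ?A powr \<theta> * vol p))"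
          using y vol_pos[OF p(1)] by (intro ennreal_mult[symmetric]) auto
        ultimately show ?thesis by simp
      qed
      also have "\<dots> = ennreal (lv / m x powr \<sigma>) * emeasure (weight_measure m) (cube p)"
        unfolding emeasure_eq_avg[OF p(1)] using lv A vol_pos[OF p(1)] by (intro ennreal_mult) auto
      also have "\<dots> < (\<integral>\<^sup>+y\<in>cube p. ennreal \<bar>F y\<bar> \<partial>pm \<theta>)"
        using pI FI[of "cube p"] by simp
      finally have yG: "ennreal y < G z" if "z \<in> cube p" for z
        unfolding G_def using p(1) that N.maximal_function_greater_iff by blast
      have y\<phi>: "y \<le> \<phi> z" if "z \<in> cube p" for z
      proof -
        have "ennreal y < ennreal lv" using yG[OF p(2)] x(2) by (rule less_le_trans)
        then have "ennreal y \<le> ennreal (\<phi> z)" unfolding \<phi>(1) using yG[OF that] by (simp add: less_imp_le)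
        then show ?thesis using \<phi>(2)[of z] by (simp add: ennreal_le_iff)
      qed
      have "ennreal (y powr b * (?A * vol p)) \<le> (\<integral>\<^sup>+z\<in>cube p. ennreal \<bar>g z\<bar> \<partial>pm (1 + e))"
      proof -
        have "ennreal (y powr b * (?A * vol p)) = ennreal (y powr b) * emeasure (weight_measure m) (cube p)"
          unfolding emeasure_eq_avg[OF p(1)] using A vol_pos[OF p(1)] by (intro ennreal_mult) auto
        also have "\<dots> = (\<integral>\<^sup>+z. ennreal (y powr b) * (ennreal (m z) * indicator (cube p) z) \<partial>lebesgue)"
          by (subst nn_integral_cmult) (auto simp: emeasure_weight_measure weight_m)
        also have "\<dots> \<le> (\<integral>\<^sup>+z\<in>cube p. ennreal (m z powr (1 + e)) * ennreal \<bar>g z\<bar> \<partial>lebesgue)"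
        proof (rule nn_integral_mono_AE)
          show "AE z in lebesgue. ennreal (y powr b) * (ennreal (m z) * indicator (cube p) z)
              \<le> ennreal (m z powr (1 + e)) * ennreal \<bar>g z\<bar> * indicator (cube p) z"
            using weight_pos[OF weight_m]
          proof eventually_elim
            case (elim z)
            show ?case
            proof (cases "z \<in> cube p")
              case True
              have "m z powr (1 + e) * m z powr (- e) = m z" using elim by (simp add: powr_add[symmetric])
              then have eq: "m z powr (1 + e) * \<bar>g z\<bar> = \<phi> z powr b * m z"
                by (simp add: g_def mult_ac)
              have "y powr b * m z \<le> \<phi> z powr b * m z"
                using y\<phi>[OF True] y b elim by (intro mult_right_mono powr_mono2) auto
              then show ?thesis
                using True elim eq by (simp add: ennreal_mult'[symmetric] ennreal_leI)
            qed simp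
          qed
        qed
        also have "\<dots> = (\<integral>\<^sup>+z\<in>cube p. ennreal \<bar>g z\<bar> \<partial>pm (1 + e))"
          by (rule set_nn_integral_weight_measure[symmetric]) (auto intro: weight_powr weight_m)
        finally show ?thesis .
      qed
      then have gI: "ennreal (y powr b * (?A * vol p)) \<le> (\<integral>\<^sup>+z\<in>cube p. ennreal \<bar>g z\<bar> \<partial>pm (1 + e))" .
      define r where "r = y powr b * ?A powr (- e) / 2"
      have "ennreal r * emeasure (pm (1 + e)) (cube p) \<le> ennreal r * ennreal (2 * ?A powr (1 + e) * vol p)"
        using e(2)[OF p(1)] by (rule mult_left_mono) simp
      also have "\<dots> = ennreal (y powr b * (?A * vol p))"
      proof -
        have "r * (2 * ?A powr (1 + e) * vol p) = y powr b * (?A * vol p)"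
          using A by (simp add: r_def powr_add powr_minus)
        moreover have "ennreal r * ennreal (2 * ?A powr (1 + e) * vol p) = ennreal (r * (2 * ?A powr (1 + e) * vol p))"
          using vol_pos[OF p(1)] by (intro ennreal_mult[symmetric]) (auto simp: r_def)
        ultimately show ?thesis by (simp only:)
      qed
      also note gI
      finally have "ennreal r * emeasure (pm (1 + e)) (cube p) / emeasure (pm (1 + e)) (cube p)
          \<le> average (pm (1 + e)) (cube p) g"
        unfolding average_def by (rule divide_right_mono_ennreal)
      also have "\<dots> \<le> ?MW x" by (rule W.maximal_function_ge[OF p])
      also have "ennreal r * emeasure (pm (1 + e)) (cube p) / emeasure (pm (1 + e)) (cube p) = ennreal r"
        using W.cube_pos[OF p(1)] W.cube_finite[OF p(1)] by (intro mult_divide_eq_ennreal) auto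
      finally have MWge: "ennreal (y powr b * ?A powr (- e) / 2) \<le> ?MW x" unfolding r_def .
      have "y powr b = lv powr b * ?A powr e / (2 powr b * m x powr e)"
        using lv A mx b by (simp add: y_def powr_divide powr_mult powr_powr)
      then have "lv powr b = c1 * m x powr e * (y powr b * ?A powr (- e) / 2)"
        using A mx by (simp add: c1_def powr_minus field_simps)
      then have "ennreal (lv powr b) = ennreal (c1 * m x powr e) * ennreal (y powr b * ?A powr (- e) / 2)"
        by (simp add: c1_def ennreal_mult[symmetric])
      also have "\<dots> \<le> ennreal (c1 * m x powr e) * ?MW x"
        using MWge by (rule mult_left_mono) simp
      finally show ?thesis .
    qed
    have Em [measurable]: "?E \<in> sets lebesgue"
    proof -
      have "{x\<in>space lebesgue. ennreal lv < ?X x \<and> G x \<le> ennreal lv} \<in> sets lebesgue" by measurable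
      then show ?thesis by simp
    qed
    have "ennreal (lv powr (1 + b)) * emeasure (pm \<theta>) ?E \<le> ennreal (c1 powr P) * (\<integral>\<^sup>+x. ennreal_powr (?MW x) P \<partial>pm (1 + e))"
    proof -
      have "ennreal (lv powr (1 + b)) * emeasure (pm \<theta>) ?E = (\<integral>\<^sup>+x. ennreal (lv powr (1 + b)) * (ennreal (m x powr \<theta>) * indicator ?E x) \<partial>lebesgue)"
        by (subst nn_integral_cmult) (auto simp: emeasure_weight_measure weight_powr weight_m Em)
      also have "\<dots> \<le> (\<integral>\<^sup>+x. ennreal (c1 powr P) * (ennreal (m x powr (1 + e)) * ennreal_powr (?MW x) P) \<partial>lebesgue)"
      proof (rule nn_integral_mono_AE)
        show "AE x in lebesgue. ennreal (lv powr (1 + b)) * (ennreal (m x powr \<theta>) * indicator ?E x)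
          \<le> ennreal (c1 powr P) * (ennreal (m x powr (1 + e)) * ennreal_powr (?MW x) P)"
          using weight_pos[OF weight_m]
        proof eventually_elim
          case (elim x)
          show ?case
          proof (cases "x \<in> ?E")
            case True
            then have "ennreal_powr (ennreal (lv powr b)) P \<le> ennreal_powr (ennreal (c1 * m x powr e) * ?MW x) P"
              using P key[of x] by (intro ennreal_powr_mono) auto
            also have "\<dots> = ennreal ((c1 * m x powr e) powr P) * ennreal_powr (?MW x) P"
              using P by (intro ennreal_powr_mult) (auto simp: c1_def)
            finally have "ennreal (lv powr (1 + b)) \<le> ennreal ((c1 * m x powr e) powr P) * ennreal_powr (?MW x) P"
              using P by (simp add: ennreal_powr_ennreal powr_powr)
            then have "ennreal (lv powr (1 + b)) * ennreal (m x powr \<theta>) \<le> ennreal ((c1 * m x powr e) powr P) * ennreal_powr (?MW x) P * ennreal (m x powr \<theta>)"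
              by (rule mult_right_mono) simp
            also have "\<dots> = ennreal ((c1 * m x powr e) powr P * m x powr \<theta>) * ennreal_powr (?MW x) P"
              by (simp add: ennreal_mult mult_ac)
            also have "(c1 * m x powr e) powr P * m x powr \<theta> = c1 powr P * m x powr (1 + e)"
            proof -
              have "e * P = \<sigma> * (b * P)" using b(2) by (simp add: mult.assoc[symmetric])
              also have "\<dots> = \<sigma> + e" using P(2) b(2) by (simp add: distrib_left)
              finally have "e * P + \<theta> = 1 + e" by (simp add: \<theta>_def)
              then show ?thesis using elim
                by (simp add: powr_mult powr_powr powr_add[symmetric] c1_def mult.assoc)
            qed
            finally show ?thesis using True by (simp add: ennreal_mult mult.assoc)
          qed simp
        qed
      qed
      also have "\<dots> = ennreal (c1 powr P) * (\<integral>\<^sup>+x. ennreal_powr (?MW x) P \<partial>pm (1 + e))"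
        by (subst nn_integral_weight_measure[OF weight_powr[OF weight_m]]) (auto intro!: nn_integral_cmult)
      finally show ?thesis .
    qed
    also have "\<dots> \<le> ennreal (c1 powr P) * (ennreal Cs * (\<integral>\<^sup>+x. ennreal (\<bar>g x\<bar> powr P) \<partial>pm (1 + e)))"
      by (intro mult_left_mono Cs gm) simp
    also have "(\<integral>\<^sup>+x. ennreal (\<bar>g x\<bar> powr P) \<partial>pm (1 + e)) = (\<integral>\<^sup>+x. ennreal_powr (min (G x) (ennreal lv)) (1 + b) \<partial>pm \<theta>)"
    proof -
      have "(\<integral>\<^sup>+x. ennreal (\<bar>g x\<bar> powr P) \<partial>pm (1 + e)) = (\<integral>\<^sup>+x. ennreal (m x powr (1 + e)) * ennreal (\<bar>g x\<bar> powr P) \<partial>lebesgue)"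
        by (rule nn_integral_weight_measure[OF weight_powr[OF weight_m]]) measurable
      also have "\<dots> = (\<integral>\<^sup>+x. ennreal (m x powr \<theta>) * ennreal_powr (min (G x) (ennreal lv)) (1 + b) \<partial>lebesgue)"
      proof (rule nn_integral_cong_AE)
        show "AE x in lebesgue. ennreal (m x powr (1 + e)) * ennreal (\<bar>g x\<bar> powr P) = ennreal (m x powr \<theta>) * ennreal_powr (min (G x) (ennreal lv)) (1 + b)"
          using weight_pos[OF weight_m]
        proof eventually_elim
          case (elim x)
          have "e * P = \<sigma> * (b * P)" using b(2) by (simp add: mult.assoc[symmetric])
          also have "\<dots> = \<sigma> + e" using P(2) b(2) by (simp add: distrib_left)
          finally have eP: "1 + e + - e * P = \<theta>" by (simp add: \<theta>_def)
          have "\<bar>g x\<bar> powr P = \<phi> x powr (1 + b) * m x powr (- e * P)"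
            using P by (simp add: g_def abs_mult powr_mult powr_powr)
          then have "m x powr (1 + e) * \<bar>g x\<bar> powr P = \<phi> x powr (1 + b) * (m x powr (1 + e) * m x powr (- e * P))"
            by (simp only: mult_ac)
          also have "m x powr (1 + e) * m x powr (- e * P) = m x powr \<theta>"
            by (simp only: powr_add[symmetric] eP)
          finally show ?case
            unfolding \<phi>(1)[symmetric] ennreal_powr_ennreal[OF \<phi>(2)]
            by (simp only: ennreal_mult'[OF powr_ge_zero, symmetric] mult.commute)
        qed
      qed
      also have "\<dots> = (\<integral>\<^sup>+x. ennreal_powr (min (G x) (ennreal lv)) (1 + b) \<partial>pm \<theta>)"
        by (rule nn_integral_weight_measure[OF weight_powr[OF weight_m], symmetric]) measurable
      finally show ?thesis .
    qed
    also have "ennreal (c1 powr P) * (ennreal Cs * (\<integral>\<^sup>+x. ennreal_powr (min (G x) (ennreal lv)) (1 + b) \<partial>pm \<theta>))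
      \<le> ennreal (c1 powr P) * (ennreal Cs * (ennreal ((1 + b) / b * Dn * lv powr b) * ?I))"
      using N.truncated_maximal_function_integral[OF F b(1) lv]
      unfolding FI_UNIV G_def by (intro mult_left_mono) auto
    also have "\<dots> = ennreal (lv powr b) * (ennreal C1 * ?I)"
    proof -
      have "c1 powr P * (Cs * ((1 + b) / b * Dn * lv powr b)) = lv powr b * C1"
        by (simp add: C1_def)
      then have "ennreal (c1 powr P * (Cs * ((1 + b) / b * Dn * lv powr b))) = ennreal (lv powr b * C1)"
        by (simp only:)
      then have "ennreal (c1 powr P) * (ennreal Cs * ennreal ((1 + b) / b * Dn * lv powr b)) = ennreal (lv powr b) * ennreal C1"
        by (simp only: ennreal_mult'[OF powr_ge_zero] ennreal_mult'[OF Cs(1)])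
      then show ?thesis by (metis mult.assoc)
    qed
    finally have "ennreal (lv powr b) * (ennreal lv * emeasure (pm \<theta>) ?E) \<le> ennreal (lv powr b) * (ennreal C1 * ?I)"
      using lv by (simp add: powr_add ennreal_mult mult_ac)
    then have E_le: "ennreal lv * emeasure (pm \<theta>) ?E \<le> ennreal C1 * ?I"
      using lv by (subst (asm) ennreal_mult_le_mult_iff) auto
    have Gm: "{x. ennreal lv < G x} \<in> sets lebesgue"
      using N.open_superlevel_set[OF F] by (simp add: G_def)
    have "emeasure (pm \<theta>) {x. ennreal lv < ?X x} \<le> emeasure (pm \<theta>) ({x. ennreal lv < G x} \<union> ?E)"
      using Gm Em by (intro emeasure_mono) auto
    also have "\<dots> \<le> emeasure (pm \<theta>) {x. ennreal lv < G x} + emeasure (pm \<theta>) ?E"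
      using Gm Em by (intro emeasure_subadditive) auto
    finally have "ennreal lv * emeasure (pm \<theta>) {x. ennreal lv < ?X x} \<le>
        ennreal lv * (emeasure (pm \<theta>) {x. ennreal lv < G x} + emeasure (pm \<theta>) ?E)"
      by (rule mult_left_mono) simp
    also have "\<dots> = ennreal lv * emeasure (pm \<theta>) {x. ennreal lv < G x} + ennreal lv * emeasure (pm \<theta>) ?E"
      by (rule distrib_left)
    also have "\<dots> \<le> ennreal Dn * ?I + ennreal C1 * ?I"
      using N.weak_type[OF F lv] E_le unfolding FI_UNIV G_def by (rule add_mono)
    also have "\<dots> = ennreal (Dn + C1) * ?I"
      using N.D_nonneg C1 by (simp add: distrib_right)
    finally show ?thesis .
  qed
  show ?thesis
    using main N.D_nonneg C1 unfolding \<theta>_def by (intro exI[of _ "Dn + C1"]) auto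
qed

text \<open>The choice b = e / \<sigma> breaks down at \<sigma> = 0, where the claim is the ordinary
  weak type inequality for m.\<close>

lemma mixed_weak_type:
  assumes \<sigma>: "0 \<le> \<sigma>" "\<sigma> < 1"
  shows "\<exists>C\<ge>0. \<forall>h\<in>borel_measurable lebesgue. \<forall>lv>0.
    ennreal lv * emeasure (pm (1 - \<sigma>)) {x. ennreal lv < ennreal (m x powr \<sigma>) * maximal_function (weight_measure m) h x}
      \<le> ennreal C * (\<integral>\<^sup>+x. ennreal \<bar>h x\<bar> \<partial>weight_measure m)"
proof (cases "\<sigma> = 0")
  case False
  then show ?thesis using mixed_weak_type_pos \<sigma> by simp
next
  case True
  obtain D where "doubling_measure (weight_measure m) D" using doubling_weight_measure by blast
  then interpret M: doubling_measure "weight_measure m" D .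
  have "ennreal lv * emeasure (pm (1 - \<sigma>)) {x. ennreal lv < ennreal (m x powr \<sigma>) * maximal_function (weight_measure m) h x}
      \<le> ennreal D * (\<integral>\<^sup>+x. ennreal \<bar>h x\<bar> \<partial>weight_measure m)"
    if h: "h \<in> borel_measurable lebesgue" and lv: "0 < lv" for h lv
  proof -
    \<comment> \<open>An inequality instead of an equality, because \<open>m x powr 0\<close> is 0
      where m vanishes.\<close>
    have "emeasure (weight_measure m) {x. ennreal lv < ennreal (m x powr 0) * maximal_function (weight_measure m) h x}
       \<le> emeasure (weight_measure m) {x. ennreal lv < maximal_function (weight_measure m) h x}"
    proof (rule emeasure_mono)
      show "{x. ennreal lv < maximal_function (weight_measure m) h x} \<in> sets (weight_measure m)"
        using M.open_superlevel_set[OF h] by simp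
    qed (auto split: if_splits)
    then have "ennreal lv * emeasure (weight_measure m) {x. ennreal lv < ennreal (m x powr 0) * maximal_function (weight_measure m) h x}
       \<le> ennreal lv * emeasure (weight_measure m) {x. ennreal lv < maximal_function (weight_measure m) h x}"
      by (rule mult_left_mono) simp
    also have "\<dots> \<le> ennreal D * (\<integral>\<^sup>+x. ennreal \<bar>h x\<bar> \<partial>weight_measure m)"
      by (rule M.weak_type[OF h lv])
    finally show ?thesis using True pm_1 by simp
  qed
  then show ?thesis using M.D_nonneg by blast
qed

end

section \<open>Lorentz norms\<close>

text \<open>Superlevel sets of a decreasing function are initial segments of the line. It makes
  distribution functions admissible integrands in the Lorentz integrals.\<close>

lemma distribution_measurable:
  fixes \<phi> :: "real \<Rightarrow> ennreal"
  assumes "antimono \<phi>"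
  shows "\<phi> \<in> borel_measurable borel"
proof (rule borel_measurableI_greater)
  fix y
  define S where "S = {t. y < \<phi> t}"
  have down: "t \<in> S" if "s \<in> S" "t \<le> s" for s t
    using that assms by (auto simp: S_def antimono_def intro: less_le_trans)
  have "S \<in> sets borel"
  proof (cases "S = {} \<or> \<not> bdd_above S")
    case True
    have "S = UNIV" if "\<not> bdd_above S"
    proof -
      have "t \<in> S" for t
        using that down[of _ t] by (meson bdd_above.I linear)
      then show ?thesis by blast
    qed
    then show ?thesis using True by auto
  next
    case False
    then have S: "S \<noteq> {}" "bdd_above S" by auto
    have "{..<Sup S} \<subseteq> S"
    proof
      fix x assume "x \<in> {..<Sup S}"
      then obtain s where "s \<in> S" "x < s" using less_cSup_iff[OF S, of x] by auto
      then show "x \<in> S" using down[of s x] by simp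
    qed
    moreover have "x < Sup S \<or> x = Sup S" if "x \<in> S" for x
      using cSup_upper[OF that S(2)] by linarith
    ultimately have "S = {..<Sup S} \<union> (S \<inter> {Sup S})" by blast
    moreover have "{..<Sup S} \<union> (S \<inter> {Sup S}) \<in> sets borel"
      by (intro sets.Un) (auto simp: Int_insert_right)
    ultimately show ?thesis by simp
  qed
  then show "{t \<in> space borel. y < \<phi> t} \<in> sets borel" by (simp add: S_def)
qed

lemma distribution_antimono:
  fixes f :: "'a \<Rightarrow> 'b::real_normed_vector"
  assumes "(\<lambda>x. norm (f x)) \<in> borel_measurable M" "space M = UNIV"
  shows "antimono (\<lambda>s. emeasure M {x. s < norm (f x)})"
proof (rule antimonoI)
  fix s t :: real assume "s \<le> t"
  have "{x\<in>space M. s < norm (f x)} \<in> sets M" using assms(1) by measurable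
  then show "emeasure M {x. t < norm (f x)} \<le> emeasure M {x. s < norm (f x)}"
    using assms(2) \<open>s \<le> t\<close> by (intro emeasure_mono) auto
qed

lemma ennreal_powr_powr: "0 < a \<Longrightarrow> 0 < b \<Longrightarrow> ennreal_powr (ennreal_powr x a) b = ennreal_powr x (a * b)"
  by (cases x) (auto simp: ennreal_powr_ennreal powr_powr)

lemma ennreal_powr_one [simp]: "ennreal_powr x 1 = x"
  by (cases x) (auto simp: ennreal_powr_ennreal)

text \<open>The substitution \<open>s = c t\<close>.\<close>

lemma lorentz_norm_scale:
  fixes f :: "'a::euclidean_space \<Rightarrow> complex"
  assumes c: "0 < c" and \<alpha>: "0 < \<alpha>" and f: "f \<in> borel_measurable lebesgue"
  shows "lorentz_norm p \<alpha> w (\<lambda>x. of_real c * f x) = ennreal c * lorentz_norm p \<alpha> w f"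
proof -
  define \<phi> where "\<phi> s = emeasure (weight_measure w) {x. s < norm (f x)}" for s
  have "antimono \<phi>"
    unfolding \<phi>_def using f by (intro distribution_antimono) (auto cong: measurable_cong_sets)
  then have [measurable]: "\<phi> \<in> borel_measurable borel" by (rule distribution_measurable)
  have \<phi>c: "emeasure (weight_measure w) {x. s < norm (of_real c * f x)} = \<phi> (s / c)" for s
    unfolding \<phi>_def using c by (intro arg_cong2[where f=emeasure]) (auto simp: norm_mult field_simps)
  let ?g = "\<lambda>s. ennreal (s powr (\<alpha> - 1)) * ennreal_powr (\<phi> s) (\<alpha> / p) * indicator {0<..} s"
  have "(\<integral>\<^sup>+s\<in>{0<..}. ennreal (s powr (\<alpha> - 1)) * ennreal_powr (\<phi> (s / c)) (\<alpha> / p) \<partial>lborel)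
     = ennreal \<bar>c\<bar> * (\<integral>\<^sup>+t. ennreal ((0 + c * t) powr (\<alpha> - 1)) * ennreal_powr (\<phi> ((0 + c * t) / c)) (\<alpha> / p) * indicator {0<..} (0 + c * t) \<partial>lborel)"
    using c by (intro nn_integral_real_affine) auto
  also have "\<dots> = ennreal \<bar>c\<bar> * (\<integral>\<^sup>+t. ennreal (c powr (\<alpha> - 1)) * ?g t \<partial>lborel)"
  proof -
    have "ennreal ((0 + c * t) powr (\<alpha> - 1)) * ennreal_powr (\<phi> ((0 + c * t) / c)) (\<alpha> / p) * indicator {0<..} (0 + c * t)
      = ennreal (c powr (\<alpha> - 1)) * ?g t" for t
      using c by (auto simp: indicator_def powr_mult ennreal_mult mult.assoc zero_less_mult_iff)
    then show ?thesis by simp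
  qed
  also have "\<dots> = ennreal \<bar>c\<bar> * (ennreal (c powr (\<alpha> - 1)) * (\<integral>\<^sup>+t. ?g t \<partial>lborel))"
    by (subst nn_integral_cmult) auto
  also have "\<dots> = ennreal (c powr \<alpha>) * (\<integral>\<^sup>+t. ?g t \<partial>lborel)"
    using c by (simp add: mult.assoc[symmetric] ennreal_mult[symmetric] powr_diff)
  finally have "lorentz_norm p \<alpha> w (\<lambda>x. of_real c * f x) =
      ennreal_powr (ennreal p * (ennreal (c powr \<alpha>) * (\<integral>\<^sup>+t. ?g t \<partial>lborel))) (1 / \<alpha>)"
    unfolding lorentz_norm_def \<phi>c by simp
  also have "\<dots> = ennreal_powr (ennreal (c powr \<alpha>) * (ennreal p * (\<integral>\<^sup>+t. ?g t \<partial>lborel))) (1 / \<alpha>)"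
    by (simp only: mult_ac)
  also have "\<dots> = ennreal ((c powr \<alpha>) powr (1 / \<alpha>)) * ennreal_powr (ennreal p * (\<integral>\<^sup>+t. ?g t \<partial>lborel)) (1 / \<alpha>)"
    using \<alpha> by (intro ennreal_powr_mult) auto
  also have "(c powr \<alpha>) powr (1 / \<alpha>) = c" using c \<alpha> by (simp add: powr_powr)
  finally show ?thesis unfolding lorentz_norm_def \<phi>_def .
qed

lemma weak_lorentz_norm_scale:
  fixes f :: "'a::euclidean_space \<Rightarrow> complex"
  assumes c: "0 < c"
  shows "weak_lorentz_norm p w (\<lambda>x. of_real c * f x) = ennreal c * weak_lorentz_norm p w f"
proof -
  have "weak_lorentz_norm p w (\<lambda>x. of_real c * f x) =
     (SUP t\<in>(\<lambda>s. c * s) ` {0<..}. ennreal t * ennreal_powr (emeasure (weight_measure w) {x. t < norm (of_real c * f x)}) (1 / p))"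
  proof -
    have "(\<lambda>s. c * s) ` {0<..} = {0<..}"
      using c by (auto simp: image_iff intro!: bexI[of _ "x / c" for x])
    then show ?thesis unfolding weak_lorentz_norm_def by simp
  qed
  also have "\<dots> = (SUP t\<in>{0<..}. ennreal c * (ennreal t * ennreal_powr (emeasure (weight_measure w) {x. t < norm (f x)}) (1 / p)))"
    unfolding image_image using c
    by (intro SUP_cong refl) (simp add: norm_mult ennreal_mult mult.assoc)
  also have "\<dots> = ennreal c * weak_lorentz_norm p w f"
    unfolding weak_lorentz_norm_def by (intro SUP_mult_left_ennreal[symmetric])
  finally show ?thesis .
qed

text \<open>The embedding \<open>L\<^bsup>r,\<alpha>\<^esup> \<subseteq> L\<^sup>r\<close> for \<open>\<alpha> \<le> r\<close>: monotonicity of the distribution function bounds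
  \<open>s\<^sup>r w(|f| > s)\<close> by one, so that its power of exponent \<open>\<alpha> / r \<le> 1\<close> is larger.\<close>

lemma lorentz_norm_le_1_integral:
  fixes f :: "'a::euclidean_space \<Rightarrow> complex"
  assumes w: "weight w" and sf: "sigma_finite_measure (weight_measure w)"
    and f: "f \<in> borel_measurable lebesgue" and \<alpha>: "0 < \<alpha>" "\<alpha> \<le> r" and le: "lorentz_norm r \<alpha> w f \<le> 1"
  shows "(\<integral>\<^sup>+x. ennreal (norm (f x) powr r) \<partial>weight_measure w) \<le> 1"
proof -
  have r: "0 < r" using \<alpha> by simp
  define \<phi> where "\<phi> s = emeasure (weight_measure w) {x. s < norm (f x)}" for s
  have am: "antimono \<phi>"
    unfolding \<phi>_def using f by (intro distribution_antimono) (auto cong: measurable_cong_sets)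
  then have [measurable]: "\<phi> \<in> borel_measurable borel" by (rule distribution_measurable)
  define e where "e = \<alpha> / r"
  have e: "0 < e" "e \<le> 1" using \<alpha> r by (auto simp: e_def)
  let ?g = "\<lambda>s. ennreal (s powr (\<alpha> - 1)) * ennreal_powr (\<phi> s) e * indicator {0<..} s"
  define N where "N = ennreal r * (\<integral>\<^sup>+s. ?g s \<partial>lborel)"
  have "ennreal_powr N (1 / \<alpha>) \<le> 1" using le by (simp add: lorentz_norm_def N_def e_def \<phi>_def)
  then have "ennreal_powr (ennreal_powr N (1 / \<alpha>)) \<alpha> \<le> ennreal_powr (ennreal 1) \<alpha>"
    using \<alpha> by (intro ennreal_powr_mono) auto
  moreover have "ennreal_powr (ennreal 1) \<alpha> = 1"
    by (subst ennreal_powr_ennreal) auto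
  ultimately have N1: "N \<le> 1" using \<alpha> by (simp add: ennreal_powr_powr)
  \<comment> \<open>s^\<alpha> is the integral of \<alpha> t^(\<alpha>-1) up to s, where \<phi> t
    \<ge> \<phi> s; then \<alpha> \<le> r compares the prefactor with the one in the norm.\<close>
  have bound: "ennreal (s powr \<alpha>) * ennreal_powr (\<phi> s) e \<le> 1" if s: "0 < s" for s
  proof -
    have "ennreal (s powr \<alpha>) * ennreal_powr (\<phi> s) e = ennreal_powr (ennreal s) \<alpha> * ennreal_powr (\<phi> s) e"
      using s by (simp add: ennreal_powr_ennreal)
    also have "\<dots> = (\<integral>\<^sup>+t\<in>{0<..}. ennreal (\<alpha> * t powr (\<alpha> - 1)) * indicator {t. ennreal t < ennreal s} t \<partial>lborel) * ennreal_powr (\<phi> s) e"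
      by (simp only: nn_integral_powr_kernel[OF \<alpha>(1)])
    also have "\<dots> = (\<integral>\<^sup>+t. ennreal (\<alpha> * t powr (\<alpha> - 1)) * indicator {t. ennreal t < ennreal s} t * indicator {0<..} t * ennreal_powr (\<phi> s) e \<partial>lborel)"
      by (subst nn_integral_multc) auto
    also have "\<dots> \<le> (\<integral>\<^sup>+t. ennreal r * ?g t \<partial>lborel)"
    proof (rule nn_integral_mono)
      fix t :: real
      show "ennreal (\<alpha> * t powr (\<alpha> - 1)) * indicator {t. ennreal t < ennreal s} t * indicator {0<..} t * ennreal_powr (\<phi> s) e \<le> ennreal r * ?g t"
      proof (cases "0 < t \<and> t < s")
        case True
        have "ennreal_powr (\<phi> s) e \<le> ennreal_powr (\<phi> t) e"
          using e am True by (intro ennreal_powr_mono) (auto simp: antimono_def)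
        moreover have "ennreal (\<alpha> * t powr (\<alpha> - 1)) \<le> ennreal r * ennreal (t powr (\<alpha> - 1))"
          using \<alpha> by (simp add: ennreal_mult[symmetric] mult_right_mono ennreal_leI)
        ultimately have "ennreal (\<alpha> * t powr (\<alpha> - 1)) * ennreal_powr (\<phi> s) e \<le> ennreal r * ennreal (t powr (\<alpha> - 1)) * ennreal_powr (\<phi> t) e"
          by (intro mult_mono) auto
        then show ?thesis using True by (simp add: ennreal_less_iff mult.assoc)
      qed (auto simp: indicator_def ennreal_less_iff)
    qed
    also have "\<dots> = N" unfolding N_def by (rule nn_integral_cmult) measurable
    finally show ?thesis using N1 by simp
  qed
  have pointwise: "ennreal (s powr r) * \<phi> s \<le> ennreal (s powr \<alpha>) * ennreal_powr (\<phi> s) e" if s: "0 < s" for s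
  proof (cases "\<phi> s")
    case top
    then show ?thesis using s bound[OF s] by (simp add: ennreal_mult_top top_unique)
  next
    case (real y)
    then have eq: "ennreal (s powr \<alpha>) * ennreal_powr (\<phi> s) e = ennreal ((s powr r * y) powr e)"
      using s r by (simp add: ennreal_powr_ennreal ennreal_mult[symmetric] powr_mult powr_powr e_def)
    then have "(s powr r * y) powr e \<le> 1" using bound[OF s] by simp
    then have "s powr r * y \<le> 1"
      using e real powr_less_mono2[of e 1 "s powr r * y"] by (force simp: not_le[symmetric])
    then have "(s powr r * y) powr 1 \<le> (s powr r * y) powr e"
      using e real by (intro powr_mono') auto
    then have "s powr r * y \<le> (s powr r * y) powr e"
      using real by simp
    then show ?thesis unfolding eq using real by (simp add: ennreal_mult[symmetric] ennreal_leI)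
  qed
  have fm [measurable]: "(\<lambda>x. norm (f x)) \<in> borel_measurable (weight_measure w)"
    using f by (auto cong: measurable_cong_sets)
  have "(\<integral>\<^sup>+x. ennreal (norm (f x) powr r) \<partial>weight_measure w) = (\<integral>\<^sup>+x. ennreal_powr (ennreal (norm (f x))) r \<partial>weight_measure w)"
    by (simp add: ennreal_powr_ennreal)
  also have "\<dots> = (\<integral>\<^sup>+t\<in>{0<..}. ennreal (r * t powr (r - 1)) * emeasure (weight_measure w) {x\<in>space (weight_measure w). ennreal t < ennreal (norm (f x))} \<partial>lborel)"
    by (intro layer_cake sf r) measurable
  also have "\<dots> \<le> (\<integral>\<^sup>+t. ennreal r * ?g t \<partial>lborel)"
  proof (rule nn_integral_mono)
    fix t :: real
    show "ennreal (r * t powr (r - 1)) * emeasure (weight_measure w) {x\<in>space (weight_measure w). ennreal t < ennreal (norm (f x))} * indicator {0<..} t \<le> ennreal r * ?g t"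
    proof (cases "0 < t")
      case True
      have eq: "emeasure (weight_measure w) {x\<in>space (weight_measure w). ennreal t < ennreal (norm (f x))} = \<phi> t"
        unfolding \<phi>_def using True by (intro arg_cong2[where f=emeasure]) (auto simp: ennreal_less_iff)
      have "ennreal (r * t powr (r - 1)) * \<phi> t = ennreal (r / t) * (ennreal (t powr r) * \<phi> t)"
        using True r by (simp add: mult.assoc[symmetric] ennreal_mult[symmetric] powr_diff)
      also have "\<dots> \<le> ennreal (r / t) * (ennreal (t powr \<alpha>) * ennreal_powr (\<phi> t) e)"
        using pointwise[OF True] by (rule mult_left_mono) simp
      also have "\<dots> = ennreal r * (ennreal (t powr (\<alpha> - 1)) * ennreal_powr (\<phi> t) e)"
        using True r by (simp add: mult.assoc[symmetric] ennreal_mult[symmetric] powr_diff)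
      finally show ?thesis using True unfolding eq by simp
    qed simp
  qed
  also have "\<dots> = N" unfolding N_def by (rule nn_integral_cmult) measurable
  finally show ?thesis using N1 by (rule order_trans)
qed

section \<open>Extrapolation\<close>

lemma hat_A_off_1_D:
  assumes w: "w \<in> hat_A_off 1 d (weight_measure \<mu>)" and \<mu>: "weight \<mu>"
  shows "weight w \<and> (\<exists>v\<in>A1_class (weight_measure \<mu>). AE x in lebesgue. w x powr d = v x)"
proof -
  have ww: "weight w" and h: "(\<lambda>x. w x powr d) \<in> hat_A 1 (weight_measure \<mu>)"
    using w by (auto simp: hat_A_off_def conjugate_exponent_def)
  obtain v g where v: "v \<in> A1_class (weight_measure \<mu>)" and
    eq: "AE x in weight_measure \<mu>. w x powr d = v x * enn2real (maximal_function (weight_measure \<mu>) g x) powr (1 - 1)"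
    using h unfolding hat_A_def by auto
  have "AE x in lebesgue. w x powr d = v x"
    using eq[unfolded AE_weight_measure_iff[OF \<mu>]] weight_pos[OF ww]
  proof eventually_elim
    case (elim x)
    \<comment> \<open>If the real value of the maximal function were 0, \<open>0 powr 0 = 0\<close>
      would contradict this; otherwise the power is 1.\<close>
    have "w x powr d \<noteq> 0" using elim(2) by simp
    then show ?case using elim(1) by (auto split: if_splits)
  qed
  then show ?thesis using ww v by blast
qed

text \<open>The d-th power of the weight is v (M_\<mu> h)^(-d/p'), and -d/p' = 1 - r for r = 1 +
  d/p'. Positivity and finiteness of M_\<mu> h make it a weight, since \<open>enn2real\<close> and
  \<open>powr\<close> would give the value 0 otherwise.\<close>

lemma hat_A_off_I:
  fixes v :: "'a::euclidean_space \<Rightarrow> real"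
  assumes \<mu>: "spread \<mu>" and v: "v \<in> A1_class (weight_measure \<mu>)" and h [measurable]: "h \<in> borel_measurable lebesgue"
    and Y: "AE x in lebesgue. 0 < maximal_function (weight_measure \<mu>) h x \<and> maximal_function (weight_measure \<mu>) h x < \<infinity>"
    and p: "1 \<le> p" and d: "0 < d"
  shows "(\<lambda>x. v x powr (1 / d) * enn2real (maximal_function (weight_measure \<mu>) h x) powr (- (1 - 1 / p)))
     \<in> hat_A_off p d (weight_measure \<mu>)" (is "?w \<in> _")
proof -
  interpret mu: spread_weight \<mu> using \<mu> by unfold_locales
  obtain D where "doubling_measure (weight_measure \<mu>) D" using mu.doubling_weight_measure by blast
  then interpret D: doubling_measure "weight_measure \<mu>" D .
  let ?Y = "\<lambda>x. enn2real (maximal_function (weight_measure \<mu>) h x)"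
  have wv: "weight v" using v by (simp add: A1_class_def)
  have [measurable]: "v \<in> borel_measurable lebesgue" using wv by (simp add: weight_def)
  have Ypos: "AE x in lebesgue. 0 < ?Y x"
    using Y by (auto elim!: eventually_mono simp: enn2real_positive_iff)
  have "?w \<in> borel_measurable lebesgue" by measurable
  then have ww: "weight ?w"
    unfolding weight_def using weight_pos[OF wv] Ypos by (auto elim: eventually_elim2)
  have r: "real_of_ereal (ereal d / conjugate_exponent p) = d * (1 - 1 / p)"
    using p by (auto simp: conjugate_exponent_def field_simps)
  have "(\<lambda>x. ?w x powr d) \<in> hat_A (1 + d * (1 - 1 / p)) (weight_measure \<mu>)"
    unfolding hat_A_def AE_weight_measure_iff[OF mu.weight_m]
  proof (intro CollectI conjI bexI[OF _ v] bexI[OF _ h])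
    show "weight (\<lambda>x. ?w x powr d)" by (rule weight_powr[OF ww])
    show "AE x in lebesgue. maximal_function (weight_measure \<mu>) h x < \<infinity>"
      using Y by (auto elim: eventually_mono)
    show "AE x in lebesgue. ?w x powr d = v x * ?Y x powr (1 - (1 + d * (1 - 1 / p)))"
      using weight_pos[OF wv] Ypos
    proof eventually_elim
      case (elim x)
      then show ?case using d by (simp add: powr_mult powr_powr algebra_simps)
    qed
  qed
  then show ?thesis unfolding hat_A_off_def r using ww by blast
qed

text \<open>The weak type bound at the levels n + 1 leaves no mass for the value
  \<infinity>.\<close>

lemma (in doubling_measure) maximal_function_finite:
  assumes g: "g \<in> borel_measurable lebesgue" and fin: "(\<integral>\<^sup>+x. ennreal \<bar>g x\<bar> \<partial>K) < \<infinity>"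
  shows "AE x in K. maximal_function K g x < \<infinity>"
proof -
  let ?N = "{x. maximal_function K g x = \<infinity>}"
  obtain I where I: "0 \<le> I" "(\<integral>\<^sup>+x. ennreal \<bar>g x\<bar> \<partial>K) = ennreal I"
    using fin by (cases "\<integral>\<^sup>+x. ennreal \<bar>g x\<bar> \<partial>K") auto
  have N: "?N \<in> sets K"
  proof -
    have "{x\<in>space lebesgue. maximal_function K g x = \<infinity>} \<in> sets lebesgue" using g by measurable
    then show ?thesis by simp
  qed
  have le: "ennreal (real (Suc n)) * emeasure K ?N \<le> ennreal (D * I)" for n
  proof -
    have "ennreal (real (Suc n)) * emeasure K ?N \<le> ennreal (real (Suc n)) * emeasure K {x. ennreal (real (Suc n)) < maximal_function K g x}"
      using open_superlevel_set[OF g] by (intro mult_left_mono emeasure_mono) auto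
    also have "\<dots> \<le> ennreal D * (\<integral>\<^sup>+x. ennreal \<bar>g x\<bar> \<partial>K)"
      by (rule weak_type[OF g]) simp
    finally show ?thesis using I D_nonneg by (simp add: ennreal_mult)
  qed
  have "emeasure K ?N = 0"
  proof (cases "emeasure K ?N")
    case (real r)
    have "r = 0"
    proof (rule ccontr)
      assume "r \<noteq> 0"
      then have "0 < r" using real by simp
      then obtain n where n: "D * I / r < real n" using reals_Archimedean2 by blast
      have "ennreal (real (Suc n) * r) \<le> ennreal (D * I)"
        using le[of n] real by (subst ennreal_mult) auto
      then have "real (Suc n) * r \<le> D * I" using I D_nonneg by (subst (asm) ennreal_le_iff) auto
      then show False using n \<open>0 < r\<close> by (simp add: field_simps)
    qed
    then show ?thesis using real by simp
  next
    case top
    then show ?thesis using le[of 0] by (simp add: top_unique)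
  qed
  then have "?N \<in> null_sets K" using N by (intro null_setsI) auto
  then show ?thesis by (rule AE_I') (auto simp: less_top[symmetric])
qed

text \<open>Some large cube contains both x and the given cube. This is the purpose of the indicator
  in h: it keeps M_\<mu> h positive even if every f_k vanishes.\<close>

lemma (in doubling_measure) maximal_function_pos:
  assumes g: "g \<in> borel_measurable lebesgue" and Q: "0 < snd p" "AE y in K. y \<in> cube p \<longrightarrow> 1 \<le> \<bar>g y\<bar>"
  shows "0 < maximal_function K g x"
proof -
  obtain n where n: "norm (fst p) + norm x + snd p \<le> real n" using real_arch_simple by blast
  define q where "q = (- (real (Suc n) *\<^sub>R One) :: 'a, 2 * real (Suc n))"
  have q: "0 < snd q" by (simp add: q_def)
  have mem: "y \<in> cube q" if "\<And>i. i \<in> Basis \<Longrightarrow> \<bar>y \<bullet> i\<bar> \<le> real (Suc n)" for y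
    unfolding mem_cube
  proof
    fix i :: 'a assume i: "i \<in> Basis"
    show "fst q \<bullet> i \<le> y \<bullet> i \<and> y \<bullet> i \<le> fst q \<bullet> i + snd q"
      using that[OF i] i by (simp add: q_def abs_le_iff)
  qed
  have "x \<in> cube q"
  proof (rule mem)
    fix i :: 'a assume i: "i \<in> Basis"
    show "\<bar>x \<bullet> i\<bar> \<le> real (Suc n)"
      using Basis_le_norm[OF i, of x] n Q(1) norm_ge_zero[of "fst p"] of_nat_Suc[of n, where 'a=real] by linarith
  qed
  have sub: "cube p \<subseteq> cube q"
  proof
    fix y assume y: "y \<in> cube p"
    show "y \<in> cube q"
    proof (rule mem)
      fix i :: 'a assume i: "i \<in> Basis"
      have "fst p \<bullet> i \<le> y \<bullet> i" "y \<bullet> i \<le> fst p \<bullet> i + snd p" using y i by (auto simp: mem_cube)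
      then show "\<bar>y \<bullet> i\<bar> \<le> real (Suc n)"
        using Basis_le_norm[OF i, of "fst p"] n norm_ge_zero[of x] Q(1) of_nat_Suc[of n, where 'a=real] by linarith
    qed
  qed
  have "0 < emeasure K (cube p)" by (rule cube_pos[OF Q(1)])
  also have "\<dots> = (\<integral>\<^sup>+y. indicator (cube p) y \<partial>K)" by simp
  also have "\<dots> \<le> (\<integral>\<^sup>+y\<in>cube q. ennreal \<bar>g y\<bar> \<partial>K)"
    using Q(2) sub by (intro nn_integral_mono_AE) (auto elim!: eventually_mono simp: indicator_def)
  finally show ?thesis
    using maximal_function_greater_iff[of 0 g x] q \<open>x \<in> cube q\<close> unfolding mult_zero_left by blast
qed

text \<open>On {|f| > s} one has W \<le> B s^(-(p-r)) w. The power \<alpha>/p of this factor times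
  s^(\<alpha>-1) is a multiple of s^(\<alpha> r/p - 1), the kernel of the norm with indices r and
  \<alpha> r/p.\<close>

lemma lorentz_norm_transfer:
  fixes f :: "'a::euclidean_space \<Rightarrow> complex"
  assumes w: "weight w" and W: "weight W" and f [measurable]: "f \<in> borel_measurable lebesgue"
    and r: "0 < r" and p: "r \<le> p" and \<alpha>: "0 < \<alpha>" and B: "0 < B"
    and le: "AE x in lebesgue. f x \<noteq> 0 \<longrightarrow> W x \<le> B * norm (f x) powr (- (p - r)) * w x"
    and norm: "lorentz_norm r (\<alpha> * r / p) w f \<le> 1"
  shows "lorentz_norm p \<alpha> W f \<le> ennreal ((p / r * B powr (\<alpha> / p)) powr (1 / \<alpha>))"
proof -
  have p0: "0 < p" using r p by simp
  define \<phi> where "\<phi> s = emeasure (weight_measure w) {x. s < norm (f x)}" for s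
  have "antimono \<phi>"
    unfolding \<phi>_def using f by (intro distribution_antimono) (auto cong: measurable_cong_sets)
  then have [measurable]: "\<phi> \<in> borel_measurable borel" by (rule distribution_measurable)
  have E: "{x. s < norm (f x)} \<in> sets lebesgue" for s
  proof -
    have "{x\<in>space lebesgue. s < norm (f x)} \<in> sets lebesgue" by measurable
    then show ?thesis by simp
  qed
  let ?J = "\<integral>\<^sup>+s\<in>{0<..}. ennreal (s powr (\<alpha> * r / p - 1)) * ennreal_powr (\<phi> s) (\<alpha> / p) \<partial>lborel"
  have N1: "ennreal r * ?J \<le> 1"
  proof -
    have a: "0 < \<alpha> * r / p" using \<alpha> r p0 by simp
    have "ennreal_powr (ennreal r * ?J) (1 / (\<alpha> * r / p)) \<le> 1"
      using norm r by (simp add: lorentz_norm_def \<phi>_def)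
    then have "ennreal_powr (ennreal_powr (ennreal r * ?J) (1 / (\<alpha> * r / p))) (\<alpha> * r / p) \<le> ennreal_powr (ennreal 1) (\<alpha> * r / p)"
      using a by (intro ennreal_powr_mono) auto
    moreover have "ennreal_powr (ennreal 1) (\<alpha> * r / p) = 1" by (subst ennreal_powr_ennreal) auto
    moreover have "ennreal_powr (ennreal_powr (ennreal r * ?J) (1 / (\<alpha> * r / p))) (\<alpha> * r / p) = ennreal r * ?J"
      using a \<alpha> r p0 by (subst ennreal_powr_powr) auto
    ultimately show ?thesis by simp
  qed
  have "(\<integral>\<^sup>+s\<in>{0<..}. ennreal (s powr (\<alpha> - 1)) * ennreal_powr (emeasure (weight_measure W) {x. s < norm (f x)}) (\<alpha> / p) \<partial>lborel)
    \<le> (\<integral>\<^sup>+s. ennreal (B powr (\<alpha> / p)) * (ennreal (s powr (\<alpha> * r / p - 1)) * ennreal_powr (\<phi> s) (\<alpha> / p) * indicator {0<..} s) \<partial>lborel)"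
  proof (rule nn_integral_mono)
    fix s :: real
    show "ennreal (s powr (\<alpha> - 1)) * ennreal_powr (emeasure (weight_measure W) {x. s < norm (f x)}) (\<alpha> / p) * indicator {0<..} s
      \<le> ennreal (B powr (\<alpha> / p)) * (ennreal (s powr (\<alpha> * r / p - 1)) * ennreal_powr (\<phi> s) (\<alpha> / p) * indicator {0<..} s)"
    proof (cases "0 < s")
      case True
      have "emeasure (weight_measure W) {x. s < norm (f x)} \<le> ennreal (B * s powr (- (p - r))) * \<phi> s"
        unfolding \<phi>_def
      proof (rule weight_measure_mono[OF W w E])
        show "AE x in lebesgue. x \<in> {x. s < norm (f x)} \<longrightarrow> W x \<le> B * s powr (- (p - r)) * w x"
          using le weight_pos[OF w]
        proof eventually_elim
          case (elim x)
          show ?case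
          proof
            assume x: "x \<in> {x. s < norm (f x)}"
            then have "f x \<noteq> 0" using True by auto
            then have "W x \<le> B * norm (f x) powr (- (p - r)) * w x" using elim by blast
            also have "\<dots> \<le> B * s powr (- (p - r)) * w x"
              using x True p B elim by (intro mult_right_mono mult_left_mono powr_mono2') auto
            finally show "W x \<le> B * s powr (- (p - r)) * w x" .
          qed
        qed
      qed (use B in simp)
      then have "ennreal_powr (emeasure (weight_measure W) {x. s < norm (f x)}) (\<alpha> / p)
          \<le> ennreal_powr (ennreal (B * s powr (- (p - r))) * \<phi> s) (\<alpha> / p)"
        using \<alpha> p0 by (intro ennreal_powr_mono) auto
      also have "\<dots> = ennreal ((B * s powr (- (p - r))) powr (\<alpha> / p)) * ennreal_powr (\<phi> s) (\<alpha> / p)"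
        using B \<alpha> p0 by (intro ennreal_powr_mult) auto
      finally have "ennreal (s powr (\<alpha> - 1)) * ennreal_powr (emeasure (weight_measure W) {x. s < norm (f x)}) (\<alpha> / p)
          \<le> ennreal (s powr (\<alpha> - 1)) * (ennreal ((B * s powr (- (p - r))) powr (\<alpha> / p)) * ennreal_powr (\<phi> s) (\<alpha> / p))"
        by (rule mult_left_mono) simp
      also have "\<dots> = ennreal (s powr (\<alpha> - 1) * (B * s powr (- (p - r))) powr (\<alpha> / p)) * ennreal_powr (\<phi> s) (\<alpha> / p)"
        by (simp add: ennreal_mult mult.assoc)
      also have "s powr (\<alpha> - 1) * (B * s powr (- (p - r))) powr (\<alpha> / p) = B powr (\<alpha> / p) * s powr (\<alpha> * r / p - 1)"
      proof -
        have "\<alpha> - 1 + - (p - r) * (\<alpha> / p) = \<alpha> * r / p - 1" using p0 by (simp add: field_simps)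
        moreover have "s powr (\<alpha> - 1) * (B * s powr (- (p - r))) powr (\<alpha> / p)
            = B powr (\<alpha> / p) * (s powr (\<alpha> - 1) * s powr (- (p - r) * (\<alpha> / p)))"
          using True B by (simp add: powr_mult powr_powr)
        ultimately show ?thesis by (simp only: powr_add[symmetric])
      qed
      finally show ?thesis using True by (simp add: ennreal_mult mult.assoc)
    qed simp
  qed
  also have "\<dots> = ennreal (B powr (\<alpha> / p)) * ?J"
    by (rule nn_integral_cmult) measurable
  finally have "ennreal p * (\<integral>\<^sup>+s\<in>{0<..}. ennreal (s powr (\<alpha> - 1)) * ennreal_powr (emeasure (weight_measure W) {x. s < norm (f x)}) (\<alpha> / p) \<partial>lborel)
     \<le> ennreal p * (ennreal (B powr (\<alpha> / p)) * ?J)"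
    by (rule mult_left_mono) simp
  also have "\<dots> = ennreal (p / r * B powr (\<alpha> / p)) * (ennreal r * ?J)"
  proof -
    have "p * B powr (\<alpha> / p) = p / r * B powr (\<alpha> / p) * r" using r by simp
    then have "ennreal (p * B powr (\<alpha> / p)) = ennreal (p / r * B powr (\<alpha> / p) * r)" by (simp only:)
    then have *: "ennreal p * ennreal (B powr (\<alpha> / p)) = ennreal (p / r * B powr (\<alpha> / p)) * ennreal r"
      using p0 r by (subst (1 2) ennreal_mult[symmetric]) (auto simp: ac_simps)
    show ?thesis by (simp only: mult.assoc[symmetric] *)
  qed
  also have "\<dots> \<le> ennreal (p / r * B powr (\<alpha> / p)) * 1"
    using N1 by (rule mult_left_mono) simp
  finally have "lorentz_norm p \<alpha> W f \<le> ennreal_powr (ennreal (p / r * B powr (\<alpha> / p))) (1 / \<alpha>)"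
    unfolding lorentz_norm_def using \<alpha> by (intro ennreal_powr_mono) auto
  then show ?thesis using p0 r by (simp add: ennreal_powr_ennreal)
qed

text \<open>Where X > t^q the weak bound for X applies; elsewhere n \<le> t^(q c) W. Since q c = q0
  - q, both parts have mass at most a multiple of t^(-q).\<close>

lemma weak_lorentz_norm_transfer:
  fixes g :: "'a::euclidean_space \<Rightarrow> complex"
  assumes n: "weight n" and W: "weight W" and g [measurable]: "g \<in> borel_measurable lebesgue"
    and X [measurable]: "X \<in> borel_measurable lebesgue"
    and q: "0 < q" "0 < q0" and c: "c = q0 / q - 1" "0 \<le> c" and H: "0 \<le> H" and K: "0 \<le> K"
    and weak: "\<And>lv. 0 < lv \<Longrightarrow> ennreal lv * emeasure (weight_measure n) {x. ennreal lv < X x} \<le> ennreal H"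
    and le: "AE x in lebesgue. \<exists>\<xi>\<ge>0. X x = ennreal \<xi> \<and> n x \<le> \<xi> powr c * W x"
    and norm: "weak_lorentz_norm q0 W g \<le> ennreal K"
  shows "weak_lorentz_norm q n g \<le> ennreal ((H + K powr q0) powr (1 / q))"
  unfolding weak_lorentz_norm_def
proof (rule SUP_least)
  fix t :: real assume "t \<in> {0<..}"
  then have t: "0 < t" by simp
  define E where "E = {x. t < norm (g x)}"
  have E: "E \<in> sets lebesgue"
  proof -
    have "{x\<in>space lebesgue. t < norm (g x)} \<in> sets lebesgue" by measurable
    then show ?thesis by (simp add: E_def)
  qed
  define lv where "lv = t powr q"
  have lv: "0 < lv" using t by (simp add: lv_def)
  have A: "{x. ennreal lv < X x} \<in> sets lebesgue" "{x. X x \<le> ennreal lv} \<in> sets lebesgue"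
  proof -
    have "{x\<in>space lebesgue. ennreal lv < X x} \<in> sets lebesgue" "{x\<in>space lebesgue. X x \<le> ennreal lv} \<in> sets lebesgue" by measurable
    then show "{x. ennreal lv < X x} \<in> sets lebesgue" "{x. X x \<le> ennreal lv} \<in> sets lebesgue" by simp_all
  qed
  have WE: "emeasure (weight_measure W) E \<le> ennreal ((K / t) powr q0)"
  proof -
    have "ennreal t * ennreal_powr (emeasure (weight_measure W) E) (1 / q0) \<le> ennreal K"
      using norm SUP_upper[of t "{0<..}"] t unfolding weak_lorentz_norm_def E_def
      by (auto intro: order_trans simp: SUP_le_iff)
    then have "ennreal (1 / t) * (ennreal t * ennreal_powr (emeasure (weight_measure W) E) (1 / q0)) \<le> ennreal (1 / t) * ennreal K"
      by (rule mult_left_mono) simp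
    then have "ennreal_powr (emeasure (weight_measure W) E) (1 / q0) \<le> ennreal (K / t)"
      using t K by (simp add: mult.assoc[symmetric] ennreal_mult[symmetric])
    then have "ennreal_powr (ennreal_powr (emeasure (weight_measure W) E) (1 / q0)) q0 \<le> ennreal_powr (ennreal (K / t)) q0"
      using q by (intro ennreal_powr_mono) auto
    then show ?thesis using q t K by (simp add: ennreal_powr_powr ennreal_powr_ennreal)
  qed
  have "emeasure (weight_measure n) E \<le> emeasure (weight_measure n) ({x. ennreal lv < X x} \<union> (E \<inter> {x. X x \<le> ennreal lv}))"
    using A E by (intro emeasure_mono) auto
  also have "\<dots> \<le> emeasure (weight_measure n) {x. ennreal lv < X x} + emeasure (weight_measure n) (E \<inter> {x. X x \<le> ennreal lv})"
    using A E by (intro emeasure_subadditive) auto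
  also have "\<dots> \<le> ennreal (H / lv) + ennreal (K powr q0 / lv)"
  proof (rule add_mono)
    have "ennreal (1 / lv) * (ennreal lv * emeasure (weight_measure n) {x. ennreal lv < X x}) \<le> ennreal (1 / lv) * ennreal H"
      using weak[OF lv] by (rule mult_left_mono) simp
    then show "emeasure (weight_measure n) {x. ennreal lv < X x} \<le> ennreal (H / lv)"
      using lv H by (simp add: mult.assoc[symmetric] ennreal_mult[symmetric])
    have "emeasure (weight_measure n) (E \<inter> {x. X x \<le> ennreal lv}) \<le> ennreal (lv powr c) * emeasure (weight_measure W) (E \<inter> {x. X x \<le> ennreal lv})"
    proof (rule weight_measure_mono[OF n W])
      show "AE x in lebesgue. x \<in> E \<inter> {x. X x \<le> ennreal lv} \<longrightarrow> n x \<le> lv powr c * W x"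
        using le weight_pos[OF W]
      proof eventually_elim
        case (elim x)
        show ?case
        proof
          assume x: "x \<in> E \<inter> {x. X x \<le> ennreal lv}"
          obtain \<xi> where \<xi>: "0 \<le> \<xi>" "X x = ennreal \<xi>" "n x \<le> \<xi> powr c * W x" using elim by blast
          have "\<xi> \<le> lv" using x \<xi> lv by (auto simp: ennreal_le_iff)
          then have "\<xi> powr c \<le> lv powr c" using \<xi> c by (intro powr_mono2) auto
          then have "\<xi> powr c * W x \<le> lv powr c * W x" using elim by (intro mult_right_mono) auto
          then show "n x \<le> lv powr c * W x" using \<xi> by simp
        qed
      qed
    qed (use A E in auto)
    also have "\<dots> \<le> ennreal (lv powr c) * ennreal ((K / t) powr q0)"
      using A E by (intro mult_left_mono order_trans[OF _ WE] emeasure_mono) auto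
    also have "\<dots> = ennreal (K powr q0 / lv)"
    proof -
      have "q * c = q0 - q" using q c by (simp add: field_simps)
      then have "lv powr c * (K / t) powr q0 = K powr q0 / lv"
        using t K q by (simp add: lv_def powr_powr powr_divide powr_diff)
      then show ?thesis by (simp add: ennreal_mult[symmetric])
    qed
    finally show "emeasure (weight_measure n) (E \<inter> {x. X x \<le> ennreal lv}) \<le> ennreal (K powr q0 / lv)" .
  qed
  also have "\<dots> = ennreal ((H + K powr q0) / lv)"
    using H lv by (subst ennreal_plus[symmetric]) (auto simp: add_divide_distrib)
  finally have "ennreal_powr (emeasure (weight_measure n) E) (1 / q) \<le> ennreal_powr (ennreal ((H + K powr q0) / lv)) (1 / q)"
    using q by (intro ennreal_powr_mono) auto
  also have "\<dots> = ennreal ((H + K powr q0) powr (1 / q) / t)"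
    using H lv t q by (subst ennreal_powr_ennreal) (auto simp: powr_divide lv_def powr_powr)
  finally have "ennreal t * ennreal_powr (emeasure (weight_measure n) E) (1 / q) \<le> ennreal t * ennreal ((H + K powr q0) powr (1 / q) / t)"
    by (rule mult_left_mono) simp
  also have "\<dots> = ennreal ((H + K powr q0) powr (1 / q))"
    using t by (simp add: ennreal_mult[symmetric])
  finally show "ennreal t * ennreal_powr (emeasure (weight_measure n) {x. t < norm (g x)}) (1 / q) \<le> ennreal ((H + K powr q0) powr (1 / q))"
    unfolding E_def .
qed

text \<open>Both norms are homogeneous, so a pair violating the inequality can be normalized. The
  factor is 1 / a, except that a = 0 and b = \<infinity> are treated apart.\<close>

lemma ennreal_scale_exists:
  fixes a b :: ennreal and N :: real
  assumes "ennreal N * a < b" "0 < N"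
  shows "\<exists>c>0. ennreal c * a \<le> 1 \<and> ennreal N < ennreal c * b"
proof (cases a)
  case top
  then show ?thesis using assms by (simp add: ennreal_mult_top)
next
  case (real r)
  show ?thesis
  proof (cases b)
    case top
    define c where "c = 1 / (r + 1)"
    have "0 < c" "c * r \<le> 1" using real by (auto simp: c_def)
    then show ?thesis using real top
      by (intro exI[of _ c]) (auto simp: ennreal_mult_top ennreal_mult[symmetric])
  next
    case b: (real s)
    have Nr: "N * r < s" using assms real b by (simp add: ennreal_mult[symmetric] ennreal_less_iff)
    have s: "0 < s" using Nr assms real by (smt (verit) mult_nonneg_nonneg)
    show ?thesis
    proof (cases "r = 0")
      case True
      define c where "c = (N + 1) / s"
      have "0 < c" "N < c * s" using s assms by (auto simp: c_def)
      then show ?thesis using True real b s assms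
        by (intro exI[of _ c]) (auto simp: ennreal_mult[symmetric] ennreal_less_iff)
    next
      case False
      define c where "c = 1 / r"
      have "0 < c" "N < c * s" "c * r = 1" using False real Nr by (auto simp: c_def field_simps)
      then show ?thesis using real b s assms
        by (intro exI[of _ c]) (auto simp: ennreal_mult[symmetric] ennreal_less_iff)
    qed
  qed
qed

lemma reciprocal_bounds:
  assumes "0 < q" "ereal q < s"
  shows "0 \<le> real_of_ereal (1 / s)" "q * real_of_ereal (1 / s) < 1"
proof -
  have "0 \<le> real_of_ereal (1 / s) \<and> q * real_of_ereal (1 / s) < 1"
  proof (cases s)
    case (real r)
    then have "q < r" using assms(2) by simp
    then show ?thesis using real assms(1) by (simp add: one_ereal_def)
  qed (use assms(2) in auto)
  then show "0 \<le> real_of_ereal (1 / s)" "q * real_of_ereal (1 / s) < 1" by auto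
qed

theorem theorem2p2:
  fixes \<mu> :: "real ^ 'n \<Rightarrow> real"
    and r\<^sub>0 p\<^sub>0 q\<^sub>0 \<alpha> \<delta>\<^sub>0 q \<delta>\<^sub>1 :: real
    and s\<^sub>0 :: ereal
    and F :: "((real ^ 'n \<Rightarrow> complex) \<times> (real ^ 'n \<Rightarrow> complex)) set"
  assumes "\<mu> \<in> A_infinity"
    and "1 \<le> r\<^sub>0" and "r\<^sub>0 \<le> p\<^sub>0"
    and "0 < q\<^sub>0" and "ereal q\<^sub>0 < s\<^sub>0"
    and "0 < \<alpha>" and "\<alpha> \<le> p\<^sub>0"
    and "1 / \<delta>\<^sub>0 = 1 / q\<^sub>0 - real_of_ereal (1 / s\<^sub>0)"
    and "\<And>f g. (f, g) \<in> F \<Longrightarrow> f \<in> borel_measurable lebesgue \<and> g \<in> borel_measurable lebesgue"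
    and "\<forall>w \<in> hat_A_off (p\<^sub>0 / r\<^sub>0) (\<delta>\<^sub>0 / r\<^sub>0) (weight_measure \<mu>). \<exists>C>0. \<forall>(f, g) \<in> F.
           weak_lorentz_norm q\<^sub>0 (\<lambda>x. w x powr (q\<^sub>0 / r\<^sub>0) * \<mu> x powr (q\<^sub>0 / \<delta>\<^sub>0)) g
           \<le> ennreal C *
             lorentz_norm p\<^sub>0 \<alpha> (\<lambda>x. w x powr (p\<^sub>0 / r\<^sub>0) * \<mu> x powr (1 - p\<^sub>0 / r\<^sub>0)) f"
    and "0 < q" and "ereal q < s\<^sub>0"
    and "1 / q - 1 / q\<^sub>0 = 1 / r\<^sub>0 - 1 / p\<^sub>0"
    and "1 / \<delta>\<^sub>1 = 1 / q - real_of_ereal (1 / s\<^sub>0)"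
  shows "\<forall>w \<in> hat_A_off 1 (\<delta>\<^sub>1 / r\<^sub>0) (weight_measure \<mu>). \<exists>C>0. \<forall>(f, g) \<in> F.
           weak_lorentz_norm q (\<lambda>x. w x powr (q / r\<^sub>0) * \<mu> x powr (q / \<delta>\<^sub>1)) g
           \<le> ennreal C * lorentz_norm r\<^sub>0 (\<alpha> * r\<^sub>0 / p\<^sub>0) w f"
proof (rule ballI, rule ccontr)
  fix w
  assume w: "w \<in> hat_A_off 1 (\<delta>\<^sub>1 / r\<^sub>0) (weight_measure \<mu>)"
  let ?n = "\<lambda>x. w x powr (q / r\<^sub>0) * \<mu> x powr (q / \<delta>\<^sub>1)"
  assume contra: "\<not> (\<exists>C>0. \<forall>(f, g) \<in> F. weak_lorentz_norm q ?n g
           \<le> ennreal C * lorentz_norm r\<^sub>0 (\<alpha> * r\<^sub>0 / p\<^sub>0) w f)"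
  note meas = assms(9)

  \<comment> \<open>Relations between the exponents\<close>
  define S where "S = real_of_ereal (1 / s\<^sub>0)"
  have S: "0 \<le> S" "q * S < 1" "q\<^sub>0 * S < 1"
    unfolding S_def using reciprocal_bounds assms by blast+
  note q = \<open>0 < q\<close> and q0 = \<open>0 < q\<^sub>0\<close> and \<alpha> = \<open>0 < \<alpha>\<close>
  have r0: "0 < r\<^sub>0" and p0: "0 < p\<^sub>0" using assms by auto
  have id0: "1 / \<delta>\<^sub>0 = 1 / q\<^sub>0 - S" and id1: "1 / \<delta>\<^sub>1 = 1 / q - S" using assms by (auto simp: S_def)
  have "0 < 1 / \<delta>\<^sub>0" "0 < 1 / \<delta>\<^sub>1"
    unfolding id0 id1 using S q q0 by (auto simp: field_simps)
  then have d0: "0 < \<delta>\<^sub>0" and d1: "0 < \<delta>\<^sub>1" by simp_all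
  \<comment> \<open>The common amount by which 1/q exceeds 1/q_0 and 1/\<delta>_1 exceeds
    1/\<delta>_0.\<close>
  define \<kappa> where "\<kappa> = 1 / r\<^sub>0 - 1 / p\<^sub>0"
  have \<kappa>: "0 \<le> \<kappa>" using assms r0 by (simp add: \<kappa>_def field_simps)
  have \<kappa>_q: "1 / q = 1 / q\<^sub>0 + \<kappa>" and \<kappa>_d: "1 / \<delta>\<^sub>1 = 1 / \<delta>\<^sub>0 + \<kappa>"
    using assms id0 id1 by (auto simp: \<kappa>_def)
  define \<sigma> where "\<sigma> = q * S"
  have \<sigma>: "0 \<le> \<sigma>" "\<sigma> < 1" using S q by (auto simp: \<sigma>_def)
  have q_d1: "q / \<delta>\<^sub>1 = 1 - \<sigma>"
  proof -
    have "q / \<delta>\<^sub>1 = q * (1 / q - S)" by (simp add: id1[symmetric])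
    then show ?thesis using q by (simp add: \<sigma>_def right_diff_distrib)
  qed
  define c where "c = q\<^sub>0 / q - 1"
  have c: "c = \<kappa> * q\<^sub>0"
  proof -
    have "c = q\<^sub>0 * (1 / q) - 1" by (simp add: c_def)
    then show ?thesis unfolding \<kappa>_q using q0 by (simp add: distrib_left)
  qed
  \<comment> \<open>The exponent of m in the later identity
    \<open>?n x = \<xi> powr c * W1 x\<close>: the first summand is due to \<xi>, the second to
    \<open>W1\<close>.\<close>
  have c_\<sigma>: "\<sigma> * c + q\<^sub>0 / \<delta>\<^sub>0 = q / \<delta>\<^sub>1"
  proof -
    have "q\<^sub>0 / \<delta>\<^sub>0 = q\<^sub>0 * (1 / q\<^sub>0 - S)" by (simp add: id0[symmetric])
    also have "\<dots> = 1 - q\<^sub>0 * S" using q0 by (simp add: right_diff_distrib)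
    finally have "q\<^sub>0 / \<delta>\<^sub>0 = 1 - q\<^sub>0 * S" .
    moreover have "\<sigma> * c = q\<^sub>0 * S - \<sigma>" using q by (simp add: \<sigma>_def c_def right_diff_distrib)
    ultimately show ?thesis unfolding q_d1 by simp
  qed
  \<comment> \<open>The weight on the right hand side of the hypothesis will contain the power
    -\<rho> of M_\<mu> h.\<close>
  define \<rho> where "\<rho> = p\<^sub>0 / r\<^sub>0 - 1"
  have \<rho>: "0 \<le> \<rho>" "\<rho> = \<kappa> * p\<^sub>0" "r\<^sub>0 * \<rho> = p\<^sub>0 - r\<^sub>0"
    using assms r0 p0 by (auto simp: \<rho>_def \<kappa>_def field_simps)

  \<comment> \<open>The measures \<mu> and m = v \<mu>\<close>
  interpret mu: spread_weight \<mu> using A_infinity_spread[OF assms(1)] by unfold_locales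
  have \<mu>: "spread \<mu>" by (rule mu.spread)
  obtain D where "doubling_measure (weight_measure \<mu>) D" using mu.doubling_weight_measure by blast
  then interpret D: doubling_measure "weight_measure \<mu>" D .
  obtain v where ww: "weight w" and v: "v \<in> A1_class (weight_measure \<mu>)" and wv_eq: "AE x in lebesgue. w x powr (\<delta>\<^sub>1 / r\<^sub>0) = v x"
    using hat_A_off_1_D[OF w mu.weight_m] by blast
  have wv: "weight v" using v by (simp add: A1_class_def)
  have w_eq: "AE x in lebesgue. w x = v x powr (r\<^sub>0 / \<delta>\<^sub>1)"
    using wv_eq weight_pos[OF ww]
  proof eventually_elim
    case (elim x)
    have "v x powr (r\<^sub>0 / \<delta>\<^sub>1) = (w x powr (\<delta>\<^sub>1 / r\<^sub>0)) powr (r\<^sub>0 / \<delta>\<^sub>1)" by (simp only: elim(1))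
    also have "\<dots> = w x" using elim(2) r0 d1 by (simp add: powr_powr)
    finally show ?case by simp
  qed
  define m where "m x = v x * \<mu> x" for x
  interpret m: spread_weight m
    using A1_class_spread[OF \<mu> v] unfolding m_def by unfold_locales
  obtain Dm where "doubling_measure (weight_measure m) Dm" using m.doubling_weight_measure by blast
  then interpret Dm: doubling_measure "weight_measure m" Dm .
  obtain A where A: "A > 0" "\<And>h x. h \<in> borel_measurable lebesgue \<Longrightarrow>
      maximal_function (weight_measure \<mu>) h x \<le> ennreal A * maximal_function (weight_measure m) h x"
    using A1_class_maximal_function_le[OF \<mu> v] unfolding m_def by blast
  have [measurable]: "w \<in> borel_measurable lebesgue" "v \<in> borel_measurable lebesgue" "\<mu> \<in> borel_measurable lebesgue"
    using ww wv mu.weight_m by (auto simp: weight_def)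
  have pos: "AE x in lebesgue. 0 < v x \<and> 0 < \<mu> x \<and> 0 < w x \<and> w x = v x powr (r\<^sub>0 / \<delta>\<^sub>1)"
    using weight_pos[OF wv] weight_pos[OF mu.weight_m] weight_pos[OF ww] w_eq by eventually_elim auto
  have sfw: "sigma_finite_measure (weight_measure w)"
  proof -
    have "sigma_finite_measure (lebesgue :: (real ^ 'n) measure)"
      using doubling_measure_lebesgue by (rule doubling_measure.sigma_finite_K)
    then show ?thesis
      unfolding weight_measure_def by (subst sigma_finite_measure.sigma_finite_iff_density_finite) auto
  qed

  \<comment> \<open>A normalized sequence of bad pairs\<close>
  let ?L = "\<lambda>f. lorentz_norm r\<^sub>0 (\<alpha> * r\<^sub>0 / p\<^sub>0) w f"
  \<comment> \<open>The q-th power is 2^(k c) 2^k: the first factor matches the growth coming from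
    the hypothesis, the second is the surplus for the contradiction.\<close>
  define N where "N k = (2 powr (real k * (c + 1))) powr (1 / q)" for k :: nat
  have "\<exists>z. fst z \<in> F \<and> 0 < snd z \<and> ennreal (snd z) * ?L (fst (fst z)) \<le> 1 \<and>
      ennreal (N k) < ennreal (snd z) * weak_lorentz_norm q ?n (snd (fst z))" for k
  proof -
    have N: "0 < N k" by (simp add: N_def)
    then obtain f g where fg: "(f, g) \<in> F" "ennreal (N k) * ?L f < weak_lorentz_norm q ?n g"
      using contra by (force simp: not_le)
    obtain b where "b > 0" "ennreal b * ?L f \<le> 1" "ennreal (N k) < ennreal b * weak_lorentz_norm q ?n g"
      using ennreal_scale_exists[OF fg(2) N] by blast
    then show ?thesis using fg(1) by (intro exI[of _ "((f, g), b)"]) simp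
  qed
  then have "\<forall>k. \<exists>z. fst z \<in> F \<and> 0 < snd z \<and> ennreal (snd z) * ?L (fst (fst z)) \<le> 1 \<and>
      ennreal (N k) < ennreal (snd z) * weak_lorentz_norm q ?n (snd (fst z))" by (rule allI)
  from choice[OF this] obtain z where z: "\<And>k. fst (z k) \<in> F \<and> 0 < snd (z k) \<and> ennreal (snd (z k)) * ?L (fst (fst (z k))) \<le> 1 \<and>
      ennreal (N k) < ennreal (snd (z k)) * weak_lorentz_norm q ?n (snd (fst (z k)))" by blast
  define fg b where "fg k = fst (z k)" and "b k = snd (z k)" for k
  have fg: "\<And>k. fg k \<in> F" and b: "\<And>k. 0 < b k" "\<And>k. ennreal (b k) * ?L (fst (fg k)) \<le> 1"
      "\<And>k. ennreal (N k) < ennreal (b k) * weak_lorentz_norm q ?n (snd (fg k))"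
    using z unfolding fg_def b_def by blast+
  \<comment> \<open>The scaled pairs need not belong to F; the hypothesis will be applied to the
    original pair and multiplied by \<open>b k\<close>.\<close>
  define f where "f k x = of_real (b k) * fst (fg k) x" for k x
  define g where "g k x = of_real (b k) * snd (fg k) x" for k x
  have fgm: "fst (fg k) \<in> borel_measurable lebesgue" "snd (fg k) \<in> borel_measurable lebesgue" for k
    using meas[of "fst (fg k)" "snd (fg k)"] fg[of k] by auto
  have fm [measurable]: "f k \<in> borel_measurable lebesgue" and gm [measurable]: "g k \<in> borel_measurable lebesgue" for k
    unfolding f_def g_def using fgm[of k] by auto
  have Lf: "?L (f k) \<le> 1" for k
  proof -
    have "?L (f k) = ennreal (b k) * ?L (fst (fg k))"
      unfolding f_def using \<alpha> r0 p0 by (intro lorentz_norm_scale b(1) fgm(1)) simp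
    then show ?thesis using b(2)[of k] by simp
  qed
  have Ng: "ennreal (N k) < weak_lorentz_norm q ?n (g k)" for k
    using b(3)[of k] unfolding g_def weak_lorentz_norm_scale[OF b(1)] .

  \<comment> \<open>The test function h\<close>
  define a :: "nat \<Rightarrow> real" where "a k = (1 / 2) ^ k" for k
  have a: "0 < a k" for k by (simp add: a_def)
  \<comment> \<open>Dividing by m turns the integral against m into \<open>a k\<close> times the
    integral of |f_k|^(r_0) w, which is at most 2^(-k).\<close>
  define H where "H k x = a k * norm (f k x) powr r\<^sub>0 * w x / m x" for k x
  have Hm [measurable]: "H k \<in> borel_measurable lebesgue" for k
    unfolding H_def m_def by measurable
  define p :: "(real ^ 'n) \<times> real" where "p = (0, 1)"
  have p: "0 < snd p" by (simp add: p_def)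
  define h' where "h' x = indicator (cube p) x + (\<Sum>k. ennreal (H k x))" for x
  have h'm [measurable]: "h' \<in> borel_measurable lebesgue" unfolding h'_def by measurable
  \<comment> \<open>The class \<open>hat_A\<close> asks for a real function; the series is finite
    almost everywhere.\<close>
  define h where "h x = enn2real (h' x)" for x
  have hm [measurable]: "h \<in> borel_measurable lebesgue" unfolding h_def by measurable
  have "(\<integral>\<^sup>+x. h' x \<partial>weight_measure m) < \<infinity>"
  proof -
    have [measurable]: "H k \<in> borel_measurable (weight_measure m)" for k by (simp add: Dm.measurable_K)
    have "(\<integral>\<^sup>+x. ennreal (H k x) \<partial>weight_measure m) \<le> ennreal (a k)" for k
    proof -
      have "(\<integral>\<^sup>+x. ennreal (H k x) \<partial>weight_measure m) = (\<integral>\<^sup>+x. ennreal (m x) * ennreal (H k x) \<partial>lebesgue)"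
        by (rule nn_integral_weight_measure[OF m.weight_m]) measurable
      also have "\<dots> = (\<integral>\<^sup>+x. ennreal (w x) * (ennreal (a k) * ennreal (norm (f k x) powr r\<^sub>0)) \<partial>lebesgue)"
      proof (rule nn_integral_cong_AE)
        show "AE x in lebesgue. ennreal (m x) * ennreal (H k x) = ennreal (w x) * (ennreal (a k) * ennreal (norm (f k x) powr r\<^sub>0))"
          using weight_pos[OF m.weight_m] weight_pos[OF ww]
        proof eventually_elim
          case (elim x)
          then show ?case using a[of k] by (simp add: H_def ennreal_mult[symmetric])
        qed
      qed
      also have "\<dots> = (\<integral>\<^sup>+x. ennreal (a k) * ennreal (norm (f k x) powr r\<^sub>0) \<partial>weight_measure w)"
        by (rule nn_integral_weight_measure[OF ww, symmetric]) measurable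
      also have "\<dots> = ennreal (a k) * (\<integral>\<^sup>+x. ennreal (norm (f k x) powr r\<^sub>0) \<partial>weight_measure w)"
        by (rule nn_integral_cmult) (use fm[of k] in \<open>simp cong: measurable_cong_sets\<close>)
      also have "\<dots> \<le> ennreal (a k) * 1"
        using assms(6,7) r0 p0 Lf[of k]
        by (intro mult_left_mono lorentz_norm_le_1_integral[OF ww sfw fm, where \<alpha>="\<alpha> * r\<^sub>0 / p\<^sub>0"]) (auto simp: field_simps)
      finally show ?thesis by simp
    qed
    then have "(\<Sum>k. \<integral>\<^sup>+x. ennreal (H k x) \<partial>weight_measure m) \<le> (\<Sum>k. ennreal (a k))"
      by (intro suminf_le) auto
    also have "(\<Sum>k. ennreal (a k)) = ennreal (\<Sum>k. a k)"
    proof (rule suminf_ennreal2)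
      show "summable a" unfolding a_def by (rule summable_geometric) simp
    qed (use a in \<open>simp add: less_imp_le\<close>)
    also have "\<dots> < \<infinity>" by simp
    finally have "(\<integral>\<^sup>+x. (\<Sum>k. ennreal (H k x)) \<partial>weight_measure m) < \<infinity>"
      by (subst nn_integral_suminf) auto
    moreover have "(\<integral>\<^sup>+x. indicator (cube p) x \<partial>weight_measure m) < \<infinity>"
      using m.mass_finite[OF p] by simp
    moreover have "(\<integral>\<^sup>+x. h' x \<partial>weight_measure m)
        = (\<integral>\<^sup>+x. indicator (cube p) x \<partial>weight_measure m) + (\<integral>\<^sup>+x. (\<Sum>k. ennreal (H k x)) \<partial>weight_measure m)"
      unfolding h'_def by (rule nn_integral_add) measurable
    ultimately show ?thesis by (simp add: ennreal_add_less_top)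
  qed
  have h'_fin: "AE x in lebesgue. h' x < \<infinity>"
  proof -
    have "h' \<in> borel_measurable (weight_measure m)" by (simp cong: measurable_cong_sets)
    from nn_integral_PInf_AE[OF this] \<open>(\<integral>\<^sup>+x. h' x \<partial>weight_measure m) < \<infinity>\<close>
    have "AE x in weight_measure m. h' x \<noteq> \<infinity>" by simp
    then show ?thesis unfolding AE_weight_measure_iff[OF m.weight_m]
      by (auto elim!: eventually_mono simp: less_top)
  qed
  have h_nonneg: "0 \<le> h x" for x by (simp add: h_def)
  have h_eq: "AE x in lebesgue. ennreal \<bar>h x\<bar> = h' x"
    using h'_fin by (auto elim!: eventually_mono simp: h_def)
  have hI: "(\<integral>\<^sup>+x. ennreal \<bar>h x\<bar> \<partial>weight_measure m) < \<infinity>"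
  proof -
    have "(\<integral>\<^sup>+x. ennreal \<bar>h x\<bar> \<partial>weight_measure m) = (\<integral>\<^sup>+x. h' x \<partial>weight_measure m)"
      using h_eq unfolding AE_weight_measure_iff[OF m.weight_m, symmetric] by (rule nn_integral_cong_AE)
    then show ?thesis using \<open>(\<integral>\<^sup>+x. h' x \<partial>weight_measure m) < \<infinity>\<close> by simp
  qed
  then obtain I where I: "0 \<le> I" "(\<integral>\<^sup>+x. ennreal \<bar>h x\<bar> \<partial>weight_measure m) = ennreal I"
    by (cases "\<integral>\<^sup>+x. ennreal \<bar>h x\<bar> \<partial>weight_measure m") auto

  \<comment> \<open>The maximal function of h\<close>
  let ?M = "maximal_function (weight_measure \<mu>) h"
  define Y where "Y x = enn2real (?M x)" for x
  have M_pos: "0 < ?M x" for x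
  proof (rule D.maximal_function_pos[OF hm p])
    show "AE y in weight_measure \<mu>. y \<in> cube p \<longrightarrow> 1 \<le> \<bar>h y\<bar>"
      unfolding AE_weight_measure_iff[OF mu.weight_m] using h_eq
    proof eventually_elim
      case (elim y)
      show ?case
      proof
        assume "y \<in> cube p"
        then have "1 \<le> h' y" by (simp add: h'_def)
        then have "ennreal 1 \<le> ennreal \<bar>h y\<bar>" unfolding elim by simp
        then show "1 \<le> \<bar>h y\<bar>" by (subst (asm) ennreal_le_iff) auto
      qed
    qed
  qed
  \<comment> \<open>Finiteness holds for M_m because h is integrable for m, and the A_1 comparison
    carries it over to M_\<mu>.\<close>
  have M_fin: "AE x in lebesgue. ?M x < \<infinity>"
    using Dm.maximal_function_finite[OF hm hI] unfolding AE_weight_measure_iff[OF m.weight_m]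
  proof eventually_elim
    case (elim x)
    have "?M x \<le> ennreal A * maximal_function (weight_measure m) h x" by (rule A(2)[OF hm])
    also have "\<dots> < \<infinity>" using elim by (simp add: ennreal_mult_less_top)
    finally show ?case .
  qed
  have Y: "AE x in lebesgue. 0 < Y x \<and> ?M x = ennreal (Y x)"
    using M_fin
  proof eventually_elim
    case (elim x)
    then show ?case using M_pos[of x] by (auto simp: Y_def enn2real_positive_iff)
  qed
  \<comment> \<open>One function Y dominates all \<open>H k\<close>; this is how a single weight
    serves every pair.\<close>
  have Y_ge: "AE x in lebesgue. \<forall>k. H k x \<le> Y x"
    using D.abs_le_maximal_function[OF hm, unfolded AE_weight_measure_iff[OF mu.weight_m]] h_eq Y
  proof eventually_elim
    case (elim x)
    show ?case
    proof
      fix k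
      have "ennreal (H k x) \<le> (\<Sum>k. ennreal (H k x))"
        using sum_le_suminf[of "\<lambda>k. ennreal (H k x)" "{k}"] by simp
      also have "\<dots> \<le> h' x" by (simp add: h'_def add_increasing)
      also have "\<dots> = ennreal \<bar>h x\<bar>" using elim by simp
      also have "\<dots> \<le> ennreal (Y x)" using elim by simp
      finally show "H k x \<le> Y x" using elim by (subst (asm) ennreal_le_iff) auto
    qed
  qed

  \<comment> \<open>The test weight and the right hand side of the hypothesis\<close>
  define w0 where "w0 x = v x powr (1 / (\<delta>\<^sub>0 / r\<^sub>0)) * Y x powr (- (1 - 1 / (p\<^sub>0 / r\<^sub>0)))" for x
  have w0_eq: "w0 x = v x powr (r\<^sub>0 / \<delta>\<^sub>0) * Y x powr (- (r\<^sub>0 * \<kappa>))" for x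
    unfolding w0_def \<kappa>_def using r0 by (simp add: right_diff_distrib)
  have w0_hat: "w0 \<in> hat_A_off (p\<^sub>0 / r\<^sub>0) (\<delta>\<^sub>0 / r\<^sub>0) (weight_measure \<mu>)"
    unfolding w0_def Y_def
  proof (rule hat_A_off_I[OF \<mu> v hm])
    show "AE x in lebesgue. 0 < ?M x \<and> ?M x < \<infinity>" using M_fin M_pos by simp
    show "1 \<le> p\<^sub>0 / r\<^sub>0" using assms r0 by simp
    show "0 < \<delta>\<^sub>0 / r\<^sub>0" using d0 r0 by simp
  qed
  then have ww0: "weight w0" by (simp add: hat_A_off_def)
  define W where "W x = w0 x powr (p\<^sub>0 / r\<^sub>0) * \<mu> x powr (1 - p\<^sub>0 / r\<^sub>0)" for x
  define W1 where "W1 x = w0 x powr (q\<^sub>0 / r\<^sub>0) * \<mu> x powr (q\<^sub>0 / \<delta>\<^sub>0)" for x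
  have wW: "weight W" and wW1: "weight W1" and wn: "weight ?n"
    unfolding W_def W1_def by (intro weight_mult weight_powr ww0 ww mu.weight_m)+
  obtain C where C: "C > 0" "\<And>f g. (f, g) \<in> F \<Longrightarrow> weak_lorentz_norm q\<^sub>0 W1 g \<le> ennreal C * lorentz_norm p\<^sub>0 \<alpha> W f"
    using bspec[OF assms(10) w0_hat] unfolding W_def W1_def by blast

  define Cp where "Cp = (p\<^sub>0 / r\<^sub>0) powr (1 / \<alpha>)"
  \<comment> \<open>As -\<rho> \<le> 0, replacing Y by its lower bound \<open>H k\<close> can only
    increase W. The result is \<open>a k powr (- \<rho>)\<close> |f_k|^(-(p_0-r_0)) w, the form
    needed for the transfer.\<close>
  have lorentz_W: "lorentz_norm p\<^sub>0 \<alpha> W (f k) \<le> ennreal (Cp * 2 powr (real k * \<kappa>))" for k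
  proof -
    let ?B = "a k powr (- \<rho>)"
    have "lorentz_norm p\<^sub>0 \<alpha> W (f k) \<le> ennreal ((p\<^sub>0 / r\<^sub>0 * ?B powr (\<alpha> / p\<^sub>0)) powr (1 / \<alpha>))"
    proof (rule lorentz_norm_transfer[OF ww wW fm r0 assms(3) \<alpha> _ _ Lf])
      show "0 < ?B" using a[of k] by simp
      show "AE x in lebesgue. f k x \<noteq> 0 \<longrightarrow> W x \<le> ?B * norm (f k x) powr (- (p\<^sub>0 - r\<^sub>0)) * w x"
        using pos Y Y_ge
      proof eventually_elim
        case (elim x)
        show ?case
        proof
          assume fx: "f k x \<noteq> 0"
          define u where "u = norm (f k x)"
          have u: "0 < u" using fx by (simp add: u_def)
          have vx: "0 < v x" "0 < \<mu> x" "0 < w x" "w x = v x powr (r\<^sub>0 / \<delta>\<^sub>1)" and Yx: "0 < Y x" using elim by auto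
          define z where "z = a k * u powr r\<^sub>0 * w x / (v x * \<mu> x)"
          have z: "0 < z" "z \<le> Y x"
            using elim u a[of k] vx by (auto simp: z_def H_def m_def u_def)
          have "W x = v x powr (p\<^sub>0 / \<delta>\<^sub>0) * Y x powr (- \<rho>) * \<mu> x powr (- \<rho>)"
          proof -
            have "r\<^sub>0 * \<kappa> * (p\<^sub>0 / r\<^sub>0) = \<rho>" using r0 \<rho>(2) by simp
            moreover have "1 - p\<^sub>0 / r\<^sub>0 = - \<rho>" by (simp add: \<rho>_def)
            ultimately show ?thesis
              unfolding W_def w0_eq using vx Yx r0 by (simp add: powr_mult powr_powr)
          qed
          also have "\<dots> \<le> v x powr (p\<^sub>0 / \<delta>\<^sub>0) * z powr (- \<rho>) * \<mu> x powr (- \<rho>)"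
            using z \<rho>(1) by (intro mult_right_mono mult_left_mono powr_mono2') auto
          also have "z powr (- \<rho>) = ?B * u powr (- (r\<^sub>0 * \<rho>)) * w x powr (- \<rho>) * (v x powr \<rho> * \<mu> x powr \<rho>)"
          proof -
            have "z powr (- \<rho>) = ?B * u powr (- (r\<^sub>0 * \<rho>)) * w x powr (- \<rho>) / (v x powr (- \<rho>) * \<mu> x powr (- \<rho>))"
              unfolding z_def using u a[of k] vx by (simp add: powr_mult powr_divide powr_powr)
            then show ?thesis using vx by (simp add: powr_minus divide_simps)
          qed
          also have "v x powr (p\<^sub>0 / \<delta>\<^sub>0) * (?B * u powr (- (r\<^sub>0 * \<rho>)) * w x powr (- \<rho>) * (v x powr \<rho> * \<mu> x powr \<rho>)) * \<mu> x powr (- \<rho>)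
             = ?B * u powr (- (r\<^sub>0 * \<rho>)) * (v x powr (p\<^sub>0 / \<delta>\<^sub>0) * w x powr (- \<rho>) * v x powr \<rho>) * (\<mu> x powr \<rho> * \<mu> x powr (- \<rho>))"
            by (simp only: mult_ac)
          also have "\<mu> x powr \<rho> * \<mu> x powr (- \<rho>) = 1"
            using vx by (simp add: powr_add[symmetric])
          also have "v x powr (p\<^sub>0 / \<delta>\<^sub>0) * w x powr (- \<rho>) * v x powr \<rho> = w x"
          proof -
            \<comment> \<open>The powers of v combine because p_0/\<delta>_1 = p_0/\<delta>_0 +
              \<rho>.\<close>
            have "p\<^sub>0 / \<delta>\<^sub>0 + r\<^sub>0 / \<delta>\<^sub>1 * (- \<rho>) + \<rho> = r\<^sub>0 / \<delta>\<^sub>1"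
            proof -
              have "r\<^sub>0 / \<delta>\<^sub>1 * \<rho> = (r\<^sub>0 * \<rho>) * (1 / \<delta>\<^sub>1)" by simp
              also have "\<dots> = p\<^sub>0 * (1 / \<delta>\<^sub>1) - r\<^sub>0 * (1 / \<delta>\<^sub>1)"
                unfolding \<rho>(3) by (rule left_diff_distrib)
              also have "p\<^sub>0 * (1 / \<delta>\<^sub>1) = p\<^sub>0 * (1 / \<delta>\<^sub>0) + \<rho>"
                unfolding \<kappa>_d \<rho>(2) by (simp add: distrib_left)
              finally show ?thesis by simp
            qed
            moreover have "v x powr (p\<^sub>0 / \<delta>\<^sub>0) * w x powr (- \<rho>) * v x powr \<rho> = v x powr (p\<^sub>0 / \<delta>\<^sub>0 + r\<^sub>0 / \<delta>\<^sub>1 * (- \<rho>) + \<rho>)"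
              unfolding vx(4) powr_powr powr_add ..
            ultimately show ?thesis using vx(4) by (simp only:)
          qed
          finally show "W x \<le> ?B * norm (f k x) powr (- (p\<^sub>0 - r\<^sub>0)) * w x"
            unfolding \<rho>(3) u_def by simp
        qed
      qed
    qed
    \<comment> \<open>\<open>a k powr (- \<rho>)\<close> is 2^(k \<rho>), and \<rho> / p_0 =
      \<kappa>.\<close>
    also have "(p\<^sub>0 / r\<^sub>0 * ?B powr (\<alpha> / p\<^sub>0)) powr (1 / \<alpha>) = Cp * 2 powr (real k * \<kappa>)"
    proof -
      have "a k = 2 powr (- real k)" by (simp add: a_def powr_minus powr_realpow power_one_over inverse_eq_divide)
      moreover have "- real k * - \<rho> * (\<alpha> / p\<^sub>0) * (1 / \<alpha>) = real k * \<kappa>"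
        using \<rho>(2) p0 \<alpha> by simp
      ultimately have "(?B powr (\<alpha> / p\<^sub>0)) powr (1 / \<alpha>) = 2 powr (real k * \<kappa>)"
        by (simp only: powr_powr)
      moreover have "(p\<^sub>0 / r\<^sub>0 * ?B powr (\<alpha> / p\<^sub>0)) powr (1 / \<alpha>)
          = (p\<^sub>0 / r\<^sub>0) powr (1 / \<alpha>) * (?B powr (\<alpha> / p\<^sub>0)) powr (1 / \<alpha>)"
        by (rule powr_mult)
      ultimately show ?thesis by (simp only: Cp_def)
    qed
    finally show ?thesis .
  qed
  define C' where "C' = C * Cp"
  have C': "0 \<le> C'" using C by (simp add: C'_def Cp_def)
  have weak_W1: "weak_lorentz_norm q\<^sub>0 W1 (g k) \<le> ennreal (C' * 2 powr (real k * \<kappa>))" for k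
  proof -
    have "weak_lorentz_norm q\<^sub>0 W1 (g k) = ennreal (b k) * weak_lorentz_norm q\<^sub>0 W1 (snd (fg k))"
      unfolding g_def by (rule weak_lorentz_norm_scale[OF b(1)])
    also have "\<dots> \<le> ennreal (b k) * (ennreal C * lorentz_norm p\<^sub>0 \<alpha> W (fst (fg k)))"
      using C(2)[of "fst (fg k)" "snd (fg k)"] fg[of k] by (intro mult_left_mono) auto
    also have "\<dots> = ennreal C * lorentz_norm p\<^sub>0 \<alpha> W (f k)"
      unfolding f_def lorentz_norm_scale[OF b(1) \<alpha> fgm(1)] by (simp only: mult_ac)
    also have "\<dots> \<le> ennreal C * ennreal (Cp * 2 powr (real k * \<kappa>))"
      using lorentz_W by (rule mult_left_mono) simp
    also have "\<dots> = ennreal (C' * 2 powr (real k * \<kappa>))"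
      using C by (simp add: C'_def ennreal_mult'[symmetric] mult.assoc)
    finally show ?thesis .
  qed

  \<comment> \<open>The left hand side of the hypothesis\<close>
  define X where "X x = ennreal (m x powr \<sigma>) * ?M x" for x
  have Xm [measurable]: "X \<in> borel_measurable lebesgue"
    unfolding X_def m_def by measurable
  have n_eq: "AE x in lebesgue. ?n x = m x powr (q / \<delta>\<^sub>1)"
    using pos
  proof eventually_elim
    case (elim x)
    have "w x powr (q / r\<^sub>0) = v x powr (q / \<delta>\<^sub>1)"
      using elim r0 by (simp add: powr_powr)
    then show ?case using elim by (simp add: m_def powr_mult)
  qed
  obtain Cm where Cm: "0 \<le> Cm" "\<And>lv. 0 < lv \<Longrightarrow>
      ennreal lv * emeasure (m.pm (1 - \<sigma>)) {x. ennreal lv < ennreal (m x powr \<sigma>) * maximal_function (weight_measure m) h x} \<le> ennreal Cm * ennreal I"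
    using m.mixed_weak_type[OF \<sigma>] hm unfolding I(2)[symmetric] by blast
  define Hc where "Hc = A * Cm * I"
  have Hc: "0 \<le> Hc" using A Cm I by (simp add: Hc_def)
  \<comment> \<open>The comparison of M_\<mu> with M_m moves the level from lv to lv / A.\<close>
  have weak_X: "ennreal lv * emeasure (weight_measure ?n) {x. ennreal lv < X x} \<le> ennreal Hc" if lv: "0 < lv" for lv
  proof -
    have eq: "weight_measure ?n = m.pm (1 - \<sigma>)"
      using weight_measure_cong[OF wn weight_powr[OF m.weight_m] n_eq] by (simp only: q_d1)
    let ?T = "{x. ennreal (lv / A) < ennreal (m x powr \<sigma>) * maximal_function (weight_measure m) h x}"
    have T: "?T \<in> sets lebesgue"
    proof -
      have "{x\<in>space lebesgue. ennreal (lv / A) < ennreal (m x powr \<sigma>) * maximal_function (weight_measure m) h x} \<in> sets lebesgue"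
        by measurable
      then show ?thesis by simp
    qed
    have sub: "{x. ennreal lv < X x} \<subseteq> ?T"
    proof (intro subsetI CollectI, rule ccontr)
      fix x assume x: "x \<in> {x. ennreal lv < X x}"
        and "\<not> ennreal (lv / A) < ennreal (m x powr \<sigma>) * maximal_function (weight_measure m) h x"
      then have "ennreal (m x powr \<sigma>) * maximal_function (weight_measure m) h x \<le> ennreal (lv / A)" by simp
      then have "ennreal A * (ennreal (m x powr \<sigma>) * maximal_function (weight_measure m) h x) \<le> ennreal A * ennreal (lv / A)"
        by (rule mult_left_mono) simp
      also have "\<dots> = ennreal lv" using A lv by (simp add: ennreal_mult[symmetric])
      finally have "ennreal (m x powr \<sigma>) * (ennreal A * maximal_function (weight_measure m) h x) \<le> ennreal lv"
        by (simp only: mult_ac)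
      moreover have "X x \<le> ennreal (m x powr \<sigma>) * (ennreal A * maximal_function (weight_measure m) h x)"
        unfolding X_def by (intro mult_left_mono A(2) hm) simp
      ultimately show False using x by auto
    qed
    have "ennreal lv * emeasure (weight_measure ?n) {x. ennreal lv < X x} \<le> ennreal lv * emeasure (m.pm (1 - \<sigma>)) ?T"
      unfolding eq using T sub by (intro mult_left_mono emeasure_mono) auto
    also have "\<dots> = ennreal A * (ennreal (lv / A) * emeasure (m.pm (1 - \<sigma>)) ?T)"
      using A lv by (simp add: mult.assoc[symmetric] ennreal_mult[symmetric])
    also have "\<dots> \<le> ennreal A * (ennreal Cm * ennreal I)"
      using A lv by (intro mult_left_mono Cm) auto
    also have "\<dots> = ennreal Hc" using A Cm I by (simp add: Hc_def ennreal_mult[symmetric] mult.assoc)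
    finally show ?thesis .
  qed
  \<comment> \<open>Equality holds for this \<xi>: the powers of Y cancel and those of m add up by
    \<open>c_\<sigma>\<close>.\<close>
  have dom: "AE x in lebesgue. \<exists>\<xi>\<ge>0. X x = ennreal \<xi> \<and> ?n x \<le> \<xi> powr c * W1 x"
    using pos Y n_eq
  proof eventually_elim
    case (elim x)
    have vx: "0 < v x" "0 < \<mu> x" and Yx: "0 < Y x" and nx: "?n x = m x powr (q / \<delta>\<^sub>1)" using elim by auto
    have mx: "0 < m x" using vx by (simp add: m_def)
    define \<xi> where "\<xi> = m x powr \<sigma> * Y x"
    have "X x = ennreal \<xi>" unfolding X_def \<xi>_def using elim by (simp add: ennreal_mult)
    moreover have "?n x = \<xi> powr c * W1 x"
    proof -
      have "W1 x = m x powr (q\<^sub>0 / \<delta>\<^sub>0) * Y x powr (- c)"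
      proof -
        have "r\<^sub>0 * \<kappa> * (q\<^sub>0 / r\<^sub>0) = c" using r0 c by simp
        then show ?thesis unfolding W1_def w0_eq m_def using vx Yx r0 by (simp add: powr_mult powr_powr)
      qed
      moreover have "\<xi> powr c = m x powr (\<sigma> * c) * Y x powr c"
        unfolding \<xi>_def using mx Yx by (simp add: powr_mult powr_powr)
      ultimately have "\<xi> powr c * W1 x = m x powr (\<sigma> * c) * m x powr (q\<^sub>0 / \<delta>\<^sub>0) * (Y x powr c * Y x powr (- c))"
        by (simp only: mult_ac)
      also have "Y x powr c * Y x powr (- c) = 1" using Yx by (simp add: powr_add[symmetric])
      also have "m x powr (\<sigma> * c) * m x powr (q\<^sub>0 / \<delta>\<^sub>0) = m x powr (q / \<delta>\<^sub>1)"
        by (simp only: powr_add[symmetric] c_\<sigma>)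
      finally show ?thesis using nx by simp
    qed
    moreover have "0 \<le> \<xi>" using Yx by (simp add: \<xi>_def)
    ultimately show ?case by (intro exI[of _ \<xi>]) simp
  qed
  \<comment> \<open>After division by 2^(k c) the right hand side is independent of k.\<close>
  have bound: "2 powr real k < Hc + C' powr q\<^sub>0" for k
  proof -
    define K where "K = C' * 2 powr (real k * \<kappa>)"
    have K: "0 \<le> K" using C' by (simp add: K_def)
    have "ennreal (N k) < weak_lorentz_norm q ?n (g k)" by (rule Ng)
    also have "\<dots> \<le> ennreal ((Hc + K powr q\<^sub>0) powr (1 / q))"
    proof (rule weak_lorentz_norm_transfer[OF wn wW1 gm Xm q q0 c_def _ Hc K weak_X dom])
      show "0 \<le> c" unfolding c using \<kappa> q0 by simp
      show "weak_lorentz_norm q\<^sub>0 W1 (g k) \<le> ennreal K" unfolding K_def by (rule weak_W1)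
    qed
    finally have "N k < (Hc + K powr q\<^sub>0) powr (1 / q)" by (simp add: ennreal_less_iff N_def)
    then have lt: "2 powr (real k * (c + 1)) < Hc + K powr q\<^sub>0"
    proof -
      have "\<not> Hc + K powr q\<^sub>0 \<le> 2 powr (real k * (c + 1))"
      proof
        assume "Hc + K powr q\<^sub>0 \<le> 2 powr (real k * (c + 1))"
        then have "(Hc + K powr q\<^sub>0) powr (1 / q) \<le> N k"
          unfolding N_def using q Hc by (intro powr_mono2) auto
        then show False using \<open>N k < (Hc + K powr q\<^sub>0) powr (1 / q)\<close> by simp
      qed
      then show ?thesis by simp
    qed
    have Kq: "K powr q\<^sub>0 = C' powr q\<^sub>0 * 2 powr (real k * c)"
      unfolding K_def c using C' by (simp add: powr_mult powr_powr mult.assoc)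
    have one: "1 \<le> 2 powr (real k * c)"
      unfolding c using \<kappa> q0 by (intro ge_one_powr_ge_zero) auto
    have "2 powr (real k * c) * 2 powr real k = 2 powr (real k * (c + 1))"
      by (simp add: powr_add[symmetric] distrib_left)
    also have "\<dots> < Hc + C' powr q\<^sub>0 * 2 powr (real k * c)" using lt unfolding Kq .
    also have "\<dots> \<le> 2 powr (real k * c) * (Hc + C' powr q\<^sub>0)"
      using one Hc mult_right_mono[OF one Hc] by (simp add: distrib_right mult.commute)
    finally show ?thesis using one by simp
  qed
  obtain k where k: "Hc + C' powr q\<^sub>0 < 2 ^ k"
    using real_arch_pow[of 2 "Hc + C' powr q\<^sub>0"] by auto
  then show False using bound[of k] by (simp add: powr_realpow)
qed

end
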